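(* Consider the inverse problem $y=G(u)+\eta$ with prior $\mu_0=N(0,C_0)$ and posterior $\mu$ given by $$\frac{\mathrm d\mu}{\mathrm d\mu_0}(u)=\frac{\exp(-\Phi(u))}{\int\exp(-\Phi(u))\,\mathrm d\mu_0(u)}.$$ The functional $I(u)=\Phi(u)+\frac12\|u\|_{C_0}^2$ is assumed to be $C^2$ in a neighborhood of $u_{\mathrm{MAP}}=\operatorname{arginf}_u I(u)$. Then the Laplace approximation of $\mu$, given by $$\nu=N\big(u_{\mathrm{MAP}},\,HI(u_{\mathrm{MAP}})^{-1}\big),$$ is equivalently defined by $$\frac{\mathrm d\nu}{\mathrm d\mu_0}(u)=\frac{\exp(-T\Phi(u))}{\int\exp(-T\Phi(u))\,\mathrm d\mu_0(u)},$$ where $$T\Phi(u)=\Phi(u_{\mathrm{MAP}})+D\Phi(u_{\mathrm{MAP}})(u-u_{\mathrm{MAP}})+\tfrac12 H\Phi(u_{\mathrm{MAP}})[u-u_{\mathrm{MAP}},u-u_{\mathrm{MAP}}]$$ is the second order Taylor approximation of $\Phi$ at $u_{\mathrm{MAP}}$.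
   Context: $X,Y$ are (possibly infinite-dimensional) Hilbert spaces, $G:X\to Y$ is a (possibly nonlinear) forward map, $\eta\sim N(0,\Gamma)$ is additive Gaussian noise, $y$ is the observation, and the unknown $u\in X$ has the Gaussian prior $\mu_0=N(0,C_0)$. Here $N(m,C)$ denotes the Gaussian measure with mean $m$ and covariance operator $C$. The data-misfit functional is $\Phi(u)=\frac12\|y-G(u)\|_\Gamma^2$. For a covariance operator $C$, $\|w\|_C^2=\langle C^{-1}w,w\rangle$. Integrals are over $X$. $D$ denotes the (Fréchet) derivative and $H$ the second (Fréchet) derivative (Hessian); a bilinear form $K$ is identified with an operator via $K[w,z]=\langle Kw,z\rangle$, and in this sense $HI(u_{\mathrm{MAP}})^{-1}$ is the covariance operator of $\nu$. The point $u_{\mathrm{MAP}}$ is the maximum a posteriori point, i.e. a minimization point of $I$. *)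

theory Defs
  imports "HOL-Probability.Probability"
begin

text \<open>
  Real Hilbert spaces are types of sort \<open>{real_inner, complete_space}\<close>. Separability is not
  assumed separately: a space carrying an injective trace-class operator is separable.
\<close>

definition positive_operator :: "('a::{real_inner, complete_space} \<Rightarrow>\<^sub>L 'a) \<Rightarrow> bool" where
  "positive_operator A \<longleftrightarrow> (\<forall>x y. A x \<bullet> y = x \<bullet> A y) \<and> (\<forall>x. 0 \<le> A x \<bullet> x)"

definition orthonormal :: "'a::real_inner set \<Rightarrow> bool" where
  "orthonormal B \<longleftrightarrow> pairwise orthogonal B \<and> (\<forall>e\<in>B. norm e = 1)"

definition covariance_operator :: "('a::{real_inner, complete_space} \<Rightarrow>\<^sub>L 'a) \<Rightarrow> bool" where
  "covariance_operator C \<longleftrightarrow>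
     positive_operator C \<and> (\<forall>B. orthonormal B \<longrightarrow> (\<lambda>e. C e \<bullet> e) summable_on B)"

text \<open>The normal law on the real line with mean \<open>a\<close> and variance \<open>v\<close>, a point mass if \<open>v = 0\<close>.\<close>

definition normal_law :: "real \<Rightarrow> real \<Rightarrow> real measure" where
  "normal_law a v =
     (if v = 0 then return borel a else density lborel (\<lambda>x. ennreal (normal_density a (sqrt v) x)))"

text \<open>
  \<open>is_gaussian M m C\<close> states \<open>M = N(m, C)\<close>: all continuous linear functionals are normal, and
  \<open>m\<close> and \<open>C\<close> are the mean and the covariance operator (the off-diagonal covariances
  \<open>C h \<bullet> k\<close> are determined by the variances \<open>C h \<bullet> h\<close> through polarization).
\<close>

definition is_gaussian ::
  "'a::{real_inner, complete_space} measure \<Rightarrow> 'a \<Rightarrow> ('a \<Rightarrow>\<^sub>L 'a) \<Rightarrow> bool" where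
  "is_gaussian M m C \<longleftrightarrow>
     prob_space M \<and> sets M = sets borel \<and> covariance_operator C \<and>
     (\<forall>h. distr M borel (\<lambda>u. u \<bullet> h) = normal_law (m \<bullet> h) (C h \<bullet> h))"

text \<open>The positive square root exists and is unique for every bounded positive operator on a Hilbert space.\<close>

definition sqrt_op ::
  "('a::{real_inner, complete_space} \<Rightarrow>\<^sub>L 'a) \<Rightarrow> ('a \<Rightarrow>\<^sub>L 'a)" where
  "sqrt_op C = (THE L. positive_operator L \<and> L o\<^sub>L L = C)"

text \<open>
  For injective \<open>C\<close>, the form \<open>w \<mapsto> \<langle>C\<^sup>-\<^sup>1 w, w\<rangle>\<close> with its usual (maximal) domain, the
  Cameron-Martin space: it is \<open>\<parallel>C\<^sup>-\<^sup>1\<^sup>/\<^sup>2 w\<parallel>\<^sup>2\<close> on the range of \<open>C\<^sup>1\<^sup>/\<^sup>2\<close>, which is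
  \<open>\<langle>v, C v\<rangle>\<close> for \<open>w = C v\<close>, and infinite elsewhere. In finite dimensions the domain is the
  whole space.
\<close>

definition cm_space :: "('a::{real_inner, complete_space} \<Rightarrow>\<^sub>L 'a) \<Rightarrow> 'a set" where
  "cm_space C = range (sqrt_op C)"

definition cm_coord :: "('a::{real_inner, complete_space} \<Rightarrow>\<^sub>L 'a) \<Rightarrow> 'a \<Rightarrow> 'a" where
  "cm_coord C w = inv (sqrt_op C) w"

definition cov_norm_sq :: "('a::{real_inner, complete_space} \<Rightarrow>\<^sub>L 'a) \<Rightarrow> 'a \<Rightarrow> ereal" where
  "cov_norm_sq C w = (if w \<in> cm_space C then ereal ((norm (cm_coord C w))\<^sup>2) else \<infinity>)"

definition data_misfit ::
  "('y::{real_inner, complete_space} \<Rightarrow>\<^sub>L 'y) \<Rightarrow> ('x \<Rightarrow> 'y) \<Rightarrow> 'y \<Rightarrow> 'x \<Rightarrow> ereal" where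
  "data_misfit \<Gamma> G y u = ereal (1/2) * cov_norm_sq \<Gamma> (y - G u)"

definition map_functional ::
  "('x \<Rightarrow> real) \<Rightarrow> ('x::{real_inner, complete_space} \<Rightarrow>\<^sub>L 'x) \<Rightarrow> 'x \<Rightarrow> ereal" where
  "map_functional \<Phi> C\<^sub>0 u = ereal (\<Phi> u) + ereal (1/2) * cov_norm_sq C\<^sub>0 u"

definition twice_differentiable_at ::
  "('a::real_normed_vector \<Rightarrow> real) \<Rightarrow> ('a \<Rightarrow>\<^sub>L real) \<Rightarrow> ('a \<Rightarrow>\<^sub>L 'a \<Rightarrow>\<^sub>L real) \<Rightarrow> 'a \<Rightarrow> bool" where
  "twice_differentiable_at f f' f'' a \<longleftrightarrow>
     (\<exists>D :: 'a \<Rightarrow> 'a \<Rightarrow>\<^sub>L real.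
        (\<forall>\<^sub>F x in nhds a. (f has_derivative blinfun_apply (D x)) (at x)) \<and> D a = f' \<and>
        (D has_derivative blinfun_apply f'') (at a))"

definition C2_near ::
  "('a::real_normed_vector \<Rightarrow> real) \<Rightarrow> ('a \<Rightarrow>\<^sub>L 'a \<Rightarrow>\<^sub>L real) \<Rightarrow> 'a \<Rightarrow> bool" where
  "C2_near f f'' a \<longleftrightarrow>
     (\<exists>U (D :: 'a \<Rightarrow> 'a \<Rightarrow>\<^sub>L real) (H :: 'a \<Rightarrow> 'a \<Rightarrow>\<^sub>L 'a \<Rightarrow>\<^sub>L real).
        open U \<and> a \<in> U \<and>
        (\<forall>x\<in>U. (f has_derivative blinfun_apply (D x)) (at x) \<and>
           (D has_derivative blinfun_apply (H x)) (at x)) \<and>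
        continuous_on U H \<and> H a = f'')"

text \<open>
  The functional \<open>F\<close> is \<open>C\<^sup>2\<close> near \<open>u\<close> on the Cameron-Martin space of \<open>C\<close>, with Hessian at
  \<open>u\<close> the bilinear form \<open>K\<close> on that space. The Cameron-Martin space carries the norm
  \<open>\<parallel>\<cdot>\<parallel>\<^sub>C\<close>, for which \<open>sqrt_op C\<close> is an isometry from the whole space onto it (when \<open>C\<close> is
  injective); differentiability is therefore expressed after composition with \<open>sqrt_op C\<close>. A
  functional such as \<open>\<parallel>\<cdot>\<parallel>\<^sub>C\<^sup>2\<close> is infinite on a dense set if the space is infinite-dimensional, so
  it is never differentiable in the norm of the ambient space; in finite dimensions the two norms
  are equivalent and this is ordinary \<open>C\<^sup>2\<close> regularity.
\<close>

definition cm_C2_near ::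
  "('a::{real_inner, complete_space} \<Rightarrow>\<^sub>L 'a) \<Rightarrow> ('a \<Rightarrow> ereal) \<Rightarrow> ('a \<Rightarrow> 'a \<Rightarrow> real) \<Rightarrow> 'a \<Rightarrow> bool"
  where
  "cm_C2_near C F K u \<longleftrightarrow>
     u \<in> cm_space C \<and>
     (\<exists>f'' :: 'a \<Rightarrow>\<^sub>L 'a \<Rightarrow>\<^sub>L real.
        C2_near (\<lambda>x. real_of_ereal (F (sqrt_op C x))) f'' (cm_coord C u) \<and>
        (\<forall>w\<in>cm_space C. \<forall>z\<in>cm_space C. K w z = f'' (cm_coord C w) (cm_coord C z)))"

text \<open>
  \<open>S\<close> is the inverse of the operator associated with the form \<open>K\<close> on the domain \<open>E\<close>, i.e. of
  the (possibly unbounded) operator \<open>A\<close> with \<open>K[w, z] = \<langle>A w, z\<rangle>\<close>. For symmetric \<open>K\<close> and dense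
  \<open>E\<close> such an \<open>S\<close> is unique.
\<close>

definition inverse_of_form ::
  "'a::{real_inner, complete_space} set \<Rightarrow> ('a \<Rightarrow> 'a \<Rightarrow> real) \<Rightarrow> ('a \<Rightarrow>\<^sub>L 'a) \<Rightarrow> bool" where
  "inverse_of_form E K S \<longleftrightarrow> (\<forall>x. S x \<in> E \<and> (\<forall>z\<in>E. K (S x) z = x \<bullet> z))"

definition taylor2 ::
  "('a::real_normed_vector \<Rightarrow> real) \<Rightarrow> ('a \<Rightarrow>\<^sub>L real) \<Rightarrow> ('a \<Rightarrow>\<^sub>L 'a \<Rightarrow>\<^sub>L real) \<Rightarrow> 'a \<Rightarrow> 'a \<Rightarrow> real" where
  "taylor2 f f' f'' a u = f a + f' (u - a) + 1/2 * f'' (u - a) (u - a)"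

text \<open>
  \<open>M\<close> has the density \<open>exp (- F) / \<integral> exp (- F) dM\<^sub>0\<close> with respect to \<open>M\<^sub>0\<close>, the normalizing
  integral being finite.
\<close>

definition has_gibbs_density :: "'a measure \<Rightarrow> ('a \<Rightarrow> real) \<Rightarrow> 'a measure \<Rightarrow> bool" where
  "has_gibbs_density M\<^sub>0 F M \<longleftrightarrow>
     integrable M\<^sub>0 (\<lambda>u. exp (- F u)) \<and>
     M = density M\<^sub>0 (\<lambda>u. ennreal (exp (- F u) / (\<integral>v. exp (- F v) \<partial>M\<^sub>0)))"

end

theory Submission
  imports Defs
begin

text \<open>
  Let \<open>L = C\<^sub>0\<^sup>1\<^sup>/\<^sup>2\<close>. In the coordinates \<open>u = L x\<close> the MAP functional is
  \<open>\<Phi> (L x) + \<parallel>x\<parallel>\<^sup>2 / 2\<close>, so its Hessian is \<open>q = 1 + L A L\<close> with \<open>A\<close> the Hessian of \<open>\<Phi>\<close>, and the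
  hypothesis on \<open>C\<close> says \<open>C = L q\<^sup>-\<^sup>1 L\<close>. The form \<open>q\<close> is nonnegative by minimality and coercive
  because \<open>L\<close> is compact. Multiplying a centred Gaussian measure by \<open>exp (- a \<langle>u, k\<rangle>\<^sup>2 / 2)\<close>
  gives, up to normalization, a centred Gaussian measure whose inverse covariance is increased by
  \<open>a k \<otimes> k\<close>; summing such rank-one updates along an orthonormal basis and passing to the limit
  shows that \<open>exp (- \<langle>A u, u\<rangle> / 2)\<close> turns \<open>N(0, C\<^sub>0)\<close> into \<open>N(0, C)\<close>. The linear part of the Taylor
  polynomial then shifts the mean to \<open>u_MAP\<close> by the first-order condition. Gaussian measures are
  determined by their one-dimensional marginals, which gives the converse.
\<close>

text \<open>The obstacle is a negative part of \<open>A\<close>: then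
  \<open>exp (- <A u, u> / 2)\<close> is unbounded, and neither its integrability nor positivity of
  the partially updated forms is automatic. Minimality alone gives only \<open>q >= 0\<close>; it is
  the existence of \<open>C\<close>, with injectivity of \<open>L\<close>, that excludes a kernel,
  and compactness turns this into a gap \<open>d\<close>. The order of the updates matters. With
  \<open>c = norm A\<close>, the updates that build \<open>A + c\<close> keep every form above the
  identity and have the constant 1 as majorant. While \<open>c\<close> is subtracted again, every
  intermediate form stays above \<open>q\<close>, hence above \<open>d\<close>, and the normalizing
  constants stay bounded because \<open>L\<close> is Hilbert-Schmidt. The rank-one terms are
  \<open><u, R e_i>^2\<close> with \<open>R\<close> a square root and \<open>e\<close> an arbitrary
  orthonormal basis, so nothing is diagonalized. The limit covariance is known beforehand as the
  inverse of the limit form; only convergence of the variances towards it has to be shown. The mean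
  arises without translating a measure: tilting \<open>N(0, C)\<close> by \<open>exp <u, k>\<close>
  gives \<open>N(C k, C)\<close>, and \<open>C k = u_MAP\<close> is the first-order
  condition.\<close>

section \<open>Square roots of positive operators\<close>

text \<open>A degenerate \<open>y\<close> needs its own argument: \<open>q\<close> at
  \<open>x + t y\<close> is affine in \<open>t\<close> and bounded below, so its slope vanishes.
  Otherwise \<open>a x - b y\<close> is the usual minimizer scaled by \<open>a\<close>, which avoids
  a division. Degeneracy cannot be excluded in \<open>form_coercive\<close>, where this is applied
  to the Hessian.\<close>

lemma psd_form_Cauchy_Schwarz:
  fixes q :: "'a::real_vector \<Rightarrow> 'a \<Rightarrow> real"
  assumes q: "bilinear q" and sym: "\<And>x y. q x y = q y x" and nonneg: "\<And>x. 0 \<le> q x x"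
  shows "(q x y)\<^sup>2 \<le> q x x * q y y"
proof (cases "q y y = 0")
  case True
  have *: "0 \<le> q x x + 2 * t * q x y" for t
  proof -
    have "q (x + t *\<^sub>R y) (x + t *\<^sub>R y) = q x x + 2 * t * q x y"
      using True sym[of y x]
      by (simp add: bilinear_ladd[OF q] bilinear_radd[OF q] bilinear_lmul[OF q] bilinear_rmul[OF q])
    then show ?thesis using nonneg by metis
  qed
  have "q x y = 0"
  proof (rule ccontr)
    assume "q x y \<noteq> 0"
    \<comment> \<open>At this \<open>t\<close> the affine function takes the value -1.\<close>
    then show False using *[of "- (q x x + 1) / (2 * q x y)"] by (simp add: field_simps)
  qed
  then show ?thesis using True by simp
next
  case False
  define a b where "a = q y y" and "b = q x y"
  have "q (a *\<^sub>R x - b *\<^sub>R y) (a *\<^sub>R x - b *\<^sub>R y) = a * (q x x * a - b\<^sup>2)"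
    using sym[of y x]
    by (simp add: bilinear_lsub[OF q] bilinear_rsub[OF q] bilinear_lmul[OF q] bilinear_rmul[OF q]
        a_def b_def algebra_simps power2_eq_square)
  then have "0 \<le> a * (q x x * a - b\<^sup>2)" using nonneg by metis
  moreover have "a > 0" using False nonneg[of y] unfolding a_def by linarith
  ultimately show ?thesis unfolding a_def b_def by (simp add: zero_le_mult_iff)
qed

lemma positive_operator_sym: "positive_operator A \<Longrightarrow> A x \<bullet> y = x \<bullet> A y"
  and positive_operator_nonneg: "positive_operator A \<Longrightarrow> 0 \<le> A x \<bullet> x"
  unfolding positive_operator_def by blast+

lemma positive_operator_Cauchy_Schwarz:
  assumes "positive_operator A"
  shows "(A x \<bullet> y)\<^sup>2 \<le> (A x \<bullet> x) * (A y \<bullet> y)"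
proof (rule psd_form_Cauchy_Schwarz)
  show "bilinear (\<lambda>x y. A x \<bullet> y)"
    unfolding bilinear_def
    by (auto intro!: linearI simp: blinfun.add_right blinfun.scaleR_right inner_simps)
  show "A x \<bullet> y = A y \<bullet> x" for x y
    using assms by (metis inner_commute positive_operator_def)
  show "0 \<le> A x \<bullet> x" for x using assms by (rule positive_operator_nonneg)
qed

text \<open>Cauchy-Schwarz for the form of \<open>A\<close> with \<open>y = A x\<close>. A vector on
  which the quadratic form vanishes therefore lies in the kernel, so injectivity becomes strict
  positivity.\<close>

lemma positive_operator_norm_sq_le:
  assumes A: "positive_operator A"
  shows "(norm (A x))\<^sup>2 \<le> norm A * (A x \<bullet> x)"
proof (cases "A x = 0")
  case False
  have "((norm (A x))\<^sup>2)\<^sup>2 \<le> (A x \<bullet> x) * (A (A x) \<bullet> A x)"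
    using positive_operator_Cauchy_Schwarz[OF A, of x "A x"] by (simp add: power2_norm_eq_inner)
  also have "A (A x) \<bullet> A x \<le> norm (A (A x)) * norm (A x)" by (rule norm_cauchy_schwarz)
  also have "norm (A (A x)) \<le> norm A * norm (A x)" by (rule norm_blinfun)
  finally have "((norm (A x))\<^sup>2)\<^sup>2 \<le> (A x \<bullet> x) * (norm A * norm (A x) * norm (A x))"
    using positive_operator_nonneg[OF A, of x] by (simp add: mult_left_mono mult_right_mono)
  then have "(norm (A x))\<^sup>2 * (norm (A x))\<^sup>2 \<le> (norm A * (A x \<bullet> x)) * (norm (A x))\<^sup>2"
    by (simp add: power2_eq_square mult_ac)
  moreover have "0 < (norm (A x))\<^sup>2" using False by simp
  ultimately show ?thesis by (rule mult_right_le_imp_le)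
qed (simp add: power2_eq_square)

text \<open>The bound \<open>e n\<close> is uniform in \<open>m\<close> and so survives the passage
  to the pointwise limit; this upgrades pointwise convergence to convergence in operator
  norm.\<close>

lemma blinfun_Cauchy_limit:
  fixes Y :: "nat \<Rightarrow> 'a::real_normed_vector \<Rightarrow>\<^sub>L 'b::{real_normed_vector, complete_space}"
  assumes le: "\<And>m n. n \<le> m \<Longrightarrow> norm (Y m - Y n) \<le> e n" and e: "e \<longlonglongrightarrow> 0"
  obtains A where "Y \<longlonglongrightarrow> A"
proof -
  have le': "norm (Y m x - Y n x) \<le> e n * norm x" if "n \<le> m" for m n x
  proof -
    have "norm (Y m x - Y n x) \<le> norm (Y m - Y n) * norm x"
      using norm_blinfun[of "Y m - Y n" x] by (simp add: blinfun.diff_left)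
    then show ?thesis using le[OF that] by (meson mult_right_mono norm_ge_zero order_trans)
  qed
  have "convergent (\<lambda>n. Y n x)" for x
  proof (rule Cauchy_convergent, rule metric_CauchyI)
    fix d :: real assume "d > 0"
    have "(\<lambda>n. e n * norm x) \<longlonglongrightarrow> 0 * norm x" by (intro tendsto_intros e)
    then have "eventually (\<lambda>n. e n * norm x < d/2) sequentially"
      using order_tendstoD(2)[of _ 0 sequentially "d/2"] \<open>d > 0\<close> by simp
    then obtain N where N: "e N * norm x < d/2" by (auto simp: eventually_sequentially)
    have "dist (Y m x) (Y n x) < d" if "m \<ge> N" "n \<ge> N" for m n
      using le'[OF that(1), of x] le'[OF that(2), of x] N
        dist_triangle2[of "Y m x" "Y n x" "Y N x"] by (simp add: dist_norm)
    then show "\<exists>M. \<forall>m\<ge>M. \<forall>n\<ge>M. dist (Y m x) (Y n x) < d" by blast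
  qed
  then have lim: "(\<lambda>n. Y n x) \<longlonglongrightarrow> lim (\<lambda>n. Y n x)" for x
    by (simp add: convergent_LIMSEQ_iff)
  define f where "f x = lim (\<lambda>n. Y n x)" for x
  have f: "norm (f x - Y n x) \<le> e n * norm x" for n x
  proof (rule tendsto_upperbound)
    show "(\<lambda>m. norm (Y m x - Y n x)) \<longlonglongrightarrow> norm (f x - Y n x)"
      unfolding f_def by (intro tendsto_intros lim)
    show "\<forall>\<^sub>F m in sequentially. norm (Y m x - Y n x) \<le> e n * norm x"
      using le' by (auto simp: eventually_sequentially)
  qed simp
  have bl: "bounded_linear f"
  proof (rule bounded_linear_intro)
    show "f (x + y) = f x + f y" for x y
      using tendsto_add[OF lim[of x] lim[of y]] lim[of "x + y"]
      by (simp add: f_def blinfun.add_right LIMSEQ_unique)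
    show "f (r *\<^sub>R x) = r *\<^sub>R f x" for r x
      using tendsto_scaleR[OF tendsto_const lim[of x], of r] lim[of "r *\<^sub>R x"]
      by (simp add: f_def blinfun.scaleR_right LIMSEQ_unique)
    show "norm (f x) \<le> norm x * (e 0 + norm (Y 0))" for x
      using f[of x 0] norm_blinfun[of "Y 0" x] norm_triangle_ineq[of "f x - Y 0 x" "Y 0 x"]
      by (simp add: algebra_simps)
  qed
  define A where "A = Blinfun f"
  have A: "A x = f x" for x by (simp add: A_def bounded_linear_Blinfun_apply bl)
  have "norm (Y n - A) \<le> e n" for n
    using f le[of n n] by (intro norm_blinfun_bound)
      (auto simp: A blinfun.diff_left norm_minus_commute)
  then have "(\<lambda>n. Y n - A) \<longlonglongrightarrow> 0"
    by (intro Lim_null_comparison[OF _ e]) auto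
  then have "Y \<longlonglongrightarrow> A" by (simp add: LIM_zero_iff)
  then show thesis by (rule that)
qed

text \<open>
  The square root is obtained as \<open>1 - Y\<close>, where \<open>Y\<close> is the limit of the iteration
  \<open>Y \<mapsto> (1 - C + Y\<^sup>2) / 2\<close> from \<open>0\<close>. Its increments are dominated by those of the scalar iteration
  \<open>t \<mapsto> (1 + t\<^sup>2) / 2\<close>, which increases to a finite limit.
\<close>

primrec sqrt_majorant :: "nat \<Rightarrow> real" where
  "sqrt_majorant 0 = 0"
| "sqrt_majorant (Suc n) = (1 + (sqrt_majorant n)\<^sup>2) / 2"

primrec sqrt_iter :: "('a::real_normed_vector \<Rightarrow>\<^sub>L 'a) \<Rightarrow> nat \<Rightarrow> ('a \<Rightarrow>\<^sub>L 'a)" where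
  "sqrt_iter A 0 = 0"
| "sqrt_iter A (Suc n) = (1/2) *\<^sub>R (A + (sqrt_iter A n o\<^sub>L sqrt_iter A n))"

lemma sqrt_majorant_bounds: "0 \<le> sqrt_majorant n \<and> sqrt_majorant n \<le> 1"
proof (induction n)
  case (Suc n)
  then show ?case using power_le_one[of "sqrt_majorant n" 2] by simp
qed simp

text \<open>This is \<open>(1 - t)^2 >= 0\<close>.\<close>

lemma sqrt_majorant_le_Suc: "sqrt_majorant n \<le> sqrt_majorant (Suc n)"
  using sum_squares_bound[of "sqrt_majorant n" 1] by simp

lemma sqrt_iter_norm_le:
  assumes "norm A \<le> 1"
  shows "norm (sqrt_iter A n) \<le> sqrt_majorant n"
proof (induction n)
  case (Suc n)
  have "norm (sqrt_iter A n o\<^sub>L sqrt_iter A n) \<le> norm (sqrt_iter A n) * norm (sqrt_iter A n)"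
    by (rule norm_blinfun_compose)
  also have "\<dots> \<le> sqrt_majorant n * sqrt_majorant n"
    using Suc by (intro mult_mono) (auto simp: sqrt_majorant_bounds)
  finally show ?case
    using assms norm_triangle_ineq[of A "sqrt_iter A n o\<^sub>L sqrt_iter A n"]
    by (simp add: power2_eq_square)
qed simp

text \<open>The difference of squares is written \<open>Y (Y - X) + (Y - X) X\<close>, which needs
  no commutation and mirrors the scalar difference \<open>y^2 - x^2\<close>, so the induction closes
  exactly.\<close>

lemma sqrt_iter_diff_le:
  assumes A: "norm A \<le> 1"
  shows "norm (sqrt_iter A (Suc n) - sqrt_iter A n) \<le> sqrt_majorant (Suc n) - sqrt_majorant n"
proof (induction n)
  case 0
  then show ?case using A by simp
next
  case (Suc n)
  let ?Y = "sqrt_iter A (Suc n)" and ?X = "sqrt_iter A n"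
  let ?y = "sqrt_majorant (Suc n)" and ?x = "sqrt_majorant n"
  have "sqrt_iter A (Suc (Suc n)) - ?Y
      = (1/2) *\<^sub>R ((?Y o\<^sub>L ?Y) - (?X o\<^sub>L ?X))"
    by (subst (1) sqrt_iter.simps(2), subst (3) sqrt_iter.simps(2)) (simp add: algebra_simps)
  also have "(?Y o\<^sub>L ?Y) - (?X o\<^sub>L ?X) = (?Y o\<^sub>L (?Y - ?X)) + ((?Y - ?X) o\<^sub>L ?X)"
    by (rule blinfun_eqI) (simp add: blinfun.diff_left blinfun.diff_right blinfun.add_left del: sqrt_iter.simps)
  finally have "norm (sqrt_iter A (Suc (Suc n)) - ?Y)
      \<le> 1/2 * (norm (?Y o\<^sub>L (?Y - ?X)) + norm ((?Y - ?X) o\<^sub>L ?X))"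
    using norm_triangle_ineq[of "?Y o\<^sub>L (?Y - ?X)" "(?Y - ?X) o\<^sub>L ?X"] by (simp del: sqrt_iter.simps)
  also have "\<dots> \<le> 1/2 * (norm ?Y * norm (?Y - ?X) + norm (?Y - ?X) * norm ?X)"
    using norm_blinfun_compose[of ?Y "?Y - ?X"] norm_blinfun_compose[of "?Y - ?X" ?X]
    by (simp del: sqrt_iter.simps)
  also have "\<dots> \<le> 1/2 * (?y * (?y - ?x) + (?y - ?x) * ?x)"
    using sqrt_iter_norm_le[OF A] Suc sqrt_majorant_bounds sqrt_majorant_le_Suc[of n]
    by (intro mult_left_mono add_mono mult_mono) (simp_all del: sqrt_iter.simps sqrt_majorant.simps)
  also have "\<dots> = (?y\<^sup>2 - ?x\<^sup>2) / 2"
    by (simp add: power2_eq_square algebra_simps del: sqrt_majorant.simps)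
  also have "\<dots> = sqrt_majorant (Suc (Suc n)) - ?y"
    using sqrt_majorant.simps(2)[of "Suc n"] sqrt_majorant.simps(2)[of n]
    by argo
  finally show ?case .
qed

lemma sqrt_iter_convergent:
  fixes A :: "'a::{real_normed_vector, complete_space} \<Rightarrow>\<^sub>L 'a"
  assumes A: "norm A \<le> 1"
  obtains Y where "sqrt_iter A \<longlonglongrightarrow> Y"
proof -
  have inc: "incseq sqrt_majorant" using sqrt_majorant_le_Suc by (rule incseq_SucI)
  obtain l where l: "sqrt_majorant \<longlonglongrightarrow> l" "\<And>n. sqrt_majorant n \<le> l"
    using incseq_convergent[OF inc, of 1] sqrt_majorant_bounds by blast
  have "norm (sqrt_iter A m - sqrt_iter A n) \<le> sqrt_majorant m - sqrt_majorant n" if "n \<le> m" for m n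
    using that
  proof (induction m rule: dec_induct)
    case (step m)
    then show ?case
      using sqrt_iter_diff_le[OF A, of m]
        norm_triangle_ineq[of "sqrt_iter A (Suc m) - sqrt_iter A m" "sqrt_iter A m - sqrt_iter A n"]
      by (simp del: sqrt_iter.simps sqrt_majorant.simps)
  qed simp
  then have "norm (sqrt_iter A m - sqrt_iter A n) \<le> l - sqrt_majorant n" if "n \<le> m" for m n
    using l(2)[of m] that by (smt (verit))
  moreover have "(\<lambda>n. l - sqrt_majorant n) \<longlonglongrightarrow> 0"
    using tendsto_diff[OF tendsto_const l(1), of l] by simp
  ultimately show thesis using blinfun_Cauchy_limit[of "sqrt_iter A"] that by metis
qed

lemma positive_operator_scaleR:
  "positive_operator A \<Longrightarrow> 0 \<le> r \<Longrightarrow> positive_operator (r *\<^sub>R A)"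
  unfolding positive_operator_def blinfun.scaleR_left inner_scaleR_left inner_scaleR_right
  by (metis zero_le_mult_iff)

text \<open>Provides the contraction \<open>1 - C\<close> that drives the iteration: in the
  expansion of \<open>|x - C x|^2\<close> the term \<open>|C x|^2\<close> is at most
  \<open><C x, x>\<close> and is absorbed by the cross term.\<close>

lemma norm_one_minus_positive_le:
  assumes C: "positive_operator C" and n: "norm C \<le> 1"
  shows "norm (id_blinfun - C) \<le> 1"
proof (rule norm_blinfun_bound)
  fix x
  have "(norm (C x))\<^sup>2 \<le> norm C * (C x \<bullet> x)" by (rule positive_operator_norm_sq_le[OF C])
  also have "\<dots> \<le> C x \<bullet> x"
    using n positive_operator_nonneg[OF C, of x] by (intro mult_left_le_one_le) auto
  finally have "C x \<bullet> C x \<le> C x \<bullet> x" by (simp add: power2_norm_eq_inner)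
  then have "(norm (x - C x))\<^sup>2 \<le> (norm x)\<^sup>2"
    using positive_operator_nonneg[OF C, of x] inner_commute[of x "C x"]
    by (simp add: power2_norm_eq_inner inner_diff_left inner_diff_right)
  then show "norm ((id_blinfun - C) x) \<le> 1 * norm x"
    by (auto simp: blinfun.diff_left intro: power2_le_imp_le)
qed simp

text \<open>The commutation clause is the tool for uniqueness: a competing root commutes with its
  own square \<open>C\<close>, hence with the root built here. It holds because every iterate is a
  polynomial in \<open>C\<close>.\<close>

lemma ex_positive_sqrt_norm_le_1:
  assumes C: "positive_operator C" and n: "norm C \<le> 1"
  obtains L where "positive_operator L" "L o\<^sub>L L = C"
    "\<And>S. S o\<^sub>L C = C o\<^sub>L S \<Longrightarrow> S o\<^sub>L L = L o\<^sub>L S"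
proof -
  define A where "A = id_blinfun - C"
  have A: "norm A \<le> 1" unfolding A_def by (rule norm_one_minus_positive_le[OF C n])
  obtain Y where Y: "sqrt_iter A \<longlonglongrightarrow> Y" by (rule sqrt_iter_convergent[OF A])
  have Yx: "(\<lambda>n. sqrt_iter A n x) \<longlonglongrightarrow> Y x" for x by (intro tendsto_intros Y)
  have "norm Y \<le> 1"
    using sqrt_iter_norm_le[OF A] sqrt_majorant_bounds
    by (intro tendsto_upperbound[OF tendsto_norm[OF Y]]) (auto intro!: always_eventually intro: order_trans)
  have sym: "sqrt_iter A n x \<bullet> y = x \<bullet> sqrt_iter A n y" for n x y
  proof (induction n arbitrary: x y)
    case (Suc n)
    have "A x \<bullet> y = x \<bullet> A y"
      by (simp add: A_def blinfun.diff_left inner_diff_left inner_diff_right positive_operator_sym[OF C])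
    with Suc show ?case
      by (simp add: blinfun.scaleR_left blinfun.add_left inner_add_left inner_add_right)
  qed simp
  have symY: "Y x \<bullet> y = x \<bullet> Y y" for x y
    by (rule LIMSEQ_unique[where X="\<lambda>n. sqrt_iter A n x \<bullet> y"])
      (intro tendsto_intros Yx, subst sym, intro tendsto_intros Yx)
  have "(\<lambda>n. sqrt_iter A (Suc n)) \<longlonglongrightarrow> (1/2) *\<^sub>R (A + (Y o\<^sub>L Y))"
    unfolding sqrt_iter.simps
    by (intro tendsto_intros Y bounded_bilinear.tendsto[OF bounded_bilinear_blinfun_compose])
  \<comment> \<open>Rearranged, \<open>2 Y = 1 - C + Y^2\<close> says
    \<open>(1 - Y)^2 = C\<close>.\<close>
  then have fixY: "Y = (1/2) *\<^sub>R (A + (Y o\<^sub>L Y))"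
    using Y LIMSEQ_Suc LIMSEQ_unique by blast
  define L where "L = id_blinfun - Y"
  show thesis
  proof (rule that)
    have "Y x \<bullet> x \<le> x \<bullet> x" for x
    proof -
      have "Y x \<bullet> x \<le> norm (Y x) * norm x" by (rule norm_cauchy_schwarz)
      also have "norm (Y x) \<le> norm x"
        using norm_blinfun[of Y x] \<open>norm Y \<le> 1\<close> by (smt (verit) mult_left_le_one_le norm_ge_zero)
      finally show ?thesis by (simp add: mult_right_mono power2_norm_eq_inner[symmetric] power2_eq_square)
    qed
    then show "positive_operator L"
      by (simp add: positive_operator_def L_def blinfun.diff_left inner_simps symY)
    have "2 *\<^sub>R Y x = A x + Y (Y x)" for x
      by (subst (1) fixY) (simp add: blinfun.scaleR_left blinfun.add_left)
    then have "Y x + Y x = x - C x + Y (Y x)" for x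
      by (metis A_def blinfun.diff_left blinfun_apply_id_blinfun scaleR_2)
    then show "L o\<^sub>L L = C"
      by (intro blinfun_eqI) (simp add: L_def blinfun.diff_left blinfun.diff_right algebra_simps)
    fix S assume S: "S o\<^sub>L C = C o\<^sub>L S"
    then have S': "S (C x) = C (S x)" for x by (metis blinfun_apply_blinfun_compose)
    have "S (sqrt_iter A n x) = sqrt_iter A n (S x)" for n x
    proof (induction n arbitrary: x)
      case (Suc n)
      then show ?case
        by (simp add: blinfun.scaleR_left blinfun.scaleR_right blinfun.add_left blinfun.add_right
            A_def blinfun.diff_left blinfun.diff_right S')
    qed simp
    then have "S (Y x) = Y (S x)" for x
      using tendsto_unique[OF _ blinfun.tendsto[OF tendsto_const Yx, of S x] ] Yx[of "S x"] by simp
    then show "S o\<^sub>L L = L o\<^sub>L S"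
      by (intro blinfun_eqI) (simp add: L_def blinfun.diff_left blinfun.diff_right)
  qed
qed

lemma ex_positive_sqrt:
  assumes C: "positive_operator C"
  obtains L where "positive_operator L" "L o\<^sub>L L = C"
    "\<And>S. S o\<^sub>L C = C o\<^sub>L S \<Longrightarrow> S o\<^sub>L L = L o\<^sub>L S"
proof -
  \<comment> \<open>The summand 1 keeps \<open>r\<close> positive for \<open>C = 0\<close>.\<close>
  define r where "r = norm C + 1"
  have r: "r > 0" by (simp add: r_def add_nonneg_pos)
  have "norm ((1/r) *\<^sub>R C) \<le> 1" using r by (simp add: r_def)
  then obtain K where K: "positive_operator K" "K o\<^sub>L K = (1/r) *\<^sub>R C"
    "\<And>S. S o\<^sub>L ((1/r) *\<^sub>R C) = ((1/r) *\<^sub>R C) o\<^sub>L S \<Longrightarrow> S o\<^sub>L K = K o\<^sub>L S"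
    using ex_positive_sqrt_norm_le_1[OF positive_operator_scaleR[OF C, of "1/r"]] r
    by (metis divide_nonneg_pos zero_le_one)
  note bl = bounded_bilinear.scaleR_left[OF bounded_bilinear_blinfun_compose]
    bounded_bilinear.scaleR_right[OF bounded_bilinear_blinfun_compose]
  show thesis
  proof (rule that)
    show "positive_operator (sqrt r *\<^sub>R K)" using K(1) r by (simp add: positive_operator_scaleR)
    show "(sqrt r *\<^sub>R K) o\<^sub>L (sqrt r *\<^sub>R K) = C" using K(2) r by (simp add: bl)
    show "S o\<^sub>L (sqrt r *\<^sub>R K) = (sqrt r *\<^sub>R K) o\<^sub>L S" if "S o\<^sub>L C = C o\<^sub>L S" for S
      using that K(3)[of S] by (simp add: bl)
  qed
qed

text \<open>Commutation gives \<open>(S + L) w = 0\<close> for \<open>w = (S - L) x\<close>. Two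
  nonnegative terms with sum zero yield \<open>S w = L w = 0\<close>, and moving
  \<open>S - L\<close> across the inner product shows \<open>|w|^2 = 0\<close>.\<close>

lemma positive_sqrt_unique:
  assumes L: "positive_operator L" and S: "positive_operator S" and eq: "S o\<^sub>L S = L o\<^sub>L L"
    and comm: "S o\<^sub>L L = L o\<^sub>L S"
  shows "S = L"
proof (rule blinfun_eqI)
  fix x
  have eq': "S (S z) = L (L z)" and comm': "S (L z) = L (S z)" for z
    using eq comm by (metis blinfun_apply_blinfun_compose)+
  define w where "w = S x - L x"
  have "S w + L w = 0" by (simp add: w_def blinfun.diff_right eq' comm')
  then have "S w \<bullet> w + L w \<bullet> w = 0" by (metis inner_add_left inner_zero_left)
  then have "S w \<bullet> w = 0" "L w \<bullet> w = 0"
    using L S unfolding positive_operator_def by (smt (verit))+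
  then have "S w = 0" "L w = 0"
    using positive_operator_norm_sq_le[OF S, of w] positive_operator_norm_sq_le[OF L, of w] by simp_all
  moreover have "w \<bullet> w = x \<bullet> (S w - L w)"
    unfolding inner_diff_right positive_operator_sym[OF S, symmetric]
      positive_operator_sym[OF L, symmetric] inner_diff_left[symmetric] by (simp add: w_def)
  ultimately have "w \<bullet> w = 0" by simp
  then show "S x = L x" by (simp add: w_def)
qed

lemma sqrt_op_works:
  assumes C: "positive_operator C"
  shows "positive_operator (sqrt_op C)" "sqrt_op C o\<^sub>L sqrt_op C = C"
proof -
  obtain L where L: "positive_operator L" "L o\<^sub>L L = C"
    "\<And>S. S o\<^sub>L C = C o\<^sub>L S \<Longrightarrow> S o\<^sub>L L = L o\<^sub>L S" by (rule ex_positive_sqrt[OF C]) blast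
  have "\<exists>!L. positive_operator L \<and> L o\<^sub>L L = C"
  proof (rule ex1I[of _ L])
    fix S assume S: "positive_operator S \<and> S o\<^sub>L S = C"
    then have "S o\<^sub>L C = C o\<^sub>L S" by (intro blinfun_eqI) auto
    then have "S o\<^sub>L L = L o\<^sub>L S" by (rule L(3))
    then show "S = L" using L(1,2) S by (metis positive_sqrt_unique)
  qed (use L(1,2) in simp)
  from theI'[OF this] show "positive_operator (sqrt_op C)" "sqrt_op C o\<^sub>L sqrt_op C = C"
    unfolding sqrt_op_def by auto
qed

section \<open>Coercive forms and orthonormal bases\<close>

text \<open>Symmetry allows a variational proof: the solution minimizes \<open>J\<close>. The
  parallelogram identity makes a minimizing sequence Cauchy, which is where coercivity
  enters.\<close>

lemma lax_milgram:
  fixes q :: "'a::{real_inner, complete_space} \<Rightarrow> 'a \<Rightarrow> real"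
  assumes q: "bounded_bilinear q" and sym: "\<And>x y. q x y = q y x"
    and d: "0 < d" and coercive: "\<And>x. d * (norm x)\<^sup>2 \<le> q x x"
    and f: "bounded_linear f"
  obtains b where "\<And>z. q b z = f z"
proof -
  interpret q: bounded_bilinear q by fact
  interpret f: bounded_linear f by fact
  define J where "J z = q z z - 2 * f z" for z
  obtain K where K: "\<And>z. \<bar>f z\<bar> \<le> norm z * K" using f.bounded by auto
  have "- (K\<^sup>2 / d) \<le> J z" for z
  proof -
    have "0 \<le> (d * norm z - K)\<^sup>2 / d" using d by simp
    also have "\<dots> = d * (norm z)\<^sup>2 - 2 * (norm z * K) + K\<^sup>2 / d"
      using d by (simp add: power2_eq_square field_simps)
    finally show ?thesis using coercive[of z] K[of z] unfolding J_def by linarith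
  qed
  then have bdd: "bdd_below (range J)" by (auto intro!: bdd_belowI)
  define m where "m = Inf (range J)"
  have m: "m \<le> J z" for z unfolding m_def by (rule cINF_lower[OF bdd]) simp
  have "\<exists>z. J z < m + 1 / (real n + 1)" for n
    using cINF_less_iff[OF _ bdd, of "m + 1 / (real n + 1)"] by (simp add: m_def)
  then obtain z where z: "\<And>n. J (z n) < m + 1 / (real n + 1)" by metis
  have par: "q (x - y) (x - y) = 2 * J x + 2 * J y - 4 * J ((1/2) *\<^sub>R (x + y))" for x y
    using sym[of y x]
    by (simp add: J_def q.diff_left q.diff_right q.add_left q.add_right q.scaleR_left q.scaleR_right
        f.scaleR f.add algebra_simps)
  have close: "d * (norm (z i - z j))\<^sup>2 \<le> 2 / (real i + 1) + 2 / (real j + 1)" for i j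
    using coercive[of "z i - z j"] par[of "z i" "z j"] z[of i] z[of j] m[of "(1/2) *\<^sub>R (z i + z j)"]
    by simp
  have "Cauchy z"
  proof (rule metric_CauchyI)
    fix e :: real assume e: "0 < e"
    obtain N where N: "4 / (d * e\<^sup>2) < real N" using reals_Archimedean2 by blast
    have "dist (z i) (z j) < e" if "i \<ge> N" "j \<ge> N" for i j
    proof -
      have N0: "0 < real N" using N d e by (smt (verit) divide_pos_pos mult_pos_pos zero_less_power)
      have "2 / (real k + 1) < d * e\<^sup>2 / 2" if "k \<ge> N" for k
      proof -
        have "4 < (d * e\<^sup>2) * real N" using N d e by (simp add: pos_divide_less_eq mult.commute)
        also have "\<dots> \<le> (d * e\<^sup>2) * (real k + 1)" using that d e by (intro mult_left_mono) auto
        finally show ?thesis by (simp add: field_simps)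
      qed
      then have "d * (norm (z i - z j))\<^sup>2 < d * e\<^sup>2" using close[of i j] that by (smt (verit) field_sum_of_halves)
      then show ?thesis using d e by (simp add: dist_norm power_less_imp_less_base)
    qed
    then show "\<exists>M. \<forall>i\<ge>M. \<forall>j\<ge>M. dist (z i) (z j) < e" by blast
  qed
  then obtain b where b: "z \<longlonglongrightarrow> b" using Cauchy_convergent convergent_def by blast
  have "(\<lambda>n. J (z n)) \<longlonglongrightarrow> J b"
    unfolding J_def by (intro tendsto_intros q.tendsto f.tendsto b)
  moreover have "(\<lambda>n. m + 1 / (real n + 1)) \<longlonglongrightarrow> m + 0"
    by (intro tendsto_add tendsto_const) real_asymp
  ultimately have Jb: "J b \<le> m"
    using z by (intro LIMSEQ_le[where X="\<lambda>n. J (z n)"]) (auto intro: less_imp_le)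
  show thesis
  proof (rule that)
    fix w
    define D where "D = q b w - f w"
    define Q where "Q = q w w"
    have Q: "0 \<le> Q" using coercive[of w] d unfolding Q_def by (smt (verit) mult_nonneg_nonneg zero_le_power2)
    \<comment> \<open>A descent step. The denominator \<open>Q + 1\<close> keeps it defined when
      \<open>Q = 0\<close> and still makes \<open>2 t D + t^2 Q\<close> negative unless
      \<open>D = 0\<close>.\<close>
    define t where "t = - D / (Q + 1)"
    have "J (b + t *\<^sub>R w) = J b + 2 * t * D + t\<^sup>2 * Q"
      using sym[of w b]
      by (simp add: J_def D_def Q_def q.add_left q.add_right q.scaleR_left q.scaleR_right f.scaleR f.add
          algebra_simps power2_eq_square)
    then have "0 \<le> 2 * t * D + t\<^sup>2 * Q" using m[of "b + t *\<^sub>R w"] Jb by simp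
    also have "\<dots> = - (D\<^sup>2 * (Q + 2)) / (Q + 1)\<^sup>2"
      using Q by (simp add: t_def power2_eq_square divide_simps) (simp add: algebra_simps)
    finally have "D\<^sup>2 * (Q + 2) \<le> 0" using Q
      by (smt (verit) divide_neg_pos zero_less_power)
    then have "D = 0" using Q by (smt (verit) mult_pos_pos zero_less_power2)
    then show "q b w = f w" by (simp add: D_def)
  qed
qed

lemma inverse_operator_of_coercive_form:
  fixes q :: "'a::{real_inner, complete_space} \<Rightarrow> 'a \<Rightarrow> real"
  assumes q: "bounded_bilinear q" and sym: "\<And>x y. q x y = q y x"
    and d: "0 < d" and coercive: "\<And>x. d * (norm x)\<^sup>2 \<le> q x x"
  obtains B :: "'a \<Rightarrow>\<^sub>L 'a" where "\<And>h z. q (B h) z = h \<bullet> z"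
proof -
  interpret q: bounded_bilinear q by fact
  have "\<exists>b. \<forall>z. q b z = h \<bullet> z" for h
    using lax_milgram[OF q sym d coercive bounded_linear_inner_right] by metis
  then obtain f where f: "\<And>h z. q (f h) z = h \<bullet> z" by metis
  have uniq: "x = y" if "\<And>z. q x z = q y z" for x y
  proof -
    have "q (x - y) (x - y) = 0" using that by (simp add: q.diff_left)
    then have "d * (norm (x - y))\<^sup>2 \<le> 0" using coercive[of "x - y"] by simp
    then show ?thesis using d by (simp add: mult_le_0_iff)
  qed
  have "bounded_linear f"
  proof (rule bounded_linear_intro)
    show "f (x + y) = f x + f y" for x y
      by (rule uniq) (simp add: f q.add_left inner_add_left)
    show "f (r *\<^sub>R x) = r *\<^sub>R f x" for r x
      by (rule uniq) (simp add: f q.scaleR_left)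
    show "norm (f x) \<le> norm x * (1/d)" for x
    proof (cases "f x = 0")
      case False
      have "d * (norm (f x))\<^sup>2 \<le> norm x * norm (f x)"
        using coercive[of "f x"] f[of x "f x"] norm_cauchy_schwarz[of x "f x"] by simp
      then show ?thesis using False d by (simp add: power2_eq_square field_simps)
    qed (use d in simp)
  qed
  then show thesis using that[of "Blinfun f"] f by (simp add: bounded_linear_Blinfun_apply)
qed

text \<open>The inner product is a coercive form with constant 1, so \<open>lax_milgram\<close>
  represents each \<open>\<beta> x\<close>; testing with the representative itself bounds it
  linearly in \<open>x\<close>.\<close>

lemma operator_of_bounded_form:
  fixes \<beta> :: "'a::{real_inner, complete_space} \<Rightarrow> 'a \<Rightarrow> real"
  assumes b: "bounded_bilinear \<beta>"
  obtains A :: "'a \<Rightarrow>\<^sub>L 'a" where "\<And>x z. \<beta> x z = A x \<bullet> z"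
proof -
  interpret b: bounded_bilinear \<beta> by fact
  have "\<exists>a. \<forall>z. a \<bullet> z = \<beta> x z" for x
    using lax_milgram[OF bounded_bilinear_inner inner_commute, of 1 "\<beta> x"] b.bounded_linear_right
    by (metis less_numeral_extra(1) mult_1 order_refl power2_norm_eq_inner)
  then obtain f where f: "\<And>x z. f x \<bullet> z = \<beta> x z" by metis
  obtain K where K: "K > 0" "\<And>x z. norm (\<beta> x z) \<le> norm x * norm z * K" using b.pos_bounded by blast
  have uniq: "x = y" if "\<And>z. x \<bullet> z = y \<bullet> z" for x y :: 'a
    using that by (metis vector_eq_rdot)
  have "bounded_linear f"
  proof (rule bounded_linear_intro)
    show "f (x + y) = f x + f y" for x y
      by (rule uniq) (simp add: f b.add_left inner_add_left)
    show "f (r *\<^sub>R x) = r *\<^sub>R f x" for r x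
      by (rule uniq) (simp add: f b.scaleR_left)
    show "norm (f x) \<le> norm x * K" for x
    proof (cases "f x = 0")
      case False
      have "(norm (f x))\<^sup>2 \<le> norm x * norm (f x) * K"
        using K(2)[of x "f x"] f[of x "f x"] by (simp add: power2_norm_eq_inner)
      then show ?thesis using False by (simp add: power2_eq_square mult_ac)
    qed (use K in simp)
  qed
  then show thesis using that[of "Blinfun f"] f by (simp add: bounded_linear_Blinfun_apply)
qed

lemma riesz_representation:
  fixes f :: "'a::{real_inner, complete_space} \<Rightarrow>\<^sub>L real"
  obtains g where "\<And>z. f z = g \<bullet> z"
  using lax_milgram[OF bounded_bilinear_inner inner_commute, of 1 f] blinfun.bounded_linear_right[of f]
  by (metis less_numeral_extra(1) mult_1 order_refl power2_norm_eq_inner)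

text \<open>
  An orthonormal basis as a sequence; zero entries are allowed, so that finite-dimensional spaces
  are covered as well.
\<close>

definition basis_seq :: "(nat \<Rightarrow> 'a::real_inner) \<Rightarrow> bool" where
  "basis_seq e \<longleftrightarrow> (\<forall>i j. i \<noteq> j \<longrightarrow> e i \<bullet> e j = 0) \<and> (\<forall>i. e i = 0 \<or> norm (e i) = 1) \<and>
     (\<forall>x. (\<lambda>n. \<Sum>i<n. (x \<bullet> e i) *\<^sub>R e i) \<longlonglongrightarrow> x)"

lemma norm_sq_sum_orthogonal:
  fixes e :: "nat \<Rightarrow> 'a::real_inner"
  assumes orth: "\<And>i j. i \<noteq> j \<Longrightarrow> e i \<bullet> e j = 0" and unit: "\<And>i. e i = 0 \<or> norm (e i) = 1"
    and I: "finite I"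
  shows "(norm (\<Sum>i\<in>I. (x \<bullet> e i) *\<^sub>R e i))\<^sup>2 = (\<Sum>i\<in>I. (x \<bullet> e i)\<^sup>2)"
proof -
  \<comment> \<open>True for zero entries as well as for unit vectors.\<close>
  have e: "(x \<bullet> e i) * (e i \<bullet> e i) = x \<bullet> e i" for i
    using unit[of i] by (auto simp: power2_norm_eq_inner[symmetric])
  have "(norm (\<Sum>i\<in>I. (x \<bullet> e i) *\<^sub>R e i))\<^sup>2
      = (\<Sum>i\<in>I. \<Sum>j\<in>I. (x \<bullet> e i) * ((x \<bullet> e j) * (e i \<bullet> e j)))"
    unfolding power2_norm_eq_inner inner_sum_left inner_sum_right inner_scaleR_left inner_scaleR_right
    by (simp add: sum_distrib_left mult_ac inner_commute[of "e i" "e j" for i j])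
  also have "\<dots> = (\<Sum>i\<in>I. \<Sum>j\<in>I. if i = j then (x \<bullet> e i)\<^sup>2 else 0)"
    using orth e by (intro sum.cong refl) (auto simp: power2_eq_square)
  also have "\<dots> = (\<Sum>i\<in>I. (x \<bullet> e i)\<^sup>2)" using I by (simp add: sum.delta')
  finally show ?thesis .
qed

lemma bessel_inequality:
  fixes e :: "nat \<Rightarrow> 'a::real_inner"
  assumes orth: "\<And>i j. i \<noteq> j \<Longrightarrow> e i \<bullet> e j = 0" and unit: "\<And>i. e i = 0 \<or> norm (e i) = 1"
    and I: "finite I"
  shows "(\<Sum>i\<in>I. (x \<bullet> e i)\<^sup>2) \<le> (norm x)\<^sup>2"
proof -
  have "(\<Sum>i\<in>I. (x \<bullet> e i) *\<^sub>R e i) \<bullet> x = (\<Sum>i\<in>I. (x \<bullet> e i)\<^sup>2)"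
    by (simp only: inner_sum_left inner_scaleR_left power2_eq_square inner_commute[of "e i" x for i])
  then have "0 \<le> (norm x)\<^sup>2 - 2 * (\<Sum>i\<in>I. (x \<bullet> e i)\<^sup>2) + (\<Sum>i\<in>I. (x \<bullet> e i)\<^sup>2)"
    using norm_sq_sum_orthogonal[where e=e and x=x, OF orth unit I]
      zero_le_power2[of "norm (x - (\<Sum>i\<in>I. (x \<bullet> e i) *\<^sub>R e i))"]
    by (simp add: power2_norm_eq_inner inner_diff_left inner_diff_right inner_commute)
  then show ?thesis by simp
qed

text \<open>The trace condition speaks of orthonormal sets. Discarding the zero entries leaves an
  injective family, which can be reindexed as such a set.\<close>

lemma basis_seq_summable:
  assumes e: "basis_seq e" and C: "covariance_operator C"
  shows "summable (\<lambda>i. C (e i) \<bullet> e i)"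
proof -
  define I where "I = {i. e i \<noteq> 0}"
  have inj: "inj_on e I"
  proof (rule inj_onI, rule ccontr)
    fix i j assume ij: "i \<in> I" "j \<in> I" "e i = e j" "i \<noteq> j"
    have "e i \<bullet> e j = 0" using e ij(4) by (simp add: basis_seq_def)
    with ij show False unfolding I_def by (metis inner_eq_zero_iff mem_Collect_eq)
  qed
  have "orthonormal (e ` I)"
    unfolding orthonormal_def pairwise_def orthogonal_def
  proof safe
    fix i j assume "e i \<noteq> e j"
    then have "i \<noteq> j" by auto
    then show "e i \<bullet> e j = 0" using e by (simp add: basis_seq_def)
  next
    fix i assume "i \<in> I"
    then show "norm (e i) = 1" using e by (auto simp: basis_seq_def I_def)
  qed
  then have "(\<lambda>x. C x \<bullet> x) summable_on (e ` I)" using C by (simp add: covariance_operator_def)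
  then have "(\<lambda>i. C (e i) \<bullet> e i) summable_on I"
    using summable_on_reindex[OF inj, of "\<lambda>x. C x \<bullet> x"] by (simp add: o_def)
  then have "(\<lambda>i. C (e i) \<bullet> e i) summable_on UNIV"
    by (subst summable_on_cong_neutral[where T=I and g="\<lambda>i. C (e i) \<bullet> e i"]) (auto simp: I_def)
  moreover have "C (e i) \<bullet> e i \<ge> 0" for i
    using C by (auto simp: covariance_operator_def intro: positive_operator_nonneg)
  ultimately show ?thesis by (simp add: summable_on_UNIV_nonneg_real_iff)
qed

lemma ex_maximal_orthonormal:
  obtains B :: "'a::real_inner set" where "orthonormal B" "\<And>B'. orthonormal B' \<Longrightarrow> B \<subseteq> B' \<Longrightarrow> B' = B"
proof -
  have "\<exists>M\<in>Collect orthonormal. \<forall>X\<in>Collect (orthonormal :: 'a set \<Rightarrow> bool). M \<subseteq> X \<longrightarrow> X = M"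
  proof (rule subset_Zorn')
    fix \<C> :: "'a set set" assume c: "subset.chain (Collect orthonormal) \<C>"
    have "orthogonal x y" if "x \<in> X" "X \<in> \<C>" "y \<in> Y" "Y \<in> \<C>" "x \<noteq> y" for x y X Y
    proof -
      have "X \<subseteq> Y \<or> Y \<subseteq> X" "orthonormal X" "orthonormal Y"
        using c that unfolding subset.chain_def by auto
      then show ?thesis using that unfolding orthonormal_def pairwise_def by blast
    qed
    moreover have "norm x = 1" if "x \<in> X" "X \<in> \<C>" for x X
      using c that unfolding subset.chain_def orthonormal_def by auto
    ultimately show "\<Union>\<C> \<in> Collect orthonormal"
      unfolding orthonormal_def pairwise_def by blast
  qed
  then show thesis using that by auto
qed

text \<open>Separability comes from the trace: on a maximal orthonormal set the numbers
  \<open><C x, x>\<close> are summable and, by injectivity, nonzero, so the set is countable.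
  Maximality then forces the expansions to converge to the right vector, since a normalized residual
  would enlarge the set.\<close>

lemma ex_basis_seq:
  fixes C :: "'a::{real_inner, complete_space} \<Rightarrow>\<^sub>L 'a"
  assumes C: "covariance_operator C" and inj: "inj (blinfun_apply C)"
  obtains e :: "nat \<Rightarrow> 'a" where "basis_seq e"
proof -
  obtain B :: "'a set" where B: "orthonormal B" and maxB: "\<And>B'. orthonormal B' \<Longrightarrow> B \<subseteq> B' \<Longrightarrow> B' = B"
    by (rule ex_maximal_orthonormal) blast
  have pos: "positive_operator C" using C by (simp add: covariance_operator_def)
  have "C x \<bullet> x \<noteq> 0" if "x \<in> B" for x
  proof
    assume "C x \<bullet> x = 0"
    then have "C x = C 0" using positive_operator_norm_sq_le[OF pos, of x] by simp
    then have "x = 0" using inj by (meson injD)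
    then show False using B that by (auto simp: orthonormal_def)
  qed
  then have "{x\<in>B. C x \<bullet> x \<noteq> 0} = B" by blast
  moreover have "(\<lambda>x. C x \<bullet> x) summable_on B" using C B by (simp add: covariance_operator_def)
  then have "countable {x\<in>B. C x \<bullet> x \<noteq> 0}" by (rule summable_countable_real)
  ultimately have cB: "countable B" by simp
  \<comment> \<open>Indices that enumerate no element, as happens for finite \<open>B\<close>,
    receive the zero vector.\<close>
  define e where "e i = (if i \<in> to_nat_on B ` B then from_nat_into B i else 0)" for i
  have e_in: "e i \<in> B \<and> to_nat_on B (e i) = i" if "e i \<noteq> 0" for i
    using that cB by (auto simp: e_def split: if_splits)
  have e_to: "e (to_nat_on B b) = b" if "b \<in> B" for b
    using that cB by (simp add: e_def)
  have orth: "e i \<bullet> e j = 0" if "i \<noteq> j" for i j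
  proof (cases "e i = 0 \<or> e j = 0")
    case False
    then have "e i \<in> B" "e j \<in> B" "e i \<noteq> e j" using e_in that by metis+
    then show ?thesis using B unfolding orthonormal_def pairwise_def orthogonal_def by blast
  qed auto
  have unit: "e i = 0 \<or> norm (e i) = 1" for i using e_in[of i] B unfolding orthonormal_def by blast
  have "(\<lambda>n. \<Sum>i<n. (x \<bullet> e i) *\<^sub>R e i) \<longlonglongrightarrow> x" for x
  proof -
    let ?P = "\<lambda>n. \<Sum>i<n. (x \<bullet> e i) *\<^sub>R e i"
    have "summable (\<lambda>i. (x \<bullet> e i)\<^sup>2)"
      by (rule summableI_nonneg_bounded[where x="(norm x)\<^sup>2"]) (auto intro: bessel_inequality[OF orth unit])
    then have cau: "\<exists>N. \<forall>m\<ge>N. \<forall>n. norm (\<Sum>i = m..<n. (x \<bullet> e i)\<^sup>2) < r" if "r > 0" for r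
      using that by (simp add: summable_Cauchy)
    have "Cauchy ?P"
    proof (rule CauchyI')
      fix r :: real assume "r > 0"
      then obtain N where N: "\<And>m n. m \<ge> N \<Longrightarrow> norm (\<Sum>i = m..<n. (x \<bullet> e i)\<^sup>2) < r\<^sup>2"
        using cau[of "r\<^sup>2"] by auto
      have "norm (?P m - ?P n) < r" if "m \<ge> N" "n > m" for m n
      proof -
        have "?P n - ?P m = (\<Sum>i\<in>{m..<n}. (x \<bullet> e i) *\<^sub>R e i)"
          using that by (simp add: lessThan_atLeast0 sum_diff_nat_ivl)
        then have "(norm (?P m - ?P n))\<^sup>2 < r\<^sup>2"
          using norm_sq_sum_orthogonal[where e=e and x=x, OF orth unit, of "{m..<n}"] N[OF that(1), of n]
          by (simp add: norm_minus_commute[of "?P m"])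
        then show ?thesis using \<open>r > 0\<close> by (simp add: power_less_imp_less_base)
      qed
      then show "\<exists>M. \<forall>m\<ge>M. \<forall>n>m. dist (?P m) (?P n) < r" unfolding dist_norm by blast
    qed
    then obtain y where y: "?P \<longlonglongrightarrow> y" using Cauchy_convergent convergent_def by blast
    \<comment> \<open>Beyond index \<open>j\<close> the partial sums already carry the exact
      coordinate along \<open>b\<close>, so the residual is eventually orthogonal to
      \<open>b\<close>.\<close>
    have 0: "(x - y) \<bullet> b = 0" if b: "b \<in> B" for b
    proof -
      define j where "j = to_nat_on B b"
      have j: "e j = b" using e_to[OF b] by (simp add: j_def)
      have "(x - ?P n) \<bullet> b = 0" if "n > j" for n
      proof -
        have "?P n \<bullet> b = (\<Sum>i<n. if i = j then x \<bullet> b else 0)"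
          unfolding inner_sum_left
        proof (rule sum.cong[OF refl])
          fix i
          show "(x \<bullet> e i) *\<^sub>R e i \<bullet> b = (if i = j then x \<bullet> b else 0)"
            using orth[of i j] j B b by (auto simp: orthonormal_def power2_norm_eq_inner[symmetric])
        qed
        then show ?thesis using that by (simp add: inner_diff_left)
      qed
      then have "\<forall>\<^sub>F n in sequentially. (x - ?P n) \<bullet> b = 0"
        by (auto simp: eventually_at_top_dense)
      moreover have "(\<lambda>n. (x - ?P n) \<bullet> b) \<longlonglongrightarrow> (x - y) \<bullet> b" by (intro tendsto_intros y)
      ultimately show ?thesis
        using tendsto_unique[OF trivial_limit_sequentially _ tendsto_eventually] by blast
    qed
    have "x = y"
    proof (rule ccontr)
      assume ne: "x \<noteq> y"
      define b where "b = (1 / norm (x - y)) *\<^sub>R (x - y)"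
      have nb: "norm b = 1" using ne by (simp add: b_def)
      have b0: "b \<bullet> a = 0" "a \<bullet> b = 0" if "a \<in> B" for a
        using 0[OF that] by (simp_all add: b_def inner_commute)
      have "orthonormal (insert b B)"
        using B nb b0 by (auto simp: orthonormal_def pairwise_insert orthogonal_def)
      then have "b \<in> B" using maxB by blast
      then show False using b0[of b] nb by auto
    qed
    then show ?thesis using y by simp
  qed
  then show thesis using that orth unit unfolding basis_seq_def by blast
qed

lemma basis_seq_sums:
  assumes "basis_seq e"
  shows "(\<lambda>i. (x \<bullet> e i) * (z \<bullet> e i)) sums (x \<bullet> z)"
proof -
  have "(\<lambda>n. (\<Sum>i<n. (x \<bullet> e i) *\<^sub>R e i) \<bullet> z) \<longlonglongrightarrow> x \<bullet> z"
    using assms unfolding basis_seq_def by (intro tendsto_intros) blast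
  then show ?thesis
    unfolding sums_def inner_sum_left inner_scaleR_left inner_commute[of "e i" z for i] .
qed

lemma basis_seq_sums_norm:
  assumes "basis_seq e"
  shows "(\<lambda>i. (x \<bullet> e i)\<^sup>2) sums (norm x)\<^sup>2"
  using basis_seq_sums[OF assms, of x x]
  by (simp only: power2_norm_eq_inner) (simp only: power2_eq_square)

section \<open>Measures are determined by their characteristic functions\<close>

text \<open>The normalized weights are densities; their images on the line have equal characteristic
  functions and coincide by Levy's theorem. Both sides are then integrals of \<open>f\<close>
  against one law, so even the default value for a non-integrable \<open>f\<close> agrees. Total
  mass zero cannot be normalized and is treated apart.\<close>

lemma integral_eq_of_weighted_char_eq:
  fixes X V :: "'a \<Rightarrow> real" and Y W :: "'b \<Rightarrow> real" and f :: "real \<Rightarrow> real"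
  assumes [measurable]: "X \<in> borel_measurable M" "Y \<in> borel_measurable N" "f \<in> borel_measurable borel"
    and V: "integrable M V" "\<And>x. 0 \<le> V x" and W: "integrable N W" "\<And>x. 0 \<le> W x"
    and eq: "\<And>s. (CLINT x|M. V x * iexp (s * X x)) = (CLINT x|N. W x * iexp (s * Y x))"
  shows "(\<integral>x. V x * f (X x) \<partial>M) = (\<integral>x. W x * f (Y x) \<partial>N)"
proof -
  have [measurable]: "V \<in> borel_measurable M" "W \<in> borel_measurable N"
    using V W by auto
  define m where "m = (\<integral>x. V x \<partial>M)"
  have mW: "(\<integral>x. W x \<partial>N) = m" using eq[of 0] by (simp add: m_def)
  have m0: "0 \<le> m" using V by (simp add: m_def)
  show ?thesis
  proof (cases "m = 0")
    case True
    then have "AE x in M. V x = 0" "AE x in N. W x = 0"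
      using integral_nonneg_eq_0_iff_AE[OF V(1)] integral_nonneg_eq_0_iff_AE[OF W(1)] V(2) W(2) mW
      by (simp_all add: m_def)
    then have "(\<integral>x. V x * f (X x) \<partial>M) = (\<integral>x. 0 \<partial>M)" "(\<integral>x. W x * f (Y x) \<partial>N) = (\<integral>x. 0 \<partial>N)"
      by (auto intro!: integral_eq_zero_AE)
    then show ?thesis by simp
  next
    case False
    then have m: "m > 0" using m0 by simp
    define M1 where "M1 = distr (density M (\<lambda>x. ennreal (V x / m))) borel X"
    define N1 where "N1 = distr (density N (\<lambda>x. ennreal (W x / m))) borel Y"
    have "emeasure (density M (\<lambda>x. ennreal (V x / m))) (space M) = 1"
      using m V by (simp add: emeasure_density nn_integral_eq_integral m_def[symmetric] cong: nn_integral_cong)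
    then interpret M1: prob_space "density M (\<lambda>x. ennreal (V x / m))" by (intro prob_spaceI) simp
    have "emeasure (density N (\<lambda>x. ennreal (W x / m))) (space N) = 1"
      using m W by (simp add: emeasure_density nn_integral_eq_integral mW cong: nn_integral_cong)
    then interpret N1: prob_space "density N (\<lambda>x. ennreal (W x / m))" by (intro prob_spaceI) simp
    have rd: "real_distribution M1" "real_distribution N1"
      unfolding M1_def N1_def by (auto intro!: M1.real_distribution_distr N1.real_distribution_distr)
    have cM: "char M1 s = (CLINT x|M. V x * iexp (s * X x)) / m" for s
      unfolding M1_def char_def using m V
      by (simp add: integral_distr integral_density scaleR_conv_of_real flip: integral_divide_zero)
    have cN: "char N1 s = (CLINT x|N. W x * iexp (s * Y x)) / m" for s
      unfolding N1_def char_def using m W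
      by (simp add: integral_distr integral_density scaleR_conv_of_real flip: integral_divide_zero)
    have "M1 = N1" using rd by (rule Levy_uniqueness) (use eq in \<open>simp add: fun_eq_iff cM cN\<close>)
    moreover have "(\<integral>x. f x \<partial>M1) = (\<integral>x. V x * f (X x) \<partial>M) / m"
      unfolding M1_def using m V by (simp add: integral_distr integral_density flip: integral_divide_zero)
    moreover have "(\<integral>x. f x \<partial>N1) = (\<integral>x. W x * f (Y x) \<partial>N) / m"
      unfolding N1_def using m W by (simp add: integral_distr integral_density flip: integral_divide_zero)
    ultimately show ?thesis using m by simp
  qed
qed

text \<open>Bounded signed weights \<open>c\<close> reduce to the nonnegative weight \<open>1 + c\<close>.\<close>

lemma integral_eq_of_signed_weighted_char_eq:
  fixes X V c :: "'a \<Rightarrow> real" and Y W d :: "'b \<Rightarrow> real" and f :: "real \<Rightarrow> real"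
  assumes X[measurable]: "X \<in> borel_measurable M" and Y[measurable]: "Y \<in> borel_measurable N"
    and f[measurable]: "f \<in> borel_measurable borel"
    and V: "integrable M V" "\<And>x. 0 \<le> V x" and W: "integrable N W" "\<And>x. 0 \<le> W x"
    and c[measurable]: "c \<in> borel_measurable M" "\<And>x. \<bar>c x\<bar> \<le> 1"
    and d[measurable]: "d \<in> borel_measurable N" "\<And>x. \<bar>d x\<bar> \<le> 1"
    and eq: "\<And>s. (CLINT x|M. V x * iexp (s * X x)) = (CLINT x|N. W x * iexp (s * Y x))"
    and eqc: "\<And>s. (CLINT x|M. V x * c x * iexp (s * X x)) = (CLINT x|N. W x * d x * iexp (s * Y x))"
    and fi: "integrable M (\<lambda>x. V x * f (X x))" "integrable N (\<lambda>x. W x * f (Y x))"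
  shows "(\<integral>x. V x * c x * f (X x) \<partial>M) = (\<integral>x. W x * d x * f (Y x) \<partial>N)"
proof -
  have [measurable]: "V \<in> borel_measurable M" "W \<in> borel_measurable N"
    using V W by auto
  have ci: "integrable L (\<lambda>x. g x * b x)"
    if "integrable L g" "b \<in> borel_measurable L" "\<And>x. \<bar>b x\<bar> \<le> 1" for L and g b :: "'c \<Rightarrow> real"
  proof (rule Bochner_Integration.integrable_bound[OF that(1)])
    show "(\<lambda>x. g x * b x) \<in> borel_measurable L" using that by measurable
    show "AE x in L. norm (g x * b x) \<le> norm (g x)"
      using that(3) by (intro AE_I2) (simp add: abs_mult mult_right_le_one_le)
  qed
  have ie: "integrable L (\<lambda>x. of_real (g x) * iexp (s * b x))"
    if "integrable L g" "b \<in> borel_measurable L" for L and g b :: "'c \<Rightarrow> real" and s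
  proof (rule Bochner_Integration.integrable_bound[OF that(1)])
    show "(\<lambda>x. of_real (g x) * iexp (s * b x)) \<in> borel_measurable L"
      using that borel_measurable_integrable[OF that(1)] by measurable
  qed (simp add: norm_mult)
  have "(\<integral>x. (V x * (1 + c x)) * f (X x) \<partial>M) = (\<integral>x. (W x * (1 + d x)) * f (Y x) \<partial>N)"
  proof (rule integral_eq_of_weighted_char_eq[where V="\<lambda>x. V x * (1 + c x)" and W="\<lambda>x. W x * (1 + d x)"
        and X=X and Y=Y and f=f])
    show "integrable M (\<lambda>x. V x * (1 + c x))" "integrable N (\<lambda>x. W x * (1 + d x))"
      using ci[OF V(1) c] ci[OF W(1) d] V W by (simp_all add: distrib_left)
    show "0 \<le> V x * (1 + c x)" "0 \<le> W y * (1 + d y)" for x y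
      using V(2)[of x] W(2)[of y] c(2)[of x] d(2)[of y] by (simp_all add: abs_le_iff)
    show "(CLINT x|M. complex_of_real (V x * (1 + c x)) * iexp (s * X x))
        = (CLINT x|N. complex_of_real (W x * (1 + d x)) * iexp (s * Y x))" for s
      using eq[of s] eqc[of s] ie[OF V(1) X, of s] ie[OF W(1) Y, of s]
        ie[OF ci[OF V(1) c] X, of s] ie[OF ci[OF W(1) d] Y, of s]
      by (simp add: distrib_left distrib_right)
  qed measurable
  moreover have "(\<integral>x. V x * f (X x) \<partial>M) = (\<integral>x. W x * f (Y x) \<partial>N)"
    by (rule integral_eq_of_weighted_char_eq[OF X Y f V W eq])
  moreover have "integrable M (\<lambda>x. V x * c x * f (X x))" "integrable N (\<lambda>x. W x * d x * f (Y x))"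
    using ci[OF fi(1) c] ci[OF fi(2) d] by (simp_all add: mult_ac)
  ultimately show ?thesis using fi by (simp add: distrib_left distrib_right)
qed

lemma borel_measurable_inner_fixed [measurable]:
  "(\<lambda>u. u \<bullet> h) \<in> borel_measurable (borel :: 'a::real_inner measure)"
  by (intro borel_measurable_continuous_onI continuous_intros)

text \<open>An open set is where the distance \<open>g\<close> to its complement is positive. By
  continuity \<open>g\<close> is the pointwise limit of \<open>g\<close> along the basis expansions,
  each a continuous function of finitely many coordinates.\<close>

lemma sets_borel_eq_coordinates:
  fixes e :: "nat \<Rightarrow> 'a::real_inner"
  assumes e: "basis_seq e"
  shows "sets (borel :: 'a measure) \<subseteq> sets (vimage_algebra UNIV (\<lambda>x i. x \<bullet> e i) (borel :: (nat \<Rightarrow> real) measure))"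
    (is "_ \<subseteq> sets ?V")
proof -
  have "U \<in> sets ?V" if U: "open U" for U
  \<comment> \<open>The distance to the empty set is 0 by convention, so the description by
    \<open>g\<close> fails for the whole space.\<close>
  proof (cases "U = UNIV")
    case True
    then show ?thesis using sets.top[of ?V] by simp
  next
    case False
    define g where "g x = infdist x (- U)" for x
    have g: "continuous_on UNIV g" unfolding g_def by (intro continuous_intros)
    define p where "p n a = (\<Sum>i<n. a i *\<^sub>R e i)" for n and a :: "nat \<Rightarrow> real"
    have "continuous_on UNIV (\<lambda>a. a i)" for i :: nat
      by (rule continuous_on_product_coordinates)
    then have p: "continuous_on UNIV (p n)" for n unfolding p_def by (intro continuous_intros)
    have gp: "(\<lambda>a. g (p n a)) \<in> borel_measurable borel" for n
      by (intro borel_measurable_continuous_onI continuous_on_compose2[OF g p]) auto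
    have co: "(\<lambda>x i. x \<bullet> e i) \<in> ?V \<rightarrow>\<^sub>M borel" by (rule measurable_vimage_algebra1) simp
    have "(\<lambda>x. g (p n (\<lambda>i. x \<bullet> e i))) \<in> borel_measurable ?V" for n
      using measurable_compose[OF co gp] by simp
    moreover have "(\<lambda>n. g (p n (\<lambda>i. x \<bullet> e i))) \<longlonglongrightarrow> g x" for x
      using e unfolding basis_seq_def p_def by (intro continuous_on_tendsto_compose[OF g]) auto
    ultimately have [measurable]: "g \<in> borel_measurable ?V" by (rule borel_measurable_LIMSEQ_metric)
    have "{x \<in> space ?V. g x > 0} \<in> sets ?V" by measurable
    also have "{x \<in> space ?V. g x > 0} = U"
      using in_closed_iff_infdist_zero[of "- U"] False U infdist_nonneg[of _ "- U"]
      by (auto simp: g_def closed_Compl less_le)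
    finally show ?thesis .
  qed
  then have "sigma_sets UNIV {S. open S} \<subseteq> sets ?V"
    by (intro sets.sigma_sets_subset[of _ ?V, simplified]) auto
  then show ?thesis by (simp add: borel_def)
qed

text \<open>Indicators of coordinates are inserted under the integral one at a time. Each insertion
  is a one-dimensional uniqueness statement in direction \<open>e j\<close>, with the indicators
  inserted before as weight and the real and imaginary parts of the remaining character as bounded
  signed factors.\<close>

lemma measure_eqI_char:
  fixes M N :: "'a::real_inner measure" and e :: "nat \<Rightarrow> 'a"
  assumes e: "basis_seq e" and M: "prob_space M" "sets M = sets borel"
    and N: "prob_space N" "sets N = sets borel"
    and char: "\<And>h. (CLINT u|M. iexp (u \<bullet> h)) = (CLINT u|N. iexp (u \<bullet> h))"
  shows "M = N"
proof -
  interpret M: prob_space M by fact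
  interpret N: prob_space N by fact
  have [measurable_cong]: "sets M = sets borel" "sets N = sets borel" by fact+
  define V where "V J A u = (\<Prod>j\<in>J. indicator (A j) (u \<bullet> e j) :: real)" for J A and u :: 'a
  have V[measurable]: "V J A \<in> borel_measurable borel" if "\<And>j. A j \<in> sets borel" for J A
    unfolding V_def using that by measurable
  have V01: "0 \<le> V J A u \<and> V J A u \<le> 1" for J A u
    unfolding V_def by (auto intro!: prod_nonneg prod_le_1 simp: indicator_def)
  \<comment> \<open>The vector \<open>h\<close> must be arbitrary: the new direction
    \<open>e j\<close> is reached by shifting it to \<open>s e_j + h\<close> and
    \<open>s e_j - h\<close>.\<close>
  have *: "(CLINT u|M. V J A u * iexp (u \<bullet> h)) = (CLINT u|N. V J A u * iexp (u \<bullet> h))"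
    if J: "finite J" and A: "\<And>j. A j \<in> sets borel" for J A h
    using J
  proof (induction J arbitrary: h rule: finite_induct)
    case empty
    then show ?case using char by (simp add: V_def)
  next
    case (insert j J)
    note [measurable] = V[OF A]
    have iM: "integrable M (\<lambda>u. V J A u * b u)" and iN: "integrable N (\<lambda>u. V J A u * b u)"
      if "b \<in> borel_measurable borel" "\<And>x. \<bar>b x\<bar> \<le> 1" for b
    proof -
      have "norm (V J A u * b u) \<le> 1" for u
        using V01[of J A u] that(2)[of u] by (simp add: abs_mult mult_le_one)
      then show "integrable M (\<lambda>u. V J A u * b u)" "integrable N (\<lambda>u. V J A u * b u)"
        using that(1) by (auto intro!: M.integrable_const_bound[where B=1] N.integrable_const_bound[where B=1])
    qed
    have ic: "integrable M (\<lambda>u. V J A u * iexp (u \<bullet> k))" "integrable N (\<lambda>u. V J A u * iexp (u \<bullet> k))" for k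
      using V01 by (auto intro!: M.integrable_const_bound[where B=1] N.integrable_const_bound[where B=1] simp: norm_mult)
    \<comment> \<open>Trades all characters in direction \<open>e j\<close> for the indicator of
      \<open>A j\<close> in that direction.\<close>
    have step: "(\<integral>u. V J A u * b u * indicator (A j) (u \<bullet> e j) \<partial>M) = (\<integral>u. V J A u * b u * indicator (A j) (u \<bullet> e j) \<partial>N)"
      if [measurable]: "b \<in> borel_measurable borel" and b: "\<And>x. \<bar>b x\<bar> \<le> 1"
        and eqb: "\<And>s. (CLINT u|M. V J A u * b u * iexp (s * (u \<bullet> e j))) = (CLINT u|N. V J A u * b u * iexp (s * (u \<bullet> e j)))"
      for b
    proof (rule integral_eq_of_signed_weighted_char_eq[where f="indicator (A j)" and X="\<lambda>u. u \<bullet> e j" and Y="\<lambda>u. u \<bullet> e j"])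
      show "integrable M (V J A)" "integrable N (V J A)" using iM[of "\<lambda>_. 1"] iN[of "\<lambda>_. 1"] by simp_all
      show "(CLINT u|M. V J A u * iexp (s * (u \<bullet> e j))) = (CLINT u|N. V J A u * iexp (s * (u \<bullet> e j)))" for s
        using insert.IH[of "s *\<^sub>R e j"] by simp
      show "integrable M (\<lambda>u. V J A u * indicator (A j) (u \<bullet> e j))" "integrable N (\<lambda>u. V J A u * indicator (A j) (u \<bullet> e j))"
        using A[of j] by (auto intro!: iM iN simp: indicator_def)
      show "indicator (A j) \<in> borel_measurable (borel :: real measure)" using A[of j] by simp
    qed (use b eqb V01 in auto)
    \<comment> \<open>Euler's formulas, which reduce the signed factors to characters covered by the
      induction hypothesis.\<close>
    have trig: "of_real (V J A u) * of_real (cos (u \<bullet> h)) * iexp (s * (u \<bullet> e j))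
        = (of_real (V J A u) * iexp (u \<bullet> (s *\<^sub>R e j + h)) + of_real (V J A u) * iexp (u \<bullet> (s *\<^sub>R e j - h))) / 2"
      "of_real (V J A u) * of_real (sin (u \<bullet> h)) * iexp (s * (u \<bullet> e j))
        = (of_real (V J A u) * iexp (u \<bullet> (s *\<^sub>R e j + h)) - of_real (V J A u) * iexp (u \<bullet> (s *\<^sub>R e j - h))) / (2 * \<i>)" for u s
      by (simp_all add: cos_of_real[symmetric] sin_of_real[symmetric] cos_exp_eq sin_exp_eq inner_add_right inner_diff_right
          exp_add exp_diff exp_minus field_simps flip: exp_add exp_diff)
    have c: "(\<integral>u. V J A u * cos (u \<bullet> h) * indicator (A j) (u \<bullet> e j) \<partial>M) = (\<integral>u. V J A u * cos (u \<bullet> h) * indicator (A j) (u \<bullet> e j) \<partial>N)"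
    proof (rule step)
      show "(CLINT u|M. V J A u * cos (u \<bullet> h) * iexp (s * (u \<bullet> e j)))
          = (CLINT u|N. V J A u * cos (u \<bullet> h) * iexp (s * (u \<bullet> e j)))" for s
        by (simp only: of_real_mult[of "V J A u" for u] trig integral_divide_zero
            Bochner_Integration.integral_add[OF ic(1) ic(1)] Bochner_Integration.integral_add[OF ic(2) ic(2)] insert.IH)
    qed auto
    have s: "(\<integral>u. V J A u * sin (u \<bullet> h) * indicator (A j) (u \<bullet> e j) \<partial>M) = (\<integral>u. V J A u * sin (u \<bullet> h) * indicator (A j) (u \<bullet> e j) \<partial>N)"
    proof (rule step)
      show "(CLINT u|M. V J A u * sin (u \<bullet> h) * iexp (s * (u \<bullet> e j)))
          = (CLINT u|N. V J A u * sin (u \<bullet> h) * iexp (s * (u \<bullet> e j)))" for s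
        by (simp only: of_real_mult[of "V J A u" for u] trig integral_divide_zero
            Bochner_Integration.integral_diff[OF ic(1) ic(1)] Bochner_Integration.integral_diff[OF ic(2) ic(2)] insert.IH)
    qed auto
    have Vins: "V (insert j J) A u * iexp (u \<bullet> h) = of_real (V J A u * cos (u \<bullet> h) * indicator (A j) (u \<bullet> e j))
        + \<i> * of_real (V J A u * sin (u \<bullet> h) * indicator (A j) (u \<bullet> e j))" for u
      using insert.hyps by (simp add: V_def exp_Euler cos_of_real sin_of_real algebra_simps)

    have ii: "integrable M (\<lambda>u. V J A u * cos (u \<bullet> h) * indicator (A j) (u \<bullet> e j))"
        "integrable N (\<lambda>u. V J A u * cos (u \<bullet> h) * indicator (A j) (u \<bullet> e j))"
        "integrable M (\<lambda>u. V J A u * sin (u \<bullet> h) * indicator (A j) (u \<bullet> e j))"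
        "integrable N (\<lambda>u. V J A u * sin (u \<bullet> h) * indicator (A j) (u \<bullet> e j))"
      using A[of j] by (simp_all only: mult.assoc) (auto intro!: iM iN simp: indicator_def)
    show ?case
      unfolding Vins using ii c s by (simp del: of_real_mult)
  qed
  define \<psi> where "\<psi> x i = x \<bullet> e i" for x :: 'a and i :: nat
  have \<psi>[measurable]: "\<psi> \<in> borel \<rightarrow>\<^sub>M (\<Pi>\<^sub>M i\<in>UNIV. borel)"
    unfolding \<psi>_def by (rule measurable_PiM_single') auto
  have "distr M (\<Pi>\<^sub>M i\<in>UNIV. borel) \<psi> = distr N (\<Pi>\<^sub>M i\<in>UNIV. borel) \<psi>"
  proof (rule measure_eqI_PiM_infinite)
    show "finite_measure (distr M (Pi\<^sub>M UNIV (\<lambda>i. borel)) \<psi>)" by (rule M.finite_measure_distr) simp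
    fix A :: "nat \<Rightarrow> real set" and J
    assume J: "finite J" and A': "\<And>i. i \<in> J \<Longrightarrow> A i \<in> sets borel"
    \<comment> \<open>Extending by \<open>UNIV\<close> makes every component Borel, as
      \<open>*\<close> requires, without changing the cylinder over \<open>J\<close>.\<close>
    define A1 where "A1 i = (if i \<in> J then A i else UNIV)" for i
    have A1: "A1 i \<in> sets borel" for i using A' by (simp add: A1_def)
    define E where "E = \<psi> -` prod_emb UNIV (\<lambda>i. borel) J (Pi\<^sub>E J A)"
    have E: "indicator E u = V J A1 u" for u
    proof -
      have "u \<in> E \<longleftrightarrow> (\<forall>j\<in>J. u \<bullet> e j \<in> A1 j)"
        by (auto simp: E_def prod_emb_def \<psi>_def A1_def PiE_iff)
      then show ?thesis using J by (auto simp: V_def indicator_def intro: prod.neutral)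
    qed
    have pe: "prod_emb UNIV (\<lambda>i. borel) J (Pi\<^sub>E J A) \<in> sets (Pi\<^sub>M UNIV (\<lambda>i. borel))"
      using J A' by (intro sets_PiM_I) auto
    have Eb: "E \<in> sets borel" using measurable_sets[OF \<psi> pe] by (simp add: E_def)
    have "complex_of_real (\<integral>u. V J A1 u \<partial>M) = complex_of_real (\<integral>u. V J A1 u \<partial>N)"
    proof -
      have "(CLINT u|M. V J A1 u * iexp (u \<bullet> 0)) = (CLINT u|N. V J A1 u * iexp (u \<bullet> 0))"
        by (rule *[OF J A1])
      then show ?thesis by simp
    qed
    then have "measure M E = measure N E"
      using Eb sets_eq_imp_space_eq[OF M(2)] sets_eq_imp_space_eq[OF N(2)] by (simp flip: E)
    then show "emeasure (distr M (Pi\<^sub>M UNIV (\<lambda>i. borel)) \<psi>) (prod_emb UNIV (\<lambda>i. borel) J (Pi\<^sub>E J A))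
      = emeasure (distr N (Pi\<^sub>M UNIV (\<lambda>i. borel)) \<psi>) (prod_emb UNIV (\<lambda>i. borel) J (Pi\<^sub>E J A))"
      using pe sets_eq_imp_space_eq[OF M(2)] sets_eq_imp_space_eq[OF N(2)]
      by (simp add: emeasure_distr E_def M.emeasure_eq_measure N.emeasure_eq_measure)
  qed auto
  \<comment> \<open>On countably many real coordinates the product sigma-algebra is the Borel
    algebra of the product topology, the one used in
    \<open>sets_borel_eq_coordinates\<close>.\<close>
  then have eqd: "distr M borel \<psi> = distr N borel \<psi>"
    using distr_cong[of M M "Pi\<^sub>M UNIV (\<lambda>i. borel)" borel \<psi> \<psi>] distr_cong[of N N "Pi\<^sub>M UNIV (\<lambda>i. borel)" borel \<psi> \<psi>]
    by (simp add: sets_PiM_equal_borel)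
  have \<psi>b: "\<psi> \<in> borel \<rightarrow>\<^sub>M borel" using \<psi> measurable_cong_sets[OF refl sets_PiM_equal_borel] by blast
  show "M = N"
  proof (rule measure_eqI)
    show "sets M = sets N" by (simp add: M N)
    fix S assume "S \<in> sets M"
    then have "S \<in> sets (vimage_algebra UNIV \<psi> borel)"
      using sets_borel_eq_coordinates[OF e] M(2) unfolding \<psi>_def[abs_def] by auto
    then obtain T where T: "T \<in> sets borel" "S = \<psi> -` T"
      by (subst (asm) sets_vimage_algebra2) auto
    have "emeasure (distr M borel \<psi>) T = emeasure (distr N borel \<psi>) T" by (simp only: eqd)
    then show "emeasure M S = emeasure N S"
      using T \<psi>b sets_eq_imp_space_eq[OF M(2)] sets_eq_imp_space_eq[OF N(2)]
      by (simp add: emeasure_distr measurable_cong_sets[OF M(2) refl] measurable_cong_sets[OF N(2) refl])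
  qed
qed

section \<open>Gaussian measures\<close>

lemma prob_space_normal_law: "0 \<le> v \<Longrightarrow> prob_space (normal_law a v)"
  unfolding normal_law_def by (auto intro!: prob_space_return prob_space_normal_density)

lemma sets_normal_law [simp, measurable_cong]: "sets (normal_law a v) = sets borel"
  by (simp add: normal_law_def)

lemma char_normal_law:
  assumes v: "0 \<le> v"
  shows "char (normal_law a v) t = iexp (t * a) * exp (- (v * t\<^sup>2) / 2)"
proof (cases "v = 0")
  case True
  then show ?thesis by (simp add: char_def normal_law_def integral_return)
next
  case False
  then have v: "v > 0" using v by simp
  have *: "normal_density a (sqrt v) (a + sqrt v * x) = std_normal_density x / sqrt v" for x
    using v by (simp add: normal_density_def real_sqrt_mult field_simps)
  have "char (normal_law a v) t = (CLINT x|lborel. normal_density a (sqrt v) x *\<^sub>R iexp (t * x))"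
    using False by (simp add: char_def normal_law_def integral_density)
  also have "\<dots> = sqrt v *\<^sub>R (CLINT x|lborel. normal_density a (sqrt v) (a + sqrt v * x) *\<^sub>R iexp (t * (a + sqrt v * x)))"
    using v by (subst lborel_integral_real_affine[where c="sqrt v" and t=a]) auto
  also have "\<dots> = (CLINT x|lborel. iexp (t * a) * (std_normal_density x *\<^sub>R iexp ((t * sqrt v) * x)))"
    unfolding * using v
    by (subst integral_scaleR_right[symmetric])
      (auto intro!: Bochner_Integration.integral_cong simp: scaleR_conv_of_real algebra_simps exp_add)
  also have "\<dots> = iexp (t * a) * char std_normal_distribution (t * sqrt v)"
    unfolding integral_mult_right_zero by (simp add: char_def integral_density)
  also have "\<dots> = iexp (t * a) * exp (- (v * t\<^sup>2) / 2)"
    using v by (simp add: char_std_normal_distribution power_mult_distrib mult.commute exp_of_real)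
  finally show ?thesis .
qed

text \<open>Completing the square: for \<open>s > 0\<close> precisions add,
  \<open>1 / \<tau> = 1 / s + a\<close>, which admits negative \<open>a\<close> while
  \<open>1 + a s\<close> is positive. \<open>K\<close> collects the constant left by the square and
  the ratio of the two normalizers. The point mass \<open>s = 0\<close> obeys the same
  formulas.\<close>

lemma integral_normal_law_tilt:
  fixes s a b t :: real
  assumes s: "0 \<le> s" and pos: "0 < 1 + a * s"
  defines "\<tau> \<equiv> s / (1 + a * s)" and "K \<equiv> exp (b\<^sup>2 * (s / (1 + a * s)) / 2) / sqrt (1 + a * s)"
  shows "integrable (normal_law 0 s) (\<lambda>x. exp (b * x - a / 2 * x\<^sup>2))"
    and "(\<integral>x. exp (b * x - a / 2 * x\<^sup>2) \<partial>normal_law 0 s) = K"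
    and "(CLINT x|normal_law 0 s. exp (b * x - a / 2 * x\<^sup>2) * iexp (t * x))
      = K * (iexp (t * (b * \<tau>)) * exp (- (\<tau> * t\<^sup>2) / 2))"
proof -
  let ?f = "\<lambda>x. exp (b * x - a / 2 * x\<^sup>2)"
  have \<tau>: "0 \<le> \<tau>" using s pos by (simp add: \<tau>_def)
  have "integrable (normal_law 0 s) ?f \<and> (\<integral>x. ?f x \<partial>normal_law 0 s) = K \<and>
    (CLINT x|normal_law 0 s. ?f x * iexp (t * x)) = K * char (normal_law (b * \<tau>) \<tau>) t"
  proof (cases "s = 0")
    case True
    have "integrable (return borel 0) ?f"
    proof -
      interpret prob_space "return borel (0::real)" by (rule prob_space_return) simp
      show ?thesis
        by (rule integrable_const_bound[where B=1]) (auto simp: AE_return)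
    qed
    then show ?thesis
      using True by (simp add: normal_law_def integral_return K_def \<tau>_def char_def)
  next
    case False
    then have s: "s > 0" using s by simp
    then have \<tau>: "\<tau> > 0" using pos by (simp add: \<tau>_def)
    have id: "normal_density 0 (sqrt s) x * ?f x = K * normal_density (b * \<tau>) (sqrt \<tau>) x" for x
    proof -
      have K: "K = exp (b\<^sup>2 * \<tau> / 2) / sqrt (1 + a * s)" by (simp add: K_def \<tau>_def)
      have s\<tau>: "s = \<tau> * (1 + a * s)" using pos by (simp add: \<tau>_def)
      have i\<tau>: "1 / \<tau> = 1 / s + a" using s pos by (simp add: \<tau>_def field_simps)
      have "b * x - a / 2 * x\<^sup>2 - x\<^sup>2 / (2 * s) = b * x - x\<^sup>2 / 2 * (1 / s + a)"
        using s by (simp add: field_simps)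
      also have "\<dots> = b * x - x\<^sup>2 / 2 * (1 / \<tau>)" by (simp only: i\<tau>)
      also have "\<dots> = b\<^sup>2 * \<tau> / 2 - (x - b * \<tau>)\<^sup>2 / (2 * \<tau>)"
        using \<tau> by (simp add: field_simps power2_eq_square)
      finally have e: "exp (- x\<^sup>2 / (2 * s)) * ?f x = exp (b\<^sup>2 * \<tau> / 2) * exp (- (x - b * \<tau>)\<^sup>2 / (2 * \<tau>))"
        by (simp add: mult_exp_exp algebra_simps)
      have "sqrt (2 * pi * s) = sqrt (1 + a * s) * sqrt (2 * pi * \<tau>)"
        by (subst s\<tau>) (simp add: real_sqrt_mult)
      then show ?thesis
        using e s \<tau> pos by (simp add: normal_density_def K)
    qed
    have fm: "?f \<in> borel_measurable borel" by measurable
    have "integrable (normal_law 0 s) ?f"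
      using s \<tau> fm by (simp add: normal_law_def integrable_density id del: times_divide_eq_left)
    moreover have "(\<integral>x. ?f x \<partial>normal_law 0 s) = K"
      using s \<tau> fm by (simp add: normal_law_def integral_density id del: times_divide_eq_left)
    moreover have "(CLINT x|normal_law 0 s. ?f x * iexp (t * x)) = K * char (normal_law (b * \<tau>) \<tau>) t"
    proof -
      have "(CLINT x|normal_law 0 s. ?f x * iexp (t * x))
          = (CLINT x|lborel. (normal_density 0 (sqrt s) x * ?f x) *\<^sub>R iexp (t * x))"
        using s by (simp add: normal_law_def integral_density scaleR_conv_of_real mult_ac)
      also have "\<dots> = K * char (normal_law (b * \<tau>) \<tau>) t"
        unfolding id using \<tau> by (simp add: normal_law_def char_def integral_density scaleR_conv_of_real mult_ac)
      finally show ?thesis .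
    qed
    ultimately show ?thesis by blast
  qed
  then show "integrable (normal_law 0 s) ?f" "(\<integral>x. ?f x \<partial>normal_law 0 s) = K"
    "(CLINT x|normal_law 0 s. exp (b * x - a / 2 * x\<^sup>2) * iexp (t * x))
      = K * (iexp (t * (b * \<tau>)) * exp (- (\<tau> * t\<^sup>2) / 2))"
    using char_normal_law[OF \<tau>] by auto
qed

lemma is_gaussianD:
  assumes "is_gaussian M m C"
  shows "prob_space M" "sets M = sets borel" "covariance_operator C" "positive_operator C"
    "distr M borel (\<lambda>u. u \<bullet> h) = normal_law (m \<bullet> h) (C h \<bullet> h)"
  using assms by (auto simp: is_gaussian_def covariance_operator_def)

lemma char_gaussian:
  assumes M: "is_gaussian M m C"
  shows "(CLINT u|M. iexp (u \<bullet> h)) = iexp (m \<bullet> h) * exp (- (C h \<bullet> h) / 2)"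
proof -
  note [measurable_cong] = is_gaussianD(2)[OF M]
  have "(CLINT u|M. iexp (u \<bullet> h)) = char (distr M borel (\<lambda>u. u \<bullet> h)) 1"
    by (simp add: char_def integral_distr)
  also have "\<dots> = iexp (m \<bullet> h) * exp (- (C h \<bullet> h) / 2)"
    unfolding is_gaussianD(5)[OF M]
    using positive_operator_nonneg[OF is_gaussianD(4)[OF M]] by (simp add: char_normal_law)
  finally show ?thesis .
qed

text \<open>Scaling \<open>h\<close> by \<open>t\<close> makes the hypothesis the whole
  characteristic function of the marginal along \<open>h\<close>.\<close>

lemma is_gaussianI_char:
  assumes M: "prob_space M" "sets M = sets borel" and C: "covariance_operator C"
    and char: "\<And>h. (CLINT u|M. iexp (u \<bullet> h)) = iexp (m \<bullet> h) * exp (- (C h \<bullet> h) / 2)"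
  shows "is_gaussian M m C"
  unfolding is_gaussian_def
proof (intro conjI allI)
  fix h
  interpret prob_space M by fact
  note [measurable_cong] = M(2)
  have C0: "0 \<le> C h \<bullet> h"
    using C by (auto simp: covariance_operator_def intro: positive_operator_nonneg)
  interpret N: prob_space "normal_law (m \<bullet> h) (C h \<bullet> h)" by (rule prob_space_normal_law[OF C0])
  show "distr M borel (\<lambda>u. u \<bullet> h) = normal_law (m \<bullet> h) (C h \<bullet> h)"
  proof (rule Levy_uniqueness)
    show "real_distribution (distr M borel (\<lambda>u. u \<bullet> h))" by (rule real_distribution_distr) simp
    show "real_distribution (normal_law (m \<bullet> h) (C h \<bullet> h))"
      by unfold_locales (auto simp: sets_eq_imp_space_eq[OF sets_normal_law])
    show "char (distr M borel (\<lambda>u. u \<bullet> h)) = char (normal_law (m \<bullet> h) (C h \<bullet> h))"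
    proof
      fix t
      have "char (distr M borel (\<lambda>u. u \<bullet> h)) t = (CLINT u|M. iexp (u \<bullet> (t *\<^sub>R h)))"
        by (simp add: char_def integral_distr)
      then show "char (distr M borel (\<lambda>u. u \<bullet> h)) t = char (normal_law (m \<bullet> h) (C h \<bullet> h)) t"
        using C0 char[of "t *\<^sub>R h"]
        by (simp add: char_normal_law blinfun.scaleR_right power2_eq_square mult_ac)
    qed
  qed
qed (use M C in auto)

lemma gaussian_unique:
  fixes e :: "nat \<Rightarrow> 'a::{real_inner, complete_space}" and M :: "'a measure"
  assumes "basis_seq e" "is_gaussian M m C" "is_gaussian N m C"
  shows "M = N"
  using assms
  by (intro measure_eqI_char[OF assms(1)]) (auto simp: char_gaussian is_gaussianD)

text \<open>Uncorrelated Gaussian functionals are independent, here in the form that is used.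
  Characters in \<open>k\<close> and \<open>w\<close> factor, so against every character in
  \<open>k\<close> the factor \<open>cos (u . w)\<close> acts as a constant and
  \<open>sin (u . w)\<close> as zero; Levy uniqueness with signed weights extends this to all
  integrable functions of \<open>u . k\<close>.\<close>

lemma integral_gaussian_uncorrelated:
  fixes g :: "real \<Rightarrow> complex" and C :: "'a::{real_inner, complete_space} \<Rightarrow>\<^sub>L 'a"
  assumes M: "is_gaussian M 0 C" and w: "C k \<bullet> w = 0"
    and g: "g \<in> borel_measurable borel" "integrable M (\<lambda>u. g (u \<bullet> k))"
  shows "(CLINT u|M. g (u \<bullet> k) * iexp (u \<bullet> w)) = complex_of_real (exp (- (C w \<bullet> w) / 2)) * (CLINT u|M. g (u \<bullet> k))"
proof -
  interpret prob_space M by (rule is_gaussianD(1)[OF M])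
  note [measurable_cong] = is_gaussianD(2)[OF M]
  note [measurable] = g(1)
  have pos: "positive_operator C" by (rule is_gaussianD(4)[OF M])
  define q where "q = exp (- (C w \<bullet> w) / 2)"
  have q: "0 \<le> q" "\<bar>q\<bar> \<le> 1" using positive_operator_nonneg[OF pos, of w] by (auto simp: q_def)
  have w': "C w \<bullet> k = 0" using w positive_operator_sym[OF pos, of w k] by (simp add: inner_commute)
  have ch: "(CLINT u|M. iexp (u \<bullet> (s *\<^sub>R k + r *\<^sub>R w))) = complex_of_real (exp (- (r\<^sup>2 * (C w \<bullet> w)) / 2)) * (CLINT u|M. iexp (s * (u \<bullet> k)))" for s r
  proof -
    have "C (s *\<^sub>R k + r *\<^sub>R w) \<bullet> (s *\<^sub>R k + r *\<^sub>R w) = s\<^sup>2 * (C k \<bullet> k) + r\<^sup>2 * (C w \<bullet> w)"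
      using w w' by (simp add: blinfun.add_right blinfun.scaleR_right inner_add_left inner_add_right power2_eq_square)
    moreover have "(CLINT u|M. iexp (s * (u \<bullet> k))) = exp (- (s\<^sup>2 * (C k \<bullet> k)) / 2)"
      using char_gaussian[OF M, of "s *\<^sub>R k"] by (simp add: blinfun.scaleR_right power2_eq_square mult.assoc)
    ultimately show ?thesis
      using char_gaussian[OF M, of "s *\<^sub>R k + r *\<^sub>R w"] by (simp add: exp_add[symmetric] exp_of_real field_simps flip: of_real_mult)
  qed
  have ie: "integrable M (\<lambda>u. iexp (u \<bullet> h))" for h by (rule integrable_const_bound[where B=1]) auto
  have trig: "of_real (cos (u \<bullet> w)) * iexp (s * (u \<bullet> k))
      = (iexp (u \<bullet> (s *\<^sub>R k + 1 *\<^sub>R w)) + iexp (u \<bullet> (s *\<^sub>R k + (- 1) *\<^sub>R w))) / 2"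
    "of_real (sin (u \<bullet> w)) * iexp (s * (u \<bullet> k))
      = (iexp (u \<bullet> (s *\<^sub>R k + 1 *\<^sub>R w)) - iexp (u \<bullet> (s *\<^sub>R k + (- 1) *\<^sub>R w))) / (2 * \<i>)" for u s
    by (simp_all add: cos_of_real[symmetric] sin_of_real[symmetric] cos_exp_eq sin_exp_eq inner_add_right inner_diff_right
        exp_add exp_diff exp_minus field_simps flip: exp_add exp_diff)
  have c: "(CLINT u|M. of_real (cos (u \<bullet> w)) * iexp (s * (u \<bullet> k))) = q * (CLINT u|M. iexp (s * (u \<bullet> k)))" for s
    by (simp only: trig integral_divide_zero Bochner_Integration.integral_add[OF ie ie] ch q_def) simp
  have s: "(CLINT u|M. of_real (sin (u \<bullet> w)) * iexp (s * (u \<bullet> k))) = 0" for s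
    by (simp only: trig integral_divide_zero Bochner_Integration.integral_diff[OF ie ie] ch) simp
  have cos_eq: "(\<integral>u. cos (u \<bullet> w) * f (u \<bullet> k) \<partial>M) = q * (\<integral>u. f (u \<bullet> k) \<partial>M)"
    and sin_eq: "(\<integral>u. sin (u \<bullet> w) * f (u \<bullet> k) \<partial>M) = 0"
    if f[measurable]: "f \<in> borel_measurable borel" and fi: "integrable M (\<lambda>u. f (u \<bullet> k))" for f :: "real \<Rightarrow> real"
  proof -
    have "(\<integral>u. 1 * cos (u \<bullet> w) * f (u \<bullet> k) \<partial>M) = (\<integral>u. 1 * q * f (u \<bullet> k) \<partial>M)"
      by (rule integral_eq_of_signed_weighted_char_eq[where V="\<lambda>_. 1" and W="\<lambda>_. 1" and c="\<lambda>u. cos (u \<bullet> w)"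
            and d="\<lambda>_. q" and X="\<lambda>u. u \<bullet> k" and Y="\<lambda>u. u \<bullet> k" and f=f])
        (use q fi c in auto)
    then show "(\<integral>u. cos (u \<bullet> w) * f (u \<bullet> k) \<partial>M) = q * (\<integral>u. f (u \<bullet> k) \<partial>M)" by simp
    have "(\<integral>u. 1 * sin (u \<bullet> w) * f (u \<bullet> k) \<partial>M) = (\<integral>u. 1 * 0 * f (u \<bullet> k) \<partial>M)"
      by (rule integral_eq_of_signed_weighted_char_eq[where V="\<lambda>_. 1" and W="\<lambda>_. 1" and c="\<lambda>u. sin (u \<bullet> w)"
            and d="\<lambda>_. 0" and X="\<lambda>u. u \<bullet> k" and Y="\<lambda>u. u \<bullet> k" and f=f])
        (use q fi s in auto)
    then show "(\<integral>u. sin (u \<bullet> w) * f (u \<bullet> k) \<partial>M) = 0" by simp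
  qed
  have ti: "integrable M (\<lambda>u. b (u \<bullet> w) * f (u \<bullet> k))"
    if "integrable M (\<lambda>u. f (u \<bullet> k))" "f \<in> borel_measurable borel" "b \<in> borel_measurable borel" "\<And>x. \<bar>b x\<bar> \<le> 1"
    for f b :: "real \<Rightarrow> real"
    using that(2,3,4)
    by (intro Bochner_Integration.integrable_bound[OF that(1)]) (auto simp: abs_mult mult_left_le_one_le)
  have gR: "(\<lambda>x. Re (g x)) \<in> borel_measurable borel" "(\<lambda>x. Im (g x)) \<in> borel_measurable borel"
    "integrable M (\<lambda>u. Re (g (u \<bullet> k)))" "integrable M (\<lambda>u. Im (g (u \<bullet> k)))"
    using g(2) by (auto intro: integrable_Re integrable_Im)
  have gi: "integrable M (\<lambda>u. g (u \<bullet> k) * iexp (u \<bullet> w))"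
    by (rule Bochner_Integration.integrable_bound[OF g(2)]) (auto simp: norm_mult)
  show ?thesis
  proof (rule complex_eqI)
    have "Re (CLINT u|M. g (u \<bullet> k) * iexp (u \<bullet> w)) = (\<integral>u. Re (g (u \<bullet> k) * iexp (u \<bullet> w)) \<partial>M)"
      by (rule integral_Re[OF gi, symmetric])
    also have "\<dots> = (\<integral>u. cos (u \<bullet> w) * Re (g (u \<bullet> k)) - sin (u \<bullet> w) * Im (g (u \<bullet> k)) \<partial>M)"
      by (simp add: Re_exp Im_exp mult_ac)
    also have "\<dots> = q * (\<integral>u. Re (g (u \<bullet> k)) \<partial>M)"
      using ti[OF gR(3,1), of cos] ti[OF gR(4,2), of sin] cos_eq[OF gR(1,3)] sin_eq[OF gR(2,4)] by simp
    finally show "Re (CLINT u|M. g (u \<bullet> k) * iexp (u \<bullet> w)) = Re (complex_of_real (exp (- (C w \<bullet> w) / 2)) * (CLINT u|M. g (u \<bullet> k)))"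
      using g(2) by (simp add: q_def exp_of_real Re_exp Im_exp)
    have "Im (CLINT u|M. g (u \<bullet> k) * iexp (u \<bullet> w)) = (\<integral>u. Im (g (u \<bullet> k) * iexp (u \<bullet> w)) \<partial>M)"
      by (rule integral_Im[OF gi, symmetric])
    also have "\<dots> = (\<integral>u. cos (u \<bullet> w) * Im (g (u \<bullet> k)) + sin (u \<bullet> w) * Re (g (u \<bullet> k)) \<partial>M)"
      by (simp add: Re_exp Im_exp mult_ac add.commute)
    also have "\<dots> = q * (\<integral>u. Im (g (u \<bullet> k)) \<partial>M)"
      using ti[OF gR(4,2), of cos] ti[OF gR(3,1), of sin] cos_eq[OF gR(2,4)] sin_eq[OF gR(1,3)] by simp
    finally show "Im (CLINT u|M. g (u \<bullet> k) * iexp (u \<bullet> w)) = Im (complex_of_real (exp (- (C w \<bullet> w) / 2)) * (CLINT u|M. g (u \<bullet> k)))"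
      using g(2) by (simp add: q_def exp_of_real Re_exp Im_exp)
  qed
qed

section \<open>Gibbs densities and rank-one updates\<close>

definition gibbs :: "'a measure \<Rightarrow> ('a \<Rightarrow> real) \<Rightarrow> 'a measure" where
  "gibbs M F = density M (\<lambda>u. ennreal (exp (- F u) / (\<integral>v. exp (- F v) \<partial>M)))"

lemma has_gibbs_density_iff:
  "has_gibbs_density M F N \<longleftrightarrow> integrable M (\<lambda>u. exp (- F u)) \<and> N = gibbs M F"
  by (simp add: has_gibbs_density_def gibbs_def)

lemma sets_gibbs [simp, measurable_cong]: "sets (gibbs M F) = sets M"
  by (simp add: gibbs_def)

lemma (in prob_space) integral_exp_pos:
  assumes "integrable M (\<lambda>u. exp (F u :: real))"
  shows "0 < (\<integral>u. exp (F u) \<partial>M)"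
proof -
  have "(\<integral>u. exp (F u) \<partial>M) \<noteq> 0"
  proof
    assume "(\<integral>u. exp (F u) \<partial>M) = 0"
    then have "AE u in M. exp (F u) = 0" using integral_nonneg_eq_0_iff_AE[OF assms] by simp
    then show False by simp
  qed
  then show ?thesis by (simp add: less_le)
qed

lemma integral_gibbs:
  fixes f :: "'a \<Rightarrow> 'b::{banach, second_countable_topology}" and F :: "'a \<Rightarrow> real"
  assumes M: "prob_space M" and F: "integrable M (\<lambda>u. exp (- F u))" and f[measurable]: "f \<in> borel_measurable M"
  shows "(\<integral>u. f u \<partial>gibbs M F) = (\<integral>u. exp (- F u) *\<^sub>R f u \<partial>M) /\<^sub>R (\<integral>u. exp (- F u) \<partial>M)"
    and "integrable (gibbs M F) f \<longleftrightarrow> integrable M (\<lambda>u. exp (- F u) *\<^sub>R f u)"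
proof -
  interpret prob_space M by fact
  define Z where "Z = (\<integral>u. exp (- F u) \<partial>M)"
  have Z: "Z > 0" unfolding Z_def by (rule integral_exp_pos[OF F])
  have [measurable]: "(\<lambda>u. exp (- F u)) \<in> borel_measurable M" using F by auto
  have eq: "(exp (- F u) / Z) *\<^sub>R f u = (1 / Z) *\<^sub>R (exp (- F u) *\<^sub>R f u)" for u by simp
  have "(\<integral>u. f u \<partial>gibbs M F) = (\<integral>u. (exp (- F u) / Z) *\<^sub>R f u \<partial>M)"
    unfolding gibbs_def Z_def[symmetric] using Z by (intro integral_density) auto
  then show "(\<integral>u. f u \<partial>gibbs M F) = (\<integral>u. exp (- F u) *\<^sub>R f u \<partial>M) /\<^sub>R (\<integral>u. exp (- F u) \<partial>M)"
    unfolding eq Z_def[symmetric] by (simp add: inverse_eq_divide del: scaleR_scaleR)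
  have "integrable (gibbs M F) f \<longleftrightarrow> integrable M (\<lambda>u. (exp (- F u) / Z) *\<^sub>R f u)"
    unfolding gibbs_def Z_def[symmetric] using Z by (intro integrable_density) auto
  then show "integrable (gibbs M F) f \<longleftrightarrow> integrable M (\<lambda>u. exp (- F u) *\<^sub>R f u)"
    unfolding eq using Z integrable_scaleR_right[of "1 / Z" M "\<lambda>u. exp (- F u) *\<^sub>R f u"]
      integrable_scaleR_right[of Z M "\<lambda>u. (1 / Z) *\<^sub>R (exp (- F u) *\<^sub>R f u)"] by auto
qed

lemma prob_space_gibbs:
  fixes F :: "'a \<Rightarrow> real"
  assumes M: "prob_space M" and F: "integrable M (\<lambda>u. exp (- F u))"
  shows "prob_space (gibbs M F)"
proof -
  interpret prob_space M by fact
  have Z: "(\<integral>u. exp (- F u) \<partial>M) > 0" by (rule integral_exp_pos[OF F])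
  have [measurable]: "(\<lambda>u. exp (- F u)) \<in> borel_measurable M" using F by auto
  have "emeasure (gibbs M F) (space (gibbs M F)) = 1"
    using Z F unfolding gibbs_def
    by (simp add: emeasure_density nn_integral_eq_integral cong: nn_integral_cong)
  then show ?thesis by (rule prob_spaceI)
qed

text \<open>The normalizing constants telescope, so an exponent may be applied one summand at a
  time.\<close>

lemma gibbs_gibbs:
  fixes F G :: "'a \<Rightarrow> real"
  assumes M: "prob_space M" and F: "integrable M (\<lambda>u. exp (- F u))"
    and G: "integrable (gibbs M F) (\<lambda>u. exp (- G u))" and [measurable]: "G \<in> borel_measurable M"
  shows "integrable M (\<lambda>u. exp (- (F u + G u)))" and "gibbs (gibbs M F) G = gibbs M (\<lambda>u. F u + G u)"
proof -
  interpret prob_space M by fact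
  have [measurable]: "(\<lambda>u. exp (- F u)) \<in> borel_measurable M" using F by auto
  have e: "exp (- F u) * exp (- G u) = exp (- (F u + G u))" for u by (simp add: mult_exp_exp)
  show i: "integrable M (\<lambda>u. exp (- (F u + G u)))"
    using G integral_gibbs(2)[OF M F, of "\<lambda>u. exp (- G u)"] by (simp add: e)
  define Z where "Z = (\<integral>u. exp (- F u) \<partial>M)"
  define Z' where "Z' = (\<integral>u. exp (- (F u + G u)) \<partial>M)"
  have Z: "Z > 0" unfolding Z_def by (rule integral_exp_pos[OF F])
  have Z': "Z' > 0" unfolding Z'_def by (rule integral_exp_pos[OF i])
  have ZZ: "(\<integral>u. exp (- G u) \<partial>gibbs M F) = Z' / Z"
    using integral_gibbs(1)[OF M F, of "\<lambda>u. exp (- G u)"] by (simp add: Z_def Z'_def e field_simps)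
  have "gibbs (gibbs M F) G = density (density M (\<lambda>u. ennreal (exp (- F u) / Z))) (\<lambda>u. ennreal (exp (- G u) / (Z' / Z)))"
    by (subst (1) gibbs_def) (simp only: ZZ, simp add: gibbs_def Z_def)
  also have "\<dots> = density M (\<lambda>u. ennreal (exp (- F u) / Z) * ennreal (exp (- G u) / (Z' / Z)))"
    by (rule density_density_eq) measurable
  also have "\<dots> = density M (\<lambda>u. ennreal (exp (- (F u + G u)) / Z'))"
  proof (rule density_cong)
    note [measurable] = borel_measurable_integrable[OF i]
    show "(\<lambda>u. ennreal (exp (- (F u + G u)) / Z')) \<in> borel_measurable M" by measurable
    show "AE u in M. ennreal (exp (- F u) / Z) * ennreal (exp (- G u) / (Z' / Z)) = ennreal (exp (- (F u + G u)) / Z')"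
      unfolding e[symmetric] using Z Z' by (intro AE_I2) (simp add: ennreal_mult[symmetric])
  qed measurable
  finally show "gibbs (gibbs M F) G = gibbs M (\<lambda>u. F u + G u)" unfolding gibbs_def Z'_def .
qed

lemma gibbs_add_const:
  fixes F :: "'a \<Rightarrow> real"
  assumes M: "prob_space M" and F: "integrable M (\<lambda>u. exp (- F u))"
  shows "integrable M (\<lambda>u. exp (- (F u + c)))" "gibbs M (\<lambda>u. F u + c) = gibbs M F"
proof -
  have e: "exp (- (F u + c)) = exp (- c) * exp (- F u)" for u by (simp add: mult_exp_exp)
  show "integrable M (\<lambda>u. exp (- (F u + c)))" unfolding e using F by simp
  show "gibbs M (\<lambda>u. F u + c) = gibbs M F" unfolding gibbs_def e by simp
qed

text \<open>The criterion uses unnormalized integrals because those are the quantities whose limits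
  dominated convergence controls in \<open>quadratic_update\<close>.\<close>

lemma gibbs_gaussianI:
  fixes F :: "'a::{real_inner, complete_space} \<Rightarrow> real"
    and S :: "'a \<Rightarrow>\<^sub>L 'a"
  assumes M: "prob_space M" "sets M = sets borel" and F: "integrable M (\<lambda>u. exp (- F u))"
    and S: "covariance_operator S"
    and ch: "\<And>h. (CLINT u|M. complex_of_real (exp (- F u)) * iexp (u \<bullet> h))
      = complex_of_real (\<integral>u. exp (- F u) \<partial>M) * (iexp (m \<bullet> h) * exp (- (S h \<bullet> h) / 2))"
  shows "is_gaussian (gibbs M F) m S"
proof (rule is_gaussianI_char)
  interpret prob_space M by fact
  note [measurable_cong] = M(2)
  show "prob_space (gibbs M F)" by (rule prob_space_gibbs[OF M(1) F])
  show "sets (gibbs M F) = sets borel" using M by simp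
  have Z: "(\<integral>u. exp (- F u) \<partial>M) > 0" by (rule integral_exp_pos[OF F])
  fix h
  have "(\<lambda>u. iexp (u \<bullet> h)) \<in> borel_measurable M" by measurable
  from integral_gibbs(1)[OF M(1) F this]
  show "(CLINT u|gibbs M F. iexp (u \<bullet> h)) = iexp (m \<bullet> h) * exp (- (S h \<bullet> h) / 2)"
    using Z ch[of h] by (simp add: scaleR_conv_of_real)
qed (rule S)

lemma gibbs_gaussianD:
  fixes F :: "'a::{real_inner, complete_space} \<Rightarrow> real"
    and S :: "'a \<Rightarrow>\<^sub>L 'a"
  assumes M: "prob_space M" "sets M = sets borel" and F: "integrable M (\<lambda>u. exp (- F u))"
    and g: "is_gaussian (gibbs M F) m S"
  shows "(CLINT u|M. complex_of_real (exp (- F u)) * iexp (u \<bullet> h))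
      = complex_of_real (\<integral>u. exp (- F u) \<partial>M) * (iexp (m \<bullet> h) * exp (- (S h \<bullet> h) / 2))"
proof -
  interpret prob_space M by fact
  note [measurable_cong] = M(2)
  have Z: "(\<integral>u. exp (- F u) \<partial>M) > 0" by (rule integral_exp_pos[OF F])
  have "(\<lambda>u. iexp (u \<bullet> h)) \<in> borel_measurable M" by measurable
  from integral_gibbs(1)[OF M(1) F this] char_gaussian[OF g, of h]
  show ?thesis using Z by (simp add: scaleR_conv_of_real field_simps)
qed

lemma covariance_operator_le:
  fixes C S :: "'a::{real_inner, complete_space} \<Rightarrow>\<^sub>L 'a"
  assumes S: "positive_operator S" and le: "\<And>x. S x \<bullet> x \<le> \<kappa> * (C x \<bullet> x)" and C: "covariance_operator C"
  shows "covariance_operator S"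
  unfolding covariance_operator_def
proof (intro conjI allI impI S)
  fix B :: "'a set" assume "orthonormal B"
  then have "(\<lambda>e. \<kappa> * (C e \<bullet> e)) summable_on B"
    using C by (intro summable_on_cmult_right) (simp add: covariance_operator_def)
  then show "(\<lambda>e. S e \<bullet> e) summable_on B"
    by (rule summable_on_comparison_test) (use S le in \<open>auto intro: positive_operator_nonneg\<close>)
qed

text \<open>The Sherman-Morrison formula for the inverse of \<open>C^-1 + a k k^T\<close>, written
  without inverting \<open>C\<close>.\<close>

definition rank_one_update :: "('a::{real_inner, complete_space} \<Rightarrow>\<^sub>L 'a) \<Rightarrow> real \<Rightarrow> 'a \<Rightarrow> ('a \<Rightarrow>\<^sub>L 'a)" where
  "rank_one_update C a k =
     C - (a / (1 + a * (C k \<bullet> k))) *\<^sub>R (blinfun_scaleR_left (C k) o\<^sub>L blinfun_inner_left (C k))"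

lemma rank_one_update_apply:
  fixes C :: "'a::{real_inner, complete_space} \<Rightarrow>\<^sub>L 'a"
  shows "rank_one_update C a k h = C h - (a * (h \<bullet> C k) / (1 + a * (C k \<bullet> k))) *\<^sub>R C k"
  by (simp add: rank_one_update_def blinfun.diff_left blinfun.scaleR_left blinfun_inner_left.rep_eq)

text \<open>For \<open>a >= 0\<close> positivity is Cauchy-Schwarz for the form of \<open>C\<close>;
  for \<open>a < 0\<close> the correction is itself nonnegative, and Cauchy-Schwarz is what
  dominates it by a multiple of \<open>C\<close>, preserving trace class.\<close>

lemma covariance_operator_rank_one_update:
  fixes C :: "'a::{real_inner, complete_space} \<Rightarrow>\<^sub>L 'a"
  assumes C: "covariance_operator C" and pos: "0 < 1 + a * (C k \<bullet> k)"
  shows "covariance_operator (rank_one_update C a k)"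
proof -
  have P: "positive_operator C" using C by (simp add: covariance_operator_def)
  define s where "s = C k \<bullet> k"
  have s: "0 \<le> s" "0 < 1 + a * s" using pos positive_operator_nonneg[OF P, of k] by (simp_all add: s_def)
  have form: "rank_one_update C a k h \<bullet> h = C h \<bullet> h - a * (C k \<bullet> h)\<^sup>2 / (1 + a * s)" for h
    by (simp add: rank_one_update_apply inner_diff_left s_def power2_eq_square inner_commute[of h])
  have CS: "(C k \<bullet> h)\<^sup>2 \<le> s * (C h \<bullet> h)" for h
    using positive_operator_Cauchy_Schwarz[OF P, of k h] by (simp add: s_def)
  have h0: "0 \<le> C h \<bullet> h" for h by (rule positive_operator_nonneg[OF P])
  have aCS: "\<bar>a\<bar> * (C k \<bullet> h)\<^sup>2 \<le> \<bar>a\<bar> * s * (C h \<bullet> h)" for h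
    using mult_left_mono[OF CS abs_ge_zero, of a h] by (simp add: mult.assoc)
  show ?thesis
  proof (rule covariance_operator_le[OF _ _ C, where \<kappa>="1 + \<bar>a\<bar> * s / (1 + a * s)"])
    show "positive_operator (rank_one_update C a k)"
      unfolding positive_operator_def
    proof (intro conjI allI)
      show "rank_one_update C a k x \<bullet> y = x \<bullet> rank_one_update C a k y" for x y
        using positive_operator_sym[OF P, of x y]
        by (simp add: rank_one_update_apply inner_diff_left inner_diff_right inner_commute)
      fix h
      have "a * (C k \<bullet> h)\<^sup>2 \<le> (1 + a * s) * (C h \<bullet> h)"
      proof (cases "a \<ge> 0")
        case True
        then show ?thesis using aCS[of h] h0[of h] by (simp add: distrib_right)
      next
        case False
        then have "a * (C k \<bullet> h)\<^sup>2 \<le> 0" by (simp add: mult_nonpos_nonneg)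
        then show ?thesis using h0[of h] s by (smt (verit) mult_nonneg_nonneg)
      qed
      then show "0 \<le> rank_one_update C a k h \<bullet> h" unfolding form using s by (simp add: field_simps)
    qed
    fix h
    have "- a * (C k \<bullet> h)\<^sup>2 \<le> \<bar>a\<bar> * (C k \<bullet> h)\<^sup>2" by (intro mult_right_mono) auto
    also note aCS
    finally have "- a * (C k \<bullet> h)\<^sup>2 / (1 + a * s) \<le> \<bar>a\<bar> * s * (C h \<bullet> h) / (1 + a * s)"
      using s by (intro divide_right_mono) auto
    then show "rank_one_update C a k h \<bullet> h \<le> (1 + \<bar>a\<bar> * s / (1 + a * s)) * (C h \<bullet> h)"
      unfolding form by (simp add: distrib_right)
  qed
qed

text \<open>
  Write \<open>h = c k + w\<close> with \<open>w\<close> uncorrelated to \<open>k\<close>: only the one-dimensional law in direction \<open>k\<close>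
  is reweighted.
\<close>

lemma gaussian_exp_quadratic:
  fixes C :: "'a::{real_inner, complete_space} \<Rightarrow>\<^sub>L 'a" and a b :: real
  assumes M: "is_gaussian M 0 C" and pos: "0 < 1 + a * (C k \<bullet> k)"
  defines "F \<equiv> \<lambda>u. a / 2 * (u \<bullet> k)\<^sup>2 - b * (u \<bullet> k)"
  shows "integrable M (\<lambda>u. exp (- F u))"
    and "(\<integral>u. exp (- F u) \<partial>M) = exp (b\<^sup>2 * ((C k \<bullet> k) / (1 + a * (C k \<bullet> k))) / 2) / sqrt (1 + a * (C k \<bullet> k))"
    and "is_gaussian (gibbs M F) ((b / (1 + a * (C k \<bullet> k))) *\<^sub>R C k) (rank_one_update C a k)"
proof -
  interpret prob_space M by (rule is_gaussianD(1)[OF M])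
  note [measurable_cong] = is_gaussianD(2)[OF M]
  have P: "positive_operator C" by (rule is_gaussianD(4)[OF M])
  define s where "s = C k \<bullet> k"
  define \<tau> where "\<tau> = s / (1 + a * s)"
  define K where "K = exp (b\<^sup>2 * \<tau> / 2) / sqrt (1 + a * s)"
  have s: "0 \<le> s" "0 < 1 + a * s" using pos positive_operator_nonneg[OF P, of k] by (simp_all add: s_def)
  define f where "f x = exp (b * x - a / 2 * x\<^sup>2)" for x
  have [measurable]: "f \<in> borel_measurable borel" unfolding f_def by measurable
  have eF: "exp (- F u) = f (u \<bullet> k)" for u by (simp add: F_def f_def)
  have law: "distr M borel (\<lambda>u. u \<bullet> k) = normal_law 0 s"
    using is_gaussianD(5)[OF M, of k] by (simp add: s_def)
  note tilt = integral_normal_law_tilt[OF s, of b, folded f_def \<tau>_def, folded K_def]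
  have fi: "integrable M (\<lambda>u. f (u \<bullet> k))"
    using tilt(1) unfolding law[symmetric] by (subst (asm) integrable_distr_eq) auto
  then show i: "integrable M (\<lambda>u. exp (- F u))" by (simp add: eF)
  have fK: "(\<integral>u. f (u \<bullet> k) \<partial>M) = K"
    using tilt(2) unfolding law[symmetric] by (subst (asm) integral_distr) auto
  then show "(\<integral>u. exp (- F u) \<partial>M) = exp (b\<^sup>2 * ((C k \<bullet> k) / (1 + a * (C k \<bullet> k))) / 2) / sqrt (1 + a * (C k \<bullet> k))"
    by (simp add: eF K_def \<tau>_def s_def)
  show "is_gaussian (gibbs M F) ((b / (1 + a * (C k \<bullet> k))) *\<^sub>R C k) (rank_one_update C a k)"
  proof (rule gibbs_gaussianI[OF is_gaussianD(1,2)[OF M] i])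
    show "covariance_operator (rank_one_update C a k)"
      by (rule covariance_operator_rank_one_update[OF is_gaussianD(3)[OF M] pos])
    fix h
    \<comment> \<open>The regression coefficient of \<open>u . h\<close> on \<open>u . k\<close>,
      chosen to make \<open>w\<close> uncorrelated with \<open>k\<close>. If \<open>s = 0\<close>,
      division by zero gives 0, which is right because then \<open>C k = 0\<close>.\<close>
    define c where "c = (C k \<bullet> h) / s"
    have cs: "c * s = C k \<bullet> h"
    proof (cases "s = 0")
      case True
      then have "C k = 0" using positive_operator_norm_sq_le[OF P, of k] by (simp add: s_def)
      then show ?thesis using True by simp
    qed (simp add: c_def)
    define w where "w = h - c *\<^sub>R k"
    have Ckw: "C k \<bullet> w = 0" by (simp add: w_def inner_diff_right s_def[symmetric] cs)
    have Chk: "C h \<bullet> k = C k \<bullet> h" using positive_operator_sym[OF P, of h k] by (simp add: inner_commute)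
    have Cww: "C w \<bullet> w = C h \<bullet> h - c\<^sup>2 * s"
      using cs by (simp add: w_def inner_diff_left inner_diff_right blinfun.diff_right blinfun.scaleR_right
          Chk s_def[symmetric] power2_eq_square algebra_simps)
    define g where "g x = complex_of_real (f x) * iexp (c * x)" for x
    have g: "g \<in> borel_measurable borel" unfolding g_def by measurable
    have gi: "integrable M (\<lambda>u. g (u \<bullet> k))"
      by (rule Bochner_Integration.integrable_bound[OF fi]) (auto simp: g_def norm_mult)
    have "(CLINT u|M. complex_of_real (exp (- F u)) * iexp (u \<bullet> h)) = (CLINT u|M. g (u \<bullet> k) * iexp (u \<bullet> w))"
      by (simp add: eF g_def w_def inner_diff_right algebra_simps flip: exp_add)
    also have "\<dots> = complex_of_real (exp (- (C w \<bullet> w) / 2)) * (CLINT u|M. g (u \<bullet> k))"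
      by (rule integral_gaussian_uncorrelated[OF M Ckw g gi])
    also have "(CLINT u|M. g (u \<bullet> k)) = (CLINT x|normal_law 0 s. f x * iexp (c * x))"
      unfolding law[symmetric] g_def by (subst integral_distr) auto
    also have "\<dots> = complex_of_real K * (iexp (c * (b * \<tau>)) * exp (- (\<tau> * c\<^sup>2) / 2))" by (rule tilt(3))
    also have "complex_of_real (exp (- (C w \<bullet> w) / 2)) * \<dots>
        = complex_of_real K * (iexp (c * (b * \<tau>)) * exp (- (C w \<bullet> w + \<tau> * c\<^sup>2) / 2))"
    proof -
      have "- (C w \<bullet> w + \<tau> * c\<^sup>2) / 2 = - (C w \<bullet> w) / 2 + - (\<tau> * c\<^sup>2) / 2" by (simp add: field_simps)
      then have "exp (- (C w \<bullet> w + \<tau> * c\<^sup>2) / 2) = exp (- (C w \<bullet> w) / 2) * exp (- (\<tau> * c\<^sup>2) / 2)"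
        by (simp only: exp_add)
      then show ?thesis by (simp only: of_real_mult mult_ac)
    qed
    also have "c * (b * \<tau>) = ((b / (1 + a * s)) *\<^sub>R C k) \<bullet> h"
      using cs by (simp add: \<tau>_def)
    also have "C w \<bullet> w + \<tau> * c\<^sup>2 = rank_one_update C a k h \<bullet> h"
    proof -
      have "\<tau> * c\<^sup>2 - c\<^sup>2 * s = - (a * (C k \<bullet> h)\<^sup>2 / (1 + a * s))"
        unfolding cs[symmetric] using s
        by (simp add: \<tau>_def power2_eq_square divide_simps) (simp add: algebra_simps)
      then show ?thesis
        by (simp add: Cww rank_one_update_apply inner_diff_left s_def power2_eq_square inner_commute[of h])
    qed
    finally show "(CLINT u|M. complex_of_real (exp (- F u)) * iexp (u \<bullet> h))
      = complex_of_real (\<integral>u. exp (- F u) \<partial>M) * (iexp (((b / (1 + a * (C k \<bullet> k))) *\<^sub>R C k) \<bullet> h) * exp (- (rank_one_update C a k h \<bullet> h) / 2))"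
      by (simp add: eF fK s_def)
  qed
qed

section \<open>Quadratic updates in Cameron-Martin coordinates\<close>

locale covariance_root =
  fixes L :: "'a::{real_inner, complete_space} \<Rightarrow>\<^sub>L 'a"
  assumes L_sym: "L x \<bullet> y = x \<bullet> L y"
    and covariance_L: "covariance_operator (L o\<^sub>L L)"
begin

text \<open>
  The covariance \<open>S\<close> is the inverse of the form \<open>(L x, L z) \<mapsto> q x z\<close> on the range of \<open>L\<close>.
\<close>

definition inverts :: "('a \<Rightarrow>\<^sub>L 'a) \<Rightarrow> ('a \<Rightarrow> 'a \<Rightarrow> real) \<Rightarrow> bool" where
  "inverts S q \<longleftrightarrow> (\<forall>h. \<exists>b. S h = L b \<and> (\<forall>z. q b z = h \<bullet> L z))"

text \<open>Testing the defining equation with its solution \<open>b\<close> gives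
  \<open>d |b| <= |L h|\<close>. Besides the trace bound, this limits each variance in
  \<open>integrable_exp_norm_sq\<close>.\<close>

lemma inverts_le:
  assumes S: "inverts S q" and d: "0 < d" and coercive: "\<And>x. d * (norm x)\<^sup>2 \<le> q x x"
  shows "S h \<bullet> h \<le> (norm (L h))\<^sup>2 / d"
proof -
  obtain b where b: "S h = L b" "\<And>z. q b z = h \<bullet> L z" using S by (auto simp: inverts_def)
  have "d * (norm b)\<^sup>2 \<le> L h \<bullet> b" using coercive[of b] b(2)[of b] by (simp add: L_sym)
  also have "\<dots> \<le> norm (L h) * norm b" by (rule norm_cauchy_schwarz)
  finally have "d * norm b \<le> norm (L h)"
    using d by (cases "b = 0") (auto simp: power2_eq_square mult.assoc[symmetric])
  then have nb: "norm b \<le> norm (L h) / d" using d by (simp add: field_simps)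
  have "S h \<bullet> h = b \<bullet> L h" by (simp add: b(1) L_sym)
  also have "\<dots> \<le> norm b * norm (L h)" by (rule norm_cauchy_schwarz)
  also have "\<dots> \<le> norm (L h) / d * norm (L h)" by (intro mult_right_mono nb) simp
  finally show ?thesis by (simp add: power2_eq_square)
qed

lemma inverts_covariance:
  assumes S: "inverts S q" and d: "0 < d" and coercive: "\<And>x. d * (norm x)\<^sup>2 \<le> q x x"
    and sym: "\<And>x y. q x y = q y x"
  shows "covariance_operator S"
proof (rule covariance_operator_le[OF _ _ covariance_L, where \<kappa>="1 / d"])
  show "positive_operator S"
    unfolding positive_operator_def
  proof (intro conjI allI)
    fix x y
    obtain b c where b: "S x = L b" "\<And>z. q b z = x \<bullet> L z" and c: "S y = L c" "\<And>z. q c z = y \<bullet> L z"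
      using S by (auto simp: inverts_def) metis
    have "S x \<bullet> y = q c b" by (simp add: b(1) c(2) inner_commute)
    also have "\<dots> = x \<bullet> S y" by (simp add: sym[of c] b(2) c(1))
    finally show "S x \<bullet> y = x \<bullet> S y" .
    have "S x \<bullet> x = q b b" by (simp add: b inner_commute)
    moreover have "0 \<le> d * (norm b)\<^sup>2" using d by simp
    ultimately show "0 \<le> S x \<bullet> x" using coercive[of b] by linarith
  qed
  show "S x \<bullet> x \<le> 1 / d * ((L o\<^sub>L L) x \<bullet> x)" for x
    using inverts_le[OF S d coercive, of x] by (simp add: L_sym power2_norm_eq_inner)
qed

lemma ex_inverts:
  assumes q: "bounded_bilinear q" and d: "0 < d" and coercive: "\<And>x. d * (norm x)\<^sup>2 \<le> q x x"
    and sym: "\<And>x y. q x y = q y x"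
  obtains S where "inverts S q"
proof -
  obtain B :: "'a \<Rightarrow>\<^sub>L 'a" where B: "\<And>h z. q (B h) z = h \<bullet> z"
    using inverse_operator_of_coercive_form[OF q sym d coercive] by blast
  have "inverts (L o\<^sub>L B o\<^sub>L L) q"
    unfolding inverts_def
  proof
    fix h
    show "\<exists>b. (L o\<^sub>L B o\<^sub>L L) h = L b \<and> (\<forall>z. q b z = h \<bullet> L z)"
      by (intro exI[of _ "B (L h)"]) (simp add: B L_sym)
  qed
  then show thesis by (rule that)
qed

text \<open>The denominator of the update is controlled by the new form: with
  \<open>S k = L bk\<close> one has \<open>q' bk bk = s (1 + a s)\<close>, so positivity of
  \<open>q'\<close> at this single vector gives \<open>1 + a s > 0\<close>.\<close>

lemma rank_one_update_inverts:
  assumes M: "is_gaussian M 0 S" and S: "inverts S q" and q: "bilinear q"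
    and q': "\<And>x z. q' x z = q x z + a * (L x \<bullet> k) * (L z \<bullet> k)"
    and q'_pos: "\<And>x. x \<noteq> 0 \<Longrightarrow> 0 < q' x x"
  shows "0 < 1 + a * (S k \<bullet> k)" and "inverts (rank_one_update S a k) q'"
proof -
  have P: "positive_operator S" by (rule is_gaussianD(4)[OF M])
  obtain bk where bk: "S k = L bk" "\<And>z. q bk z = k \<bullet> L z" using S by (auto simp: inverts_def)
  define s where "s = S k \<bullet> k"
  have s0: "0 \<le> s" using positive_operator_nonneg[OF P] by (simp add: s_def)
  have sL: "L bk \<bullet> k = s" "k \<bullet> L bk = s" by (simp_all add: s_def bk(1) inner_commute)
  show pos: "0 < 1 + a * (S k \<bullet> k)"
  proof (cases "bk = 0")
    case True
    then show ?thesis by (simp add: bk(1))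
  next
    case False
    from q'_pos[OF this] have "0 < s * (1 + a * s)" by (simp add: q' bk(2) sL algebra_simps)
    then show ?thesis using s0 by (simp add: zero_less_mult_iff s_def)
  qed
  show "inverts (rank_one_update S a k) q'"
    unfolding inverts_def
  proof
    fix h
    obtain b where b: "S h = L b" "\<And>z. q b z = h \<bullet> L z" using S by (auto simp: inverts_def)
    \<comment> \<open>The solution of \<open>a (h . S k - c s) = c\<close>, which is what cancels
      the rank-one term in \<open>q'\<close>.\<close>
    define c where "c = a * (h \<bullet> S k) / (1 + a * s)"
    have Lb: "L b \<bullet> k = h \<bullet> S k" using positive_operator_sym[OF P, of h k] by (simp add: b(1))
    have c: "a * (h \<bullet> S k - c * s) = c"
      using pos unfolding s_def[symmetric] by (simp add: c_def field_simps)
    have "rank_one_update S a k h = L (b - c *\<^sub>R bk)"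
      by (simp add: rank_one_update_apply b(1) bk(1)[symmetric] c_def s_def blinfun.diff_right blinfun.scaleR_right)
    moreover have "q' (b - c *\<^sub>R bk) z = h \<bullet> L z" for z
    proof -
      have "q' (b - c *\<^sub>R bk) z = h \<bullet> L z - c * (k \<bullet> L z) + a * (h \<bullet> S k - c * s) * (L z \<bullet> k)"
        by (simp add: q' bilinear_lsub[OF q] bilinear_lmul[OF q] b(2) bk(2) blinfun.diff_right
            blinfun.scaleR_right inner_diff_left Lb sL)
      then show ?thesis unfolding c by (simp add: inner_commute)
    qed
    ultimately show "\<exists>b. rank_one_update S a k h = L b \<and> (\<forall>z. q' b z = h \<bullet> L z)" by blast
  qed
qed

primrec updates :: "('a \<Rightarrow>\<^sub>L 'a) \<Rightarrow> real \<Rightarrow> (nat \<Rightarrow> 'a) \<Rightarrow> nat \<Rightarrow> ('a \<Rightarrow>\<^sub>L 'a)" where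
  "updates S a k 0 = S"
| "updates S a k (Suc n) = rank_one_update (updates S a k n) a (k n)"

text \<open>Positivity is demanded at every stage, not only in the limit: for negative
  \<open>a\<close> it licenses each next update. The last conclusion writes the normalizing integral
  as a running product, from which uniform bounds are read off.\<close>

lemma updates_inverts:
  fixes a :: real and k :: "nat \<Rightarrow> 'a"
  assumes M: "is_gaussian M 0 S" and S: "inverts S q" and q: "bilinear q"
    and pos: "\<And>n x. x \<noteq> 0 \<Longrightarrow> 0 < q x x + a * (\<Sum>i<n. (L x \<bullet> k i)\<^sup>2)"
  defines "F \<equiv> \<lambda>n u. a / 2 * (\<Sum>i<n. (u \<bullet> k i)\<^sup>2)"
    and "Q \<equiv> \<lambda>n x z. q x z + a * (\<Sum>i<n. (L x \<bullet> k i) * (L z \<bullet> k i))"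
  shows "integrable M (\<lambda>u. exp (- F n u))"
    and "is_gaussian (gibbs M (F n)) 0 (updates S a k n)"
    and "inverts (updates S a k n) (Q n)"
    and "0 < 1 + a * (updates S a k n (k n) \<bullet> k n)"
    and "(\<integral>u. exp (- F (Suc n) u) \<partial>M) = (\<integral>u. exp (- F n u) \<partial>M) / sqrt (1 + a * (updates S a k n (k n) \<bullet> k n))"
proof -
  interpret prob_space M by (rule is_gaussianD(1)[OF M])
  note [measurable_cong] = is_gaussianD(2)[OF M]
  have [measurable]: "F n \<in> borel_measurable M" for n unfolding F_def by measurable
  have Qb: "bilinear (Q n)" for n
    unfolding bilinear_def Q_def
    by (auto intro!: linearI simp: bilinear_ladd[OF q] bilinear_radd[OF q] bilinear_lmul[OF q] bilinear_rmul[OF q]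
        blinfun.add_right blinfun.scaleR_right inner_add_left sum.distrib sum_distrib_left algebra_simps)
  have Q': "Q (Suc n) x z = Q n x z + a * (L x \<bullet> k n) * (L z \<bullet> k n)" for n x z
    by (simp add: Q_def algebra_simps)
  have Qpos: "0 < Q n x x" if "x \<noteq> 0" for n x using pos[OF that, of n] by (simp add: Q_def power2_eq_square)
  \<comment> \<open>The vanishing linear term gives the increment the shape of
    \<open>gaussian_exp_quadratic\<close> with \<open>b = 0\<close>.\<close>
  have F': "F (Suc n) u = F n u + (a / 2 * (u \<bullet> k n)\<^sup>2 - 0 * (u \<bullet> k n))" for n u
    by (simp add: F_def algebra_simps)
  have step: "0 < 1 + a * (updates S a k n (k n) \<bullet> k n) \<and> inverts (updates S a k (Suc n)) (Q (Suc n)) \<and>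
      integrable M (\<lambda>u. exp (- F (Suc n) u)) \<and> is_gaussian (gibbs M (F (Suc n))) 0 (updates S a k (Suc n)) \<and>
      (\<integral>u. exp (- F (Suc n) u) \<partial>M) = (\<integral>u. exp (- F n u) \<partial>M) / sqrt (1 + a * (updates S a k n (k n) \<bullet> k n))"
    if I: "integrable M (\<lambda>u. exp (- F n u))" and G: "is_gaussian (gibbs M (F n)) 0 (updates S a k n)"
      and V: "inverts (updates S a k n) (Q n)" for n
  proof -
    note r = rank_one_update_inverts[OF G V Qb Q' Qpos]
    note g = gaussian_exp_quadratic[OF G r(1), of 0]
    let ?G = "\<lambda>u. a / 2 * (u \<bullet> k n)\<^sup>2 - 0 * (u \<bullet> k n)"
    have m: "?G \<in> borel_measurable M" by measurable
    note gg = gibbs_gibbs[OF prob_space_axioms I g(1) m]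
    have Zn: "(\<integral>u. exp (- ?G u) \<partial>gibbs M (F n)) = (\<integral>u. exp (- F (Suc n) u) \<partial>M) / (\<integral>u. exp (- F n u) \<partial>M)"
    proof -
      have "exp (- F n u) *\<^sub>R exp (- ?G u) = exp (- F (Suc n) u)" for u
        unfolding real_scaleR_def by (simp only: F' mult_exp_exp minus_add_distrib)
      moreover have "(\<lambda>u. exp (- ?G u)) \<in> borel_measurable M" by measurable
      ultimately show ?thesis
        by (simp only: integral_gibbs(1)[OF prob_space_axioms I]) (simp add: inverse_eq_divide)
    qed
    have "(\<integral>u. exp (- F (Suc n) u) \<partial>M) / (\<integral>u. exp (- F n u) \<partial>M) = 1 / sqrt (1 + a * (updates S a k n (k n) \<bullet> k n))"
      using trans[OF Zn[symmetric] g(2)] by simp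
    moreover have "0 < (\<integral>u. exp (- F n u) \<partial>M)" by (rule integral_exp_pos[OF I])
    ultimately have "(\<integral>u. exp (- F (Suc n) u) \<partial>M) = (\<integral>u. exp (- F n u) \<partial>M) / sqrt (1 + a * (updates S a k n (k n) \<bullet> k n))"
      by (simp add: field_simps)
    moreover have "is_gaussian (gibbs M (F (Suc n))) 0 (updates S a k (Suc n))"
    proof -
      have "F (Suc n) = (\<lambda>u. F n u + ?G u)" by (rule ext) (rule F')
      then have "gibbs M (F (Suc n)) = gibbs (gibbs M (F n)) ?G" using gg(2) by simp
      then show ?thesis using g(3) by simp
    qed
    moreover have "integrable M (\<lambda>u. exp (- F (Suc n) u))" using gg(1) unfolding F' .
    ultimately show ?thesis using r by simp
  qed
  have "gibbs M (F 0) = M" by (simp add: gibbs_def F_def prob_space density_1)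
  then have base: "integrable M (\<lambda>u. exp (- F 0 u))" "is_gaussian (gibbs M (F 0)) 0 (updates S a k 0)"
    "inverts (updates S a k 0) (Q 0)"
    using M S by (simp_all add: F_def Q_def)
  have all: "integrable M (\<lambda>u. exp (- F n u)) \<and> is_gaussian (gibbs M (F n)) 0 (updates S a k n) \<and> inverts (updates S a k n) (Q n)" for n
  proof (induction n)
    case 0
    then show ?case using base by blast
  next
    case (Suc n)
    then show ?case using step[of n] by blast
  qed
  then show "integrable M (\<lambda>u. exp (- F n u))" "is_gaussian (gibbs M (F n)) 0 (updates S a k n)"
    "inverts (updates S a k n) (Q n)" by blast+
  show "0 < 1 + a * (updates S a k n (k n) \<bullet> k n)"
    "(\<integral>u. exp (- F (Suc n) u) \<partial>M) = (\<integral>u. exp (- F n u) \<partial>M) / sqrt (1 + a * (updates S a k n (k n) \<bullet> k n))"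
    using step[of n] all[of n] by blast+
qed

text \<open>By Parseval \<open>|R u|^2\<close> is the sum of the \<open>(u . R e_i)^2\<close>, so
  the finite updates approximate the full exponent. The majorant \<open>w\<close> is left open: the
  constant 1 serves for \<open>a = 1\<close>, whereas negative \<open>a\<close> needs
  \<open>integrable_exp_norm_sq\<close>.\<close>

lemma quadratic_update:
  fixes a :: real and R :: "'a \<Rightarrow>\<^sub>L 'a" and e :: "nat \<Rightarrow> 'a"
  assumes M: "is_gaussian M 0 S" and S: "inverts S q" and q: "bounded_bilinear q"
    and e: "basis_seq e" and R: "\<And>x y. R x \<bullet> y = x \<bullet> R y" and d: "0 < d"
    and coercive: "\<And>n x. d * (norm x)\<^sup>2 \<le> q x x + a * (\<Sum>i<n. (L x \<bullet> R (e i))\<^sup>2)"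
    and T: "inverts T (\<lambda>x z. q x z + a * (R (L x) \<bullet> R (L z)))"
    and T_cov: "covariance_operator T"
    and w: "integrable M w" "\<And>n u. exp (- (a / 2 * (\<Sum>i<n. (u \<bullet> R (e i))\<^sup>2))) \<le> w u"
  shows "integrable M (\<lambda>u. exp (- (a / 2 * (norm (R u))\<^sup>2)))"
    and "is_gaussian (gibbs M (\<lambda>u. a / 2 * (norm (R u))\<^sup>2)) 0 T"
proof -
  interpret q: bounded_bilinear q by fact
  interpret prob_space M by (rule is_gaussianD(1)[OF M])
  note [measurable_cong] = is_gaussianD(2)[OF M]
  have qb: "bilinear q"
    unfolding bilinear_def by (auto intro: bounded_linear.linear q.bounded_linear_left q.bounded_linear_right)
  define k where "k i = R (e i)" for i
  define F where "F n u = a / 2 * (\<Sum>i<n. (u \<bullet> k i)\<^sup>2)" for n u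
  have pos: "0 < q x x + a * (\<Sum>i<n. (L x \<bullet> k i)\<^sup>2)" if "x \<noteq> 0" for n x
  proof -
    have "0 < d * (norm x)\<^sup>2" using that d by simp
    then show ?thesis using coercive[of x n] by (simp add: k_def)
  qed
  note U = updates_inverts[OF M S qb pos, folded F_def]
  have Rk: "u \<bullet> k i = R u \<bullet> e i" for u i by (simp add: k_def R)
  have Flim: "(\<lambda>n. F n u) \<longlonglongrightarrow> a / 2 * (norm (R u))\<^sup>2" for u
    using basis_seq_sums_norm[OF e, of "R u"] unfolding F_def Rk sums_def by (intro tendsto_intros)
  have [measurable]: "F n \<in> borel_measurable M" for n unfolding F_def by measurable
  have Rm[measurable]: "(\<lambda>u. a / 2 * (norm (R u))\<^sup>2) \<in> borel_measurable M"
    by (rule borel_measurable_LIMSEQ_real[OF Flim]) simp_all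
  have elim: "(\<lambda>n. exp (- F n u)) \<longlonglongrightarrow> exp (- (a / 2 * (norm (R u))\<^sup>2))" for u
    by (intro tendsto_intros Flim)
  have le: "exp (- F n u) \<le> w u" for n u using w(2) by (simp add: F_def k_def)
  have em: "(\<lambda>u. exp (- (a / 2 * (norm (R u))\<^sup>2))) \<in> borel_measurable M"
    by (rule borel_measurable_LIMSEQ_real[OF elim]) simp_all
  have dom: "AE u in M. (\<lambda>n. exp (- F n u)) \<longlonglongrightarrow> exp (- (a / 2 * (norm (R u))\<^sup>2))"
    "AE u in M. norm (exp (- F n u)) \<le> w u" for n
    using le elim by (auto intro!: AE_I2 simp del: times_divide_eq_left)
  have me: "(\<lambda>u. exp (- F n u)) \<in> borel_measurable M" for n by measurable
  show I: "integrable M (\<lambda>u. exp (- (a / 2 * (norm (R u))\<^sup>2)))"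
    by (rule integrable_dominated_convergence[OF em me w(1) dom])
  have Zlim: "(\<lambda>n. \<integral>u. exp (- F n u) \<partial>M) \<longlonglongrightarrow> (\<integral>u. exp (- (a / 2 * (norm (R u))\<^sup>2)) \<partial>M)"
    by (rule integral_dominated_convergence[OF em me w(1) dom])
  have Slim: "(\<lambda>n. updates S a k n h \<bullet> h) \<longlonglongrightarrow> T h \<bullet> h" for h
  proof -
    obtain b where b: "T h = L b" "\<And>z. q b z + a * (R (L b) \<bullet> R (L z)) = h \<bullet> L z"
      using T unfolding inverts_def by metis
    have "\<forall>n. \<exists>c. updates S a k n h = L c \<and>
        (\<forall>z. q c z + a * (\<Sum>i<n. (L c \<bullet> k i) * (L z \<bullet> k i)) = h \<bullet> L z)"
      using U(3) unfolding inverts_def by metis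
    then obtain c where c: "\<And>n. updates S a k n h = L (c n)"
      "\<And>n z. q (c n) z + a * (\<Sum>i<n. (L (c n) \<bullet> k i) * (L z \<bullet> k i)) = h \<bullet> L z"
      by metis
    define y where "y = R (L b)"
    define p where "p n = (\<Sum>i<n. (y \<bullet> e i) *\<^sub>R e i)" for n
    have p: "p \<longlonglongrightarrow> y" using e unfolding basis_seq_def p_def by blast
    \<comment> \<open>The error is tested in the form of stage \<open>n\<close>. Everything cancels
      except the tail \<open>y - p n\<close> of the expansion of \<open>R (L b)\<close>, and
      coercivity uniform in \<open>n\<close> converts that tail into a rate.\<close>
    have bound: "norm (c n - b) \<le> \<bar>a\<bar> * (norm R * norm L) / d * norm (y - p n)" for n
    proof -
      let ?w = "c n - b"
      have py: "p n \<bullet> R (L z) = (\<Sum>i<n. (L b \<bullet> k i) * (L z \<bullet> k i))" for z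
        by (simp only: p_def inner_sum_left inner_scaleR_left Rk y_def inner_commute[of "e i" "R (L z)" for i])
      have "d * (norm ?w)\<^sup>2 \<le> q ?w ?w + a * (\<Sum>i<n. (L ?w \<bullet> k i) * (L ?w \<bullet> k i))"
        using coercive[of ?w n] by (simp add: k_def power2_eq_square)
      also have "\<dots> = h \<bullet> L ?w - (q b ?w + a * (\<Sum>i<n. (L b \<bullet> k i) * (L ?w \<bullet> k i)))"
        unfolding c(2)[of n, symmetric]
        by (simp only: q.diff_left blinfun.diff_right inner_diff_left left_diff_distrib sum_subtractf right_diff_distrib)
      also have "\<dots> = a * ((y - p n) \<bullet> R (L ?w))"
        unfolding b(2)[symmetric] py[symmetric] y_def[symmetric] by (simp add: inner_diff_left right_diff_distrib)
      also have "\<dots> \<le> \<bar>a\<bar> * \<bar>(y - p n) \<bullet> R (L ?w)\<bar>"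
        by (metis abs_ge_self abs_mult)
      also have "\<dots> \<le> \<bar>a\<bar> * (norm (y - p n) * (norm R * (norm L * norm ?w)))"
      proof (rule mult_left_mono)
        have "\<bar>(y - p n) \<bullet> R (L ?w)\<bar> \<le> norm (y - p n) * norm (R (L ?w))" by (rule Cauchy_Schwarz_ineq2)
        also have "norm (R (L ?w)) \<le> norm R * (norm L * norm ?w)"
          by (meson norm_blinfun mult_left_mono norm_ge_zero order_trans)
        finally show "\<bar>(y - p n) \<bullet> R (L ?w)\<bar> \<le> norm (y - p n) * (norm R * (norm L * norm ?w))"
          by (simp add: mult_left_mono)
      qed simp
      finally have "(d * norm ?w) * norm ?w \<le> (\<bar>a\<bar> * (norm R * norm L) * norm (y - p n)) * norm ?w"
        by (simp add: power2_eq_square mult_ac)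
      then have "d * norm ?w \<le> \<bar>a\<bar> * (norm R * norm L) * norm (y - p n)"
      proof (cases "?w = 0")
        case False
        then have "0 < norm ?w" by simp
        from mult_right_le_imp_le[OF _ this] show ?thesis
          using \<open>(d * norm ?w) * norm ?w \<le> _\<close> by blast
      qed simp
      then show ?thesis using d by (simp add: field_simps)
    qed
    have "(\<lambda>n. \<bar>a\<bar> * (norm R * norm L) / d * norm (y - p n)) \<longlonglongrightarrow> \<bar>a\<bar> * (norm R * norm L) / d * norm (y - y)"
      by (intro tendsto_intros p)
    then have "(\<lambda>n. c n - b) \<longlonglongrightarrow> 0"
      by (intro Lim_null_comparison[OF always_eventually[OF allI[OF bound]]]) simp
    then have "c \<longlonglongrightarrow> b" by (simp add: LIM_zero_iff)
    then show ?thesis unfolding c(1) b(1) by (intro tendsto_intros)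
  qed
  show "is_gaussian (gibbs M (\<lambda>u. a / 2 * (norm (R u))\<^sup>2)) 0 T"
  proof (rule gibbs_gaussianI[OF is_gaussianD(1,2)[OF M] I T_cov])
    fix h
    let ?e = "\<lambda>n u. complex_of_real (exp (- F n u)) * iexp (u \<bullet> h)"
    have 1: "(\<lambda>n. CLINT u|M. ?e n u) \<longlonglongrightarrow> (CLINT u|M. complex_of_real (exp (- (a / 2 * (norm (R u))\<^sup>2))) * iexp (u \<bullet> h))"
    proof (rule integral_dominated_convergence[where w=w])
      show "(\<lambda>u. complex_of_real (exp (- (a / 2 * (norm (R u))\<^sup>2))) * iexp (u \<bullet> h)) \<in> borel_measurable M"
        by (intro borel_measurable_times) (use Rm in measurable)
      show "AE u in M. (\<lambda>n. ?e n u) \<longlonglongrightarrow> complex_of_real (exp (- (a / 2 * (norm (R u))\<^sup>2))) * iexp (u \<bullet> h)"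
        by (intro AE_I2 tendsto_intros elim)
      show "AE u in M. norm (?e n u) \<le> w u" for n using le by (intro AE_I2) (simp add: norm_mult)
    qed (use w(1) in auto)
    have 2: "(\<lambda>n. complex_of_real (\<integral>u. exp (- F n u) \<partial>M) * (iexp (0 \<bullet> h) * exp (- (updates S a k n h \<bullet> h) / 2)))
        \<longlonglongrightarrow> complex_of_real (\<integral>u. exp (- (a / 2 * (norm (R u))\<^sup>2)) \<partial>M) * (iexp (0 \<bullet> h) * exp (- (T h \<bullet> h) / 2))"
      by (intro tendsto_intros Zlim Slim) auto
    have eq: "(CLINT u|M. ?e n u) = complex_of_real (\<integral>u. exp (- F n u) \<partial>M)
        * (iexp (0 \<bullet> h) * exp (- (updates S a k n h \<bullet> h) / 2))" for n
      by (rule gibbs_gaussianD[OF is_gaussianD(1,2)[OF M] U(1) U(2)])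
    show "(CLINT u|M. complex_of_real (exp (- (a / 2 * (norm (R u))\<^sup>2))) * iexp (u \<bullet> h))
      = complex_of_real (\<integral>u. exp (- (a / 2 * (norm (R u))\<^sup>2)) \<partial>M) * (iexp (0 \<bullet> h) * exp (- (T h \<bullet> h) / 2))"
      using 1 2 unfolding eq by (rule LIMSEQ_unique)
  qed
qed

end

section \<open>Compactness, coercivity and integrability\<close>

text \<open>Finite-dimensional boundedness without leaving the ambient space: a Minkowski sum of
  finitely many compact segments is compact.\<close>

lemma compact_coordinate_set:
  fixes e :: "nat \<Rightarrow> 'a::real_inner"
  obtains D where "compact D" "\<And>x. (\<And>i. \<bar>x \<bullet> e i\<bar> \<le> K) \<Longrightarrow> (\<Sum>i<N. (x \<bullet> e i) *\<^sub>R e i) \<in> D"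
proof -
  have "\<exists>D. compact D \<and> (\<forall>x. (\<forall>i. \<bar>x \<bullet> e i\<bar> \<le> K) \<longrightarrow> (\<Sum>i<N. (x \<bullet> e i) *\<^sub>R e i) \<in> D)"
  proof (induction N)
    case 0
    show ?case by (intro exI[of _ "{0}"]) simp
  next
    case (Suc N)
    then obtain D where D: "compact D" "\<And>x. (\<forall>i. \<bar>x \<bullet> e i\<bar> \<le> K) \<Longrightarrow> (\<Sum>i<N. (x \<bullet> e i) *\<^sub>R e i) \<in> D"
      by auto
    have "compact ((\<lambda>a. a *\<^sub>R e N) ` {-K..K})"
      by (intro compact_continuous_image continuous_intros) simp
    then have "compact {x + y | x y. x \<in> D \<and> y \<in> (\<lambda>a. a *\<^sub>R e N) ` {-K..K}}"
      using D(1) by (intro compact_sums)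
    moreover have "(\<Sum>i<Suc N. (x \<bullet> e i) *\<^sub>R e i) \<in> {x + y | x y. x \<in> D \<and> y \<in> (\<lambda>a. a *\<^sub>R e N) ` {-K..K}}"
      if "\<forall>i. \<bar>x \<bullet> e i\<bar> \<le> K" for x
    proof -
      have "x \<bullet> e N \<in> {-K..K}" using that by (auto simp: abs_le_iff minus_le_iff)
      then have "(x \<bullet> e N) *\<^sub>R e N \<in> (\<lambda>a. a *\<^sub>R e N) ` {-K..K}" by (rule imageI)
      then show ?thesis using D(2)[OF that] unfolding sum.lessThan_Suc by blast
    qed
    ultimately show ?case by blast
  qed
  then show thesis using that by blast
qed

context covariance_root
begin

text \<open>The trace of \<open>L o\<^sub>L L\<close> is the squared Hilbert-Schmidt norm of
  \<open>L\<close>.\<close>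

lemma summable_norm_sq_root:
  assumes "basis_seq e"
  shows "summable (\<lambda>i. (norm (L (e i)))\<^sup>2)"
  using basis_seq_summable[OF assms covariance_L] by (simp add: power2_norm_eq_inner L_sym)

text \<open>A Hilbert-Schmidt operator is compact: on the ball the tails of the expansion of
  \<open>L x\<close> are uniformly small, since \<open><L x, e_i>^2 <= |x|^2 |L e_i|^2\<close>, and
  the heads lie in a compact set.\<close>

lemma compact_closure_image_ball:
  fixes e :: "nat \<Rightarrow> 'a"
  assumes e: "basis_seq e"
  shows "compact (closure (L ` cball 0 K))"
  unfolding compact_eq_totally_bounded complete_eq_closed
proof (intro conjI allI impI)
  let ?T = "L ` cball 0 K"
  show "closed (closure ?T)" by simp
  fix \<epsilon> :: real assume \<epsilon>: "\<epsilon> > 0"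
  \<comment> \<open>A positive substitute for \<open>\<bar>K\<bar>\<close>, so that \<open>r\<close>
    can be defined by division.\<close>
  define K1 where "K1 = \<bar>K\<bar> + 1"
  have K1: "K1 > 0" "\<bar>K\<bar> \<le> K1" by (simp_all add: K1_def add_nonneg_pos)
  \<comment> \<open>The tail costs at most an eighth of \<open>\<epsilon>\<close> and the net for
    the heads a quarter. The sum is below a half, leaving room to pass from closed balls, needed for
    the closure, back to open ones.\<close>
  define r where "r = \<epsilon> / 8 / K1"
  have r: "r > 0" using \<epsilon> K1 by (simp add: r_def)
  obtain N where N: "\<And>m. norm (\<Sum>i = N..<m. (norm (L (e i)))\<^sup>2) < r\<^sup>2"
    using summable_norm_sq_root[OF e] r unfolding summable_Cauchy by (meson order_refl zero_less_power)
  have unit: "norm (e i) \<le> 1" for i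
    using e unfolding basis_seq_def by (metis norm_zero order_refl zero_le_one)
  have orth: "\<And>i j. i \<noteq> j \<Longrightarrow> e i \<bullet> e j = 0" "\<And>i. e i = 0 \<or> norm (e i) = 1"
    using e unfolding basis_seq_def by blast+
  obtain D where D: "compact D" "\<And>x. (\<And>i. \<bar>x \<bullet> e i\<bar> \<le> norm L * \<bar>K\<bar>) \<Longrightarrow> (\<Sum>i<N. (x \<bullet> e i) *\<^sub>R e i) \<in> D"
    by (rule compact_coordinate_set[where K="norm L * \<bar>K\<bar>" and e=e and N=N]) blast
  obtain F where F: "finite F" "D \<subseteq> (\<Union>x\<in>F. ball x (\<epsilon> / 4))"
    using D(1) \<epsilon> unfolding compact_eq_totally_bounded by (meson zero_less_divide_iff zero_less_numeral)
  have "?T \<subseteq> (\<Union>x\<in>F. cball x (\<epsilon> / 2))"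
  proof
    fix y assume "y \<in> ?T"
    then obtain x where x: "y = L x" "norm x \<le> K" by auto
    define p where "p m = (\<Sum>i<m. (y \<bullet> e i) *\<^sub>R e i)" for m
    have py: "p \<longlonglongrightarrow> y" using e unfolding basis_seq_def p_def by blast
    have ny: "norm y \<le> norm L * \<bar>K\<bar>"
      unfolding x(1) using x(2) by (intro order_trans[OF norm_blinfun] mult_left_mono) auto
    have "\<bar>y \<bullet> e i\<bar> \<le> norm L * \<bar>K\<bar>" for i
    proof -
      have "\<bar>y \<bullet> e i\<bar> \<le> norm y * norm (e i)" by (rule Cauchy_Schwarz_ineq2)
      also have "\<dots> \<le> norm y" using unit[of i] by (simp add: mult_left_le)
      finally show ?thesis using ny by simp
    qed
    then have pD: "p N \<in> D" unfolding p_def by (rule D(2))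
    have diff: "norm (p m - p N) \<le> \<epsilon> / 8" if "m \<ge> N" for m
    proof -
      have "p m - p N = (\<Sum>i\<in>{N..<m}. (y \<bullet> e i) *\<^sub>R e i)"
        using that by (simp add: p_def lessThan_atLeast0 sum_diff_nat_ivl)
      then have "(norm (p m - p N))\<^sup>2 = (\<Sum>i = N..<m. (y \<bullet> e i)\<^sup>2)"
        using norm_sq_sum_orthogonal[where e=e and x=y, OF orth, of "{N..<m}"] by simp
      also have "\<dots> \<le> (\<Sum>i = N..<m. \<bar>K\<bar>\<^sup>2 * (norm (L (e i)))\<^sup>2)"
      proof (rule sum_mono)
        fix i
        have "(y \<bullet> e i)\<^sup>2 = (x \<bullet> L (e i))\<^sup>2" by (simp add: x(1) L_sym)
        also have "\<dots> \<le> (x \<bullet> x) * (L (e i) \<bullet> L (e i))" by (rule Cauchy_Schwarz_ineq)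
        also have "\<dots> = (norm x)\<^sup>2 * (norm (L (e i)))\<^sup>2" by (simp only: power2_norm_eq_inner)
        also have "\<dots> \<le> \<bar>K\<bar>\<^sup>2 * (norm (L (e i)))\<^sup>2"
          using x(2) by (intro mult_right_mono power_mono) auto
        finally show "(y \<bullet> e i)\<^sup>2 \<le> \<bar>K\<bar>\<^sup>2 * (norm (L (e i)))\<^sup>2" .
      qed
      also have "\<dots> = \<bar>K\<bar>\<^sup>2 * (\<Sum>i = N..<m. (norm (L (e i)))\<^sup>2)" by (simp add: sum_distrib_left)
      also have "\<dots> \<le> \<bar>K\<bar>\<^sup>2 * r\<^sup>2" using N[of m] by (intro mult_left_mono) auto
      also have "\<dots> = (\<bar>K\<bar> * r)\<^sup>2" by (simp add: power_mult_distrib)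
      finally have "norm (p m - p N) \<le> \<bar>K\<bar> * r" by (rule power2_le_imp_le) (use r in simp)
      also have "\<dots> \<le> K1 * r" using r K1 by (intro mult_right_mono) auto
      also have "\<dots> = \<epsilon> / 8" using K1 by (simp add: r_def)
      finally show ?thesis .
    qed
    have "norm (y - p N) \<le> \<epsilon> / 8"
    proof (rule LIMSEQ_le_const2)
      show "(\<lambda>m. norm (p m - p N)) \<longlonglongrightarrow> norm (y - p N)" by (intro tendsto_intros py)
      show "\<exists>M. \<forall>m\<ge>M. norm (p m - p N) \<le> \<epsilon> / 8" using diff by blast
    qed
    moreover obtain f where f: "f \<in> F" "dist f (p N) < \<epsilon> / 4" using F(2) pD by auto
    ultimately have "dist f y \<le> \<epsilon> / 2"
      using dist_triangle[of f y "p N"] \<epsilon> by (simp add: dist_norm norm_minus_commute)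
    then show "y \<in> (\<Union>x\<in>F. cball x (\<epsilon> / 2))" using f(1) by auto
  qed
  then have "closure ?T \<subseteq> (\<Union>x\<in>F. cball x (\<epsilon> / 2))"
    using F(1) by (intro closure_minimal closed_UN) auto
  also have "\<dots> \<subseteq> (\<Union>x\<in>F. ball x \<epsilon>)" using \<epsilon> by auto
  finally show "\<exists>k. finite k \<and> closure ?T \<subseteq> (\<Union>x\<in>k. ball x \<epsilon>)" using F(1) by blast
qed

text \<open>
  A unit sequence along which the form tends to \<open>0\<close> has, by compactness of \<open>L\<close>, a limit point in
  the kernel of the form, and the kernel is trivial because the form is invertible.
\<close>

lemma form_coercive:
  fixes A :: "'a \<Rightarrow>\<^sub>L 'a" and e :: "nat \<Rightarrow> 'a"
  assumes e: "basis_seq e" and inj: "inj L" and A: "\<And>x y. A x \<bullet> y = x \<bullet> A y"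
  defines "q \<equiv> \<lambda>x z. x \<bullet> z + A (L x) \<bullet> L z"
  assumes nonneg: "\<And>x. 0 \<le> q x x" and S: "inverts S q"
  obtains d where "0 < d" "\<And>x. d * (norm x)\<^sup>2 \<le> q x x"
proof (rule ccontr)
  note goal = that
  assume "\<not> thesis"
  then have no: "\<exists>x. q x x < d * (norm x)\<^sup>2" if "d > 0" for d
    using goal[of d] \<open>d > 0\<close> \<open>\<not> thesis\<close> by (meson not_le)
  have sym: "q x y = q y x" for x y unfolding q_def using A[of "L x" "L y"] by (simp add: inner_commute)
  have qL: "q x z = (x + L (A (L x))) \<bullet> z" for x z by (simp add: q_def inner_add_left L_sym)
  have qb: "bilinear q"
    unfolding q_def bilinear_def
    by (auto intro!: linearI simp: blinfun.add_right blinfun.scaleR_right inner_add_left inner_add_right algebra_simps)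
  have "\<exists>x. norm x = 1 \<and> q x x < 1 / (real n + 1)" for n
  proof -
    obtain y where y: "q y y < 1 / (real n + 1) * (norm y)\<^sup>2" using no[of "1 / (real n + 1)"] by auto
    then have "y \<noteq> 0" using nonneg[of y] by auto
    define t where "t = 1 / norm y"
    have "q (t *\<^sub>R y) (t *\<^sub>R y) = t\<^sup>2 * q y y"
      by (simp add: bilinear_lmul[OF qb] bilinear_rmul[OF qb] power2_eq_square)
    also have "\<dots> < t\<^sup>2 * (1 / (real n + 1) * (norm y)\<^sup>2)"
      using y \<open>y \<noteq> 0\<close> by (intro mult_strict_left_mono) (auto simp: t_def)
    also have "\<dots> = 1 / (real n + 1)" using \<open>y \<noteq> 0\<close> by (simp add: t_def power2_eq_square)
    finally show ?thesis using \<open>y \<noteq> 0\<close> by (intro exI[of _ "t *\<^sub>R y"]) (simp add: t_def)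
  qed
  then obtain x where x: "\<And>n. norm (x n) = 1" "\<And>n. q (x n) (x n) < 1 / (real n + 1)" by metis
  \<comment> \<open>The vector representing \<open>q (x n)\<close>, half the gradient of the
    quadratic form.\<close>
  define v where "v n = x n + L (A (L (x n)))" for n
  define K where "K = 1 + norm A * norm L * norm L"
  have K: "q z z \<le> K * (norm z)\<^sup>2" for z
  proof -
    have "A (L z) \<bullet> L z \<le> norm (A (L z)) * norm (L z)" by (rule norm_cauchy_schwarz)
    also have "\<dots> \<le> (norm A * (norm L * norm z)) * (norm L * norm z)"
      by (intro mult_mono order_trans[OF norm_blinfun] mult_left_mono norm_blinfun) auto
    finally show ?thesis
      by (simp add: q_def K_def power2_norm_eq_inner[symmetric] power2_eq_square algebra_simps)
  qed
  \<comment> \<open>Cauchy-Schwarz for the possibly degenerate form \<open>q\<close>: small values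
    of \<open>q\<close> on unit vectors force small gradients.\<close>
  have v2: "(norm (v n))\<^sup>2 \<le> K / (real n + 1)" for n
  proof (cases "v n = 0")
    case False
    have "((norm (v n))\<^sup>2)\<^sup>2 = (q (x n) (v n))\<^sup>2" by (simp add: qL v_def power2_norm_eq_inner)
    also have "\<dots> \<le> q (x n) (x n) * q (v n) (v n)"
      by (rule psd_form_Cauchy_Schwarz[OF qb sym nonneg])
    also have "\<dots> \<le> 1 / (real n + 1) * (K * (norm (v n))\<^sup>2)"
      using x(2)[of n] by (intro mult_mono K nonneg) auto
    finally have "(norm (v n))\<^sup>2 * (norm (v n))\<^sup>2 \<le> (K / (real n + 1)) * (norm (v n))\<^sup>2"
      by (simp add: power2_eq_square)
    moreover have "0 < (norm (v n))\<^sup>2" using False by simp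
    ultimately show ?thesis by (rule mult_right_le_imp_le)
  qed (simp add: K_def)
  have "(\<lambda>n. K / (real n + 1)) \<longlonglongrightarrow> 0" by real_asymp
  then have "(\<lambda>n. (norm (v n))\<^sup>2) \<longlonglongrightarrow> 0"
    by (rule Lim_null_comparison[rotated]) (use v2 in auto)
  then have "(\<lambda>n. sqrt ((norm (v n))\<^sup>2)) \<longlonglongrightarrow> sqrt 0" by (rule tendsto_real_sqrt)
  then have v: "v \<longlonglongrightarrow> 0" by (simp add: tendsto_norm_zero_iff)
  have "L (x n) \<in> closure (L ` cball 0 1)" for n
    using x(1)[of n] closure_subset[of "L ` cball 0 1"] by auto
  then obtain y s where s: "strict_mono s" "((\<lambda>n. L (x n)) \<circ> s) \<longlonglongrightarrow> y"
    using compact_closure_image_ball[OF e, of 1]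
    unfolding compact_eq_seq_compact_metric seq_compact_def by metis
  \<comment> \<open>Compactness gives convergence of \<open>L x\<close> along a subsequence only;
    solving \<open>v = x + L (A (L x))\<close> for \<open>x\<close> upgrades this to norm
    convergence of \<open>x\<close>, so the limit is still a unit vector.\<close>
  define z where "z = - L (A y)"
  have Ly: "(\<lambda>n. L (x (s n))) \<longlonglongrightarrow> y" using s(2) by (simp add: o_def)
  have "(\<lambda>n. v (s n) - L (A (L (x (s n))))) \<longlonglongrightarrow> 0 - L (A y)"
    using LIMSEQ_subseq_LIMSEQ[OF v s(1)] by (intro tendsto_intros Ly) (simp add: o_def)
  then have xz: "(\<lambda>n. x (s n)) \<longlonglongrightarrow> z" by (simp add: v_def z_def)
  have "norm z = 1"
    using tendsto_norm[OF xz] by (simp add: x(1) LIMSEQ_const_iff)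
  have "(\<lambda>n. L (x (s n))) \<longlonglongrightarrow> L z" by (intro tendsto_intros xz)
  then have "y = L z" using Ly LIMSEQ_unique by blast
  then have qz: "q z w = 0" for w by (simp add: qL z_def[symmetric]) (simp add: z_def)
  \<comment> \<open>With \<open>S h = L b\<close>, the number \<open>h . L z\<close> is
    \<open>q b z = q z b\<close>, which vanishes because \<open>z\<close> is in the kernel.\<close>
  have "h \<bullet> L z = 0" for h
    using S qz sym unfolding inverts_def by metis
  then have "L z = L 0" by (metis inner_eq_zero_iff blinfun.zero_right)
  then have "z = 0" using inj by (meson injD)
  then show False using \<open>norm z = 1\<close> by simp
qed

text \<open>A Fernique-type bound. The truncated integrals increase, and each new factor is at most
  \<open>exp (c |L e_n|^2 / (2 d))\<close>; the Hilbert-Schmidt property makes the product finite,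
  and monotone convergence concludes.\<close>

lemma integrable_exp_norm_sq:
  fixes e :: "nat \<Rightarrow> 'a"
  assumes M: "is_gaussian M 0 S" and S: "inverts S q" and q: "bilinear q" and e: "basis_seq e"
    and c: "0 \<le> c" and d: "0 < d" and coercive: "\<And>x. d * (norm x)\<^sup>2 \<le> q x x - c * (norm (L x))\<^sup>2"
  shows "integrable M (\<lambda>u. exp (c / 2 * (norm u)\<^sup>2))"
    and "d * (norm x)\<^sup>2 \<le> q x x + (- c) * (\<Sum>i<n. (L x \<bullet> e i)\<^sup>2)"
proof -
  interpret prob_space M by (rule is_gaussianD(1)[OF M])
  note [measurable_cong] = is_gaussianD(2)[OF M]
  have partial: "(\<Sum>i<n. (u \<bullet> e i)\<^sup>2) \<le> (norm u)\<^sup>2" for n u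
    using basis_seq_sums_norm[OF e, of u] by (metis sum_le_suminf sums_iff zero_le_power2 finite_lessThan)
  show dn: "d * (norm x)\<^sup>2 \<le> q x x + (- c) * (\<Sum>i<n. (L x \<bullet> e i)\<^sup>2)" for x n
    using coercive[of x] mult_left_mono[OF partial c, of "L x" n] by simp
  have pos: "0 < q x x + (- c) * (\<Sum>i<n. (L x \<bullet> e i)\<^sup>2)" if "x \<noteq> 0" for n x
  proof -
    have "0 < d * (norm x)\<^sup>2" using that d by simp
    then show ?thesis using dn[of x n] by simp
  qed
  define F where "F n u = - c / 2 * (\<Sum>i<n. (u \<bullet> e i)\<^sup>2)" for n u
  note U = updates_inverts[OF M S q pos, folded F_def]
  define Z where "Z n = (\<integral>u. exp (- F n u) \<partial>M)" for n
  define s where "s n = updates S (- c) e n (e n) \<bullet> e n" for n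
  have Zle: "Z n \<le> exp (\<Sum>i<n. c * (norm (L (e i)))\<^sup>2 / (2 * d))" for n
  proof (induction n)
    case 0
    then show ?case by (simp add: Z_def F_def prob_space)
  next
    case (Suc n)
    have s1: "0 < 1 - c * s n" using U(4)[of n] by (simp add: s_def)
    \<comment> \<open>The variance after the update. The factor \<open>1 / (1 - c s)\<close> gives
      no bound by itself, but it equals \<open>1 + c s'\<close>, and coercivity of the updated form
      bounds \<open>s'\<close>.\<close>
    define s' where "s' = updates S (- c) e (Suc n) (e n) \<bullet> e n"
    have "s' = s n - (- c) * s n * s n / (1 - c * s n)"
      by (simp add: s'_def rank_one_update_apply inner_diff_left inner_add_left s_def inner_commute[of "e n"])
    then have s': "1 / (1 - c * s n) = 1 + c * s'"
      using s1 by (simp add: field_simps)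
    have dq: "d * (norm x)\<^sup>2 \<le> q x x + (- c) * (\<Sum>i<Suc n. (L x \<bullet> e i) * (L x \<bullet> e i))" for x
      using dn[of x "Suc n"] by (simp only: power2_eq_square[of "L x \<bullet> e i" for i])
    have "s' \<le> (norm (L (e n)))\<^sup>2 / d"
      unfolding s'_def by (rule inverts_le[OF U(3) d dq])
    then have cs': "c * s' \<le> c * ((norm (L (e n)))\<^sup>2 / d)" using c by (rule mult_left_mono)
    have "Z (Suc n) = Z n * sqrt (1 / (1 - c * s n))"
      using U(5)[of n] by (simp add: Z_def s_def real_sqrt_divide)
    also have "sqrt (1 / (1 - c * s n)) \<le> exp (c * s' / 2)"
    proof -
      have "1 + c * s' \<le> exp (c * s')" by (rule exp_ge_add_one_self)
      also have "\<dots> = (exp (c * s' / 2))\<^sup>2" by (simp add: exp_double[symmetric])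
      finally show ?thesis unfolding s' by (simp add: real_le_lsqrt)
    qed
    also have "exp (c * s' / 2) \<le> exp (c * (norm (L (e n)))\<^sup>2 / (2 * d))" using cs' by (simp add: field_simps)
    finally have "Z (Suc n) \<le> Z n * exp (c * (norm (L (e n)))\<^sup>2 / (2 * d))"
      by (simp add: Z_def mult_left_mono)
    also have "\<dots> \<le> exp (\<Sum>i<n. c * (norm (L (e i)))\<^sup>2 / (2 * d)) * exp (c * (norm (L (e n)))\<^sup>2 / (2 * d))"
      using Suc by (intro mult_right_mono) auto
    finally show ?case by (simp add: exp_add)
  qed
  have sm: "summable (\<lambda>i. c * (norm (L (e i)))\<^sup>2 / (2 * d))"
    using summable_norm_sq_root[OF e] by (intro summable_divide summable_mult)
  have Zbd: "Z n \<le> exp (\<Sum>i. c * (norm (L (e i)))\<^sup>2 / (2 * d))" for n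
    using sum_le_suminf[OF sm, of "{..<n}"] c d by (intro order_trans[OF Zle]) simp
  have Fle: "exp (- F n u) \<le> exp (- F m u)" if "n \<le> m" for n m u
  proof -
    have "(\<Sum>i<n. (u \<bullet> e i)\<^sup>2) \<le> (\<Sum>i<m. (u \<bullet> e i)\<^sup>2)" using that by (intro sum_mono2) auto
    then show ?thesis using c by (simp add: F_def mult_left_mono)
  qed
  have "incseq Z"
    unfolding Z_def by (intro incseq_SucI integral_mono U(1) Fle) simp_all
  then obtain l where l: "Z \<longlonglongrightarrow> l" using incseq_convergent[of Z] Zbd by blast
  show "integrable M (\<lambda>u. exp (c / 2 * (norm u)\<^sup>2))"
  proof (rule integrable_monotone_convergence[where f="\<lambda>n u. exp (- F n u)" and x=l])
    show "integrable M (\<lambda>u. exp (- F n u))" for n by (rule U(1))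
    show "AE u in M. mono (\<lambda>n. exp (- F n u))" using Fle by (intro AE_I2 monoI) auto
    have "(\<lambda>n. exp (c / 2 * (\<Sum>i<n. (u \<bullet> e i)\<^sup>2))) \<longlonglongrightarrow> exp (c / 2 * (norm u)\<^sup>2)" for u
      using basis_seq_sums_norm[OF e, of u] unfolding sums_def by (intro tendsto_intros)
    then show "AE u in M. (\<lambda>n. exp (- F n u)) \<longlonglongrightarrow> exp (c / 2 * (norm u)\<^sup>2)" by (simp add: F_def)
    show "(\<lambda>n. \<integral>u. exp (- F n u) \<partial>M) \<longlonglongrightarrow> l" using l unfolding Z_def[abs_def] .
    have "(\<lambda>u::'a. exp (c / 2 * (norm u)\<^sup>2)) \<in> borel_measurable borel"
      by (intro borel_measurable_continuous_onI continuous_intros)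
    then show "(\<lambda>u. exp (c / 2 * (norm u)\<^sup>2)) \<in> borel_measurable M" by simp
  qed
qed

end

section \<open>Quadratic densities\<close>

context covariance_root
begin

text \<open>
  With \<open>c = \<parallel>A\<parallel>\<close> and \<open>R\<^sup>2 = A + c\<close>, the quadratic form splits as
  \<open>\<langle>A u, u\<rangle> = \<parallel>R u\<parallel>\<^sup>2 - c \<parallel>u\<parallel>\<^sup>2\<close>; the two parts are treated one after the other.
\<close>

lemma gibbs_quadratic_gaussian:
  fixes A :: "'a \<Rightarrow>\<^sub>L 'a" and e :: "nat \<Rightarrow> 'a"
  assumes M: "is_gaussian M 0 (L o\<^sub>L L)" and inj: "inj L" and e: "basis_seq e"
    and A: "\<And>x y. A x \<bullet> y = x \<bullet> A y"
    and nonneg: "\<And>x. 0 \<le> x \<bullet> x + A (L x) \<bullet> L x"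
    and C: "inverts C (\<lambda>x z. x \<bullet> z + A (L x) \<bullet> L z)"
  shows "integrable M (\<lambda>u. exp (- (1/2 * (A u \<bullet> u))))"
    and "is_gaussian (gibbs M (\<lambda>u. 1/2 * (A u \<bullet> u))) 0 C"
proof -
  note [measurable_cong] = is_gaussianD(2)[OF M]
  define q where "q x z = x \<bullet> z + A (L x) \<bullet> L z" for x z
  have sym: "q x y = q y x" for x y unfolding q_def using A[of "L x" "L y"] by (simp add: inner_commute)
  obtain d where d: "0 < d" and coercive: "\<And>x. d * (norm x)\<^sup>2 \<le> q x x"
    using form_coercive[OF e inj A nonneg C] unfolding q_def by blast
  \<comment> \<open>By Cauchy-Schwarz this shift makes \<open>A + c\<close> positive, so that it has
    a square root.\<close>
  define c where "c = norm A"
  have c: "0 \<le> c" by (simp add: c_def)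
  define B where "B = A + c *\<^sub>R id_blinfun"
  have Bx: "B x = A x + c *\<^sub>R x" for x by (simp add: B_def blinfun.add_left blinfun.scaleR_left)
  have B: "positive_operator B"
    unfolding positive_operator_def
  proof (intro conjI allI)
    show "B x \<bullet> y = x \<bullet> B y" for x y by (simp add: Bx inner_add_left inner_add_right A)
    fix x
    have "\<bar>A x \<bullet> x\<bar> \<le> norm (A x) * norm x" by (rule Cauchy_Schwarz_ineq2)
    also have "\<dots> \<le> c * norm x * norm x" unfolding c_def by (intro mult_right_mono norm_blinfun) simp
    finally show "0 \<le> B x \<bullet> x"
      by (simp add: Bx inner_add_left power2_norm_eq_inner[symmetric] power2_eq_square mult.assoc)
  qed
  define R where "R = sqrt_op B"
  have R: "R x \<bullet> y = x \<bullet> R y" for x y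
    unfolding R_def by (rule positive_operator_sym[OF sqrt_op_works(1)[OF B]])
  have RR: "R x \<bullet> R y = B x \<bullet> y" for x y
    using sqrt_op_works(2)[OF B] unfolding R_def[symmetric] by (metis R blinfun_apply_blinfun_compose inner_commute)
  \<comment> \<open>The form of the intermediate covariance \<open>T\<close>. It dominates the inner
    product, so its inverse exists with constant 1.\<close>
  define p where "p x z = x \<bullet> z + 1 * (R (L x) \<bullet> R (L z))" for x z
  have pq: "p x z = q x z + c * (L x \<bullet> L z)" for x z
    by (simp add: p_def q_def RR Bx inner_add_left)
  have pb: "bounded_bilinear p"
  proof -
    have "bounded_linear (\<lambda>x. x + L (B (L x)))" by (intro bounded_linear_intros)
    then have "bounded_bilinear (\<lambda>x z. (x + L (B (L x))) \<bullet> z)"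
      by (rule bounded_bilinear.comp1[OF bounded_bilinear_inner])
    then show ?thesis unfolding p_def[abs_def] by (simp add: RR inner_add_left L_sym)
  qed
  have psym: "p x y = p y x" for x y unfolding p_def by (simp add: inner_commute)
  have p1: "1 * (norm x)\<^sup>2 \<le> p x x" for x by (simp add: p_def power2_norm_eq_inner)
  obtain T where T: "inverts T p" using ex_inverts[OF pb zero_less_one p1 psym] by blast
  have T_cov: "covariance_operator T" by (rule inverts_covariance[OF T zero_less_one p1 psym])
  have S0: "inverts (L o\<^sub>L L) (\<bullet>)"
    unfolding inverts_def by (auto simp: L_sym)
  have eq1: "1 / 2 * (norm (R u))\<^sup>2 = 1 / 2 * (B u \<bullet> u)" for u by (simp add: power2_norm_eq_inner RR)
  interpret M: prob_space M by (rule is_gaussianD(1)[OF M])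
  have 1: "integrable M (\<lambda>u. exp (- (1 / 2 * (norm (R u))\<^sup>2)))"
    "is_gaussian (gibbs M (\<lambda>u. 1 / 2 * (norm (R u))\<^sup>2)) 0 T"
  proof -
    have co: "1 * (norm x)\<^sup>2 \<le> x \<bullet> x + 1 * (\<Sum>i<n. (L x \<bullet> R (e i))\<^sup>2)" for n x
      by (simp add: power2_norm_eq_inner sum_nonneg)
    have le: "exp (- (1 / 2 * (\<Sum>i<n. (u \<bullet> R (e i))\<^sup>2))) \<le> 1" for n and u :: 'a
      by (simp add: sum_nonneg)
    have i1: "integrable M (\<lambda>u. 1 :: real)" by simp
    note Q = quadratic_update[OF M S0 bounded_bilinear_inner e R zero_less_one co T[unfolded p_def] T_cov i1 le]
    show "integrable M (\<lambda>u. exp (- (1 / 2 * (norm (R u))\<^sup>2)))" by (rule Q(1))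
    show "is_gaussian (gibbs M (\<lambda>u. 1 / 2 * (norm (R u))\<^sup>2)) 0 T" by (rule Q(2))
  qed
  let ?N = "gibbs M (\<lambda>u. 1 / 2 * (norm (R u))\<^sup>2)"
  have pbil: "bilinear p"
    unfolding bilinear_def
    by (auto intro: bounded_linear.linear bounded_bilinear.bounded_linear_left[OF pb] bounded_bilinear.bounded_linear_right[OF pb])
  \<comment> \<open>Removing all of \<open>c\<close> from \<open>p\<close> returns exactly
    \<open>q\<close>; removing only finitely many coordinates leaves more, so \<open>d\<close>
    serves every stage.\<close>
  have co: "d * (norm x)\<^sup>2 \<le> p x x - c * (norm (L x))\<^sup>2" for x
    using coercive[of x] by (simp add: pq power2_norm_eq_inner)
  note E = integrable_exp_norm_sq[OF 1(2) T pbil e c d co]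
  have 2: "integrable ?N (\<lambda>u. exp (- ((- c) / 2 * (norm (id_blinfun u))\<^sup>2)))"
    "is_gaussian (gibbs ?N (\<lambda>u. (- c) / 2 * (norm (id_blinfun u))\<^sup>2)) 0 C"
  proof -
    have idb: "id_blinfun x \<bullet> y = x \<bullet> id_blinfun y" for x y :: 'a by simp
    have co': "d * (norm x)\<^sup>2 \<le> p x x + (- c) * (\<Sum>i<n. (L x \<bullet> id_blinfun (e i))\<^sup>2)" for n x
      using E(2)[of x n] by simp
    have "(\<lambda>x z. p x z + (- c) * (id_blinfun (L x) \<bullet> id_blinfun (L z))) = (\<lambda>x z. x \<bullet> z + A (L x) \<bullet> L z)"
      by (intro ext) (simp add: pq q_def)
    then have C': "inverts C (\<lambda>x z. p x z + (- c) * (id_blinfun (L x) \<bullet> id_blinfun (L z)))" using C by simp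
    have Ccov: "covariance_operator C"
      using inverts_covariance[OF C d] coercive sym unfolding q_def by blast
    have le: "exp (- ((- c) / 2 * (\<Sum>i<n. (u \<bullet> id_blinfun (e i))\<^sup>2))) \<le> exp (c / 2 * (norm u)\<^sup>2)" for n and u :: 'a
    proof -
      have "(\<Sum>i<n. (u \<bullet> e i)\<^sup>2) \<le> (norm u)\<^sup>2"
        using basis_seq_sums_norm[OF e, of u] by (metis sum_le_suminf sums_iff zero_le_power2 finite_lessThan)
      then show ?thesis using c by (simp add: mult_left_mono)
    qed
    note Q = quadratic_update[OF 1(2) T pb e idb d co' C' Ccov E(1) le]
    show "integrable ?N (\<lambda>u. exp (- ((- c) / 2 * (norm (id_blinfun u))\<^sup>2)))" by (rule Q(1))
    show "is_gaussian (gibbs ?N (\<lambda>u. (- c) / 2 * (norm (id_blinfun u))\<^sup>2)) 0 C" by (rule Q(2))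
  qed
  have mb: "(\<lambda>u::'a. (- c) / 2 * (norm (id_blinfun u))\<^sup>2) \<in> borel_measurable borel"
    by (intro borel_measurable_continuous_onI continuous_intros)
  then have m: "(\<lambda>u. (- c) / 2 * (norm (id_blinfun u))\<^sup>2) \<in> borel_measurable M" by simp
  note gg = gibbs_gibbs[OF M.prob_space_axioms 1(1) 2(1) m]
  have eq: "1 / 2 * (norm (R u))\<^sup>2 + (- c) / 2 * (norm (id_blinfun u))\<^sup>2 = 1/2 * (A u \<bullet> u)" for u
    unfolding eq1 by (simp add: Bx inner_add_left power2_norm_eq_inner add_divide_distrib)
  show "integrable M (\<lambda>u. exp (- (1/2 * (A u \<bullet> u))))" using gg(1) unfolding eq .
  show "is_gaussian (gibbs M (\<lambda>u. 1/2 * (A u \<bullet> u))) 0 C" using 2(2) unfolding gg(2) eq .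
qed

end

section \<open>Second derivatives at a minimum\<close>

lemma DERIV_along_line:
  fixes f :: "'a::real_normed_vector \<Rightarrow> real"
  assumes "(f has_derivative D) (at (c + s *\<^sub>R z))"
  shows "((\<lambda>s. f (c + s *\<^sub>R z)) has_real_derivative D z) (at s)"
proof -
  have "((\<lambda>s. c + s *\<^sub>R z) has_derivative (\<lambda>h. h *\<^sub>R z)) (at s)"
    by (auto intro!: derivative_eq_intros)
  from has_derivative_compose[OF this assms]
  have "((\<lambda>s. f (c + s *\<^sub>R z)) has_derivative (\<lambda>h. D (h *\<^sub>R z))) (at s)" .
  moreover have "D (h *\<^sub>R z) = D z * h" for h
    using linear_scale[OF has_derivative_linear[OF assms]] by simp
  ultimately show ?thesis by (simp add: has_field_derivative_def)
qed

text \<open>The mean value theorem in the direction \<open>z\<close> is applied to a difference in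
  the direction \<open>w\<close>. Only values of \<open>D\<close> appear, so differentiability of
  \<open>D\<close> at the single point \<open>a\<close> suffices.\<close>

lemma second_difference_approx:
  fixes f :: "'a::real_normed_vector \<Rightarrow> real" and D :: "'a \<Rightarrow> 'a \<Rightarrow>\<^sub>L real" and f'' :: "'a \<Rightarrow>\<^sub>L 'a \<Rightarrow>\<^sub>L real"
  assumes f: "\<forall>\<^sub>F x in nhds a. (f has_derivative D x) (at x)"
    and D: "(D has_derivative f'') (at a)" and \<epsilon>: "0 < \<epsilon>"
  shows "\<exists>\<tau>>0. \<forall>t. 0 < t \<and> t < \<tau> \<longrightarrow>
    \<bar>f (a + t *\<^sub>R w + t *\<^sub>R z) - f (a + t *\<^sub>R w) - f (a + t *\<^sub>R z) + f a - t\<^sup>2 * f'' w z\<bar> \<le> \<epsilon> * t\<^sup>2"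
proof -
  \<comment> \<open>The two remainders at \<open>y1\<close> and \<open>y2\<close> add up to
    \<open>\<epsilon> t (K - 1) / K\<close>; the summand 1 keeps \<open>K\<close> positive.\<close>
  define K where "K = (norm w + 2 * norm z) * norm z + 1"
  have K: "0 < K" unfolding K_def by (intro add_nonneg_pos mult_nonneg_nonneg add_nonneg_nonneg) auto
  obtain d1 where d1: "d1 > 0" "\<And>x. dist x a < d1 \<Longrightarrow> (f has_derivative D x) (at x)"
    using f unfolding eventually_nhds_metric by blast
  obtain d2 where d2: "d2 > 0"
    "\<And>y. norm (y - a) < d2 \<Longrightarrow> norm (D y - D a - f'' (y - a)) \<le> \<epsilon> / K * norm (y - a)"
    using D \<epsilon> K unfolding has_derivative_at_alt by (meson zero_less_divide_iff)
  \<comment> \<open>Bounds the whole parallelogram: for \<open>t\<close> below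
    \<open>min d1 d2 / N\<close> it lies in both neighborhoods.\<close>
  define N where "N = norm w + norm z + 1"
  have N: "0 < N" by (simp add: N_def add_nonneg_pos)
  define \<tau> where "\<tau> = min d1 d2 / N"
  have "0 < \<tau>" using d1 d2 N by (simp add: \<tau>_def)
  moreover have "\<bar>f (a + t *\<^sub>R w + t *\<^sub>R z) - f (a + t *\<^sub>R w) - f (a + t *\<^sub>R z) + f a - t\<^sup>2 * f'' w z\<bar> \<le> \<epsilon> * t\<^sup>2"
    if t: "0 < t" "t < \<tau>" for t
  proof -
    have tN: "t * N < d1" "t * N < d2" using t N by (simp_all add: \<tau>_def field_simps)
    have near: "norm (r *\<^sub>R w + s *\<^sub>R z) < min d1 d2" if "0 \<le> r" "r \<le> t" "0 \<le> s" "s \<le> t" for r s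
    proof -
      have "norm (r *\<^sub>R w + s *\<^sub>R z) \<le> r * norm w + s * norm z"
        using norm_triangle_ineq[of "r *\<^sub>R w" "s *\<^sub>R z"] that by simp
      also have "\<dots> \<le> t * norm w + t * norm z" using that by (intro add_mono mult_right_mono) auto
      also have "\<dots> \<le> t * N" using t by (simp add: N_def algebra_simps)
      finally show ?thesis using tN by simp
    qed
    have near1: "dist (a + r *\<^sub>R w + s *\<^sub>R z) a < d1" "norm ((a + r *\<^sub>R w + s *\<^sub>R z) - a) < d2"
      if "0 \<le> r" "r \<le> t" "0 \<le> s" "s \<le> t" for r s
      using near[OF that] by (simp_all add: dist_norm add.assoc)
    define g where "g s = f ((a + t *\<^sub>R w) + s *\<^sub>R z) - f (a + s *\<^sub>R z)" for s
    have "\<exists>\<xi>>0. \<xi> < t \<and> g t - g 0 = (t - 0) * (D (a + t *\<^sub>R w + \<xi> *\<^sub>R z) z - D (a + \<xi> *\<^sub>R z) z)"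
    proof (rule MVT2[OF t(1)])
      fix s assume s: "0 \<le> s" "s \<le> t"
      show "(g has_real_derivative D (a + t *\<^sub>R w + s *\<^sub>R z) z - D (a + s *\<^sub>R z) z) (at s)"
        unfolding g_def
        using d1(2)[OF near1(1)[of t s]] d1(2)[OF near1(1)[of 0 s]] s t
        by (intro DERIV_diff DERIV_along_line) auto
    qed
    then obtain \<xi> where \<xi>: "0 < \<xi>" "\<xi> < t"
      "g t - g 0 = t * (D (a + t *\<^sub>R w + \<xi> *\<^sub>R z) z - D (a + \<xi> *\<^sub>R z) z)" by auto
    define E where "E y = D y - D a - f'' (y - a)" for y
    define y1 where "y1 = a + t *\<^sub>R w + \<xi> *\<^sub>R z"
    define y2 where "y2 = a + \<xi> *\<^sub>R z"
    have E1: "norm (E y1) \<le> \<epsilon> / K * (t * norm w + t * norm z)"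
    proof -
      have "norm (y1 - a) \<le> t * norm w + \<xi> * norm z"
        using norm_triangle_ineq[of "t *\<^sub>R w" "\<xi> *\<^sub>R z"] t \<xi> by (simp add: y1_def add.assoc)
      also have "\<dots> \<le> t * norm w + t * norm z" using \<xi> by (intro add_left_mono mult_right_mono) auto
      finally have "\<epsilon> / K * norm (y1 - a) \<le> \<epsilon> / K * (t * norm w + t * norm z)"
        using \<epsilon> K by (intro mult_left_mono) auto
      moreover have "norm (y1 - a) < d2" unfolding y1_def using near1(2)[of t \<xi>] t \<xi> by simp
      ultimately show ?thesis using d2(2)[of y1] unfolding E_def by linarith
    qed
    have E2: "norm (E y2) \<le> \<epsilon> / K * (t * norm z)"
    proof -
      have "norm (y2 - a) \<le> t * norm z" using \<xi> by (simp add: y2_def mult_right_mono)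
      then have "\<epsilon> / K * norm (y2 - a) \<le> \<epsilon> / K * (t * norm z)"
        using \<epsilon> K by (intro mult_left_mono) auto
      moreover have "norm (y2 - a) < d2" unfolding y2_def using near1(2)[of 0 \<xi>] t \<xi> by simp
      ultimately show ?thesis using d2(2)[of y2] unfolding E_def by linarith
    qed
    have "f'' (y1 - a) - f'' (y2 - a) = t *\<^sub>R f'' w"
      by (simp add: y1_def y2_def blinfun.diff_right[symmetric] blinfun.scaleR_right[symmetric])
    then have "f'' (y1 - a) z - f'' (y2 - a) z = t * f'' w z"
      by (metis blinfun.diff_left blinfun.scaleR_left real_scaleR_def)
    then have DE: "D y1 z - D y2 z = t * f'' w z + (E y1 z - E y2 z)"
      by (simp add: E_def blinfun.diff_left)
    have "g t - g 0 - t\<^sup>2 * f'' w z = t * (E y1 z - E y2 z)"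
      unfolding \<xi>(3) y1_def[symmetric] y2_def[symmetric] DE by (simp add: algebra_simps power2_eq_square)
    moreover have "\<bar>E y1 z - E y2 z\<bar> \<le> (\<epsilon> / K * (t * norm w + t * norm z)) * norm z + (\<epsilon> / K * (t * norm z)) * norm z"
      using norm_blinfun[of "E y1" z] norm_blinfun[of "E y2" z] mult_right_mono[OF E1, of "norm z"] mult_right_mono[OF E2, of "norm z"]
      by simp
    moreover have "(\<epsilon> / K * (t * norm w + t * norm z)) * norm z + (\<epsilon> / K * (t * norm z)) * norm z = \<epsilon> * t * ((K - 1) / K)"
    proof -
      have "K - 1 = (norm w + 2 * norm z) * norm z" by (simp add: K_def)
      then show ?thesis by (simp add: add_divide_distrib algebra_simps)
    qed
    moreover have "\<epsilon> * t * ((K - 1) / K) \<le> \<epsilon> * t"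
      by (rule mult_left_le) (use K \<epsilon> t in simp_all)
    ultimately have "\<bar>g t - g 0 - t\<^sup>2 * f'' w z\<bar> \<le> t * (\<epsilon> * t)"
      using t by (simp add: abs_mult mult_left_mono)
    then show ?thesis by (simp add: g_def power2_eq_square algebra_simps)
  qed
  ultimately show ?thesis by blast
qed

text \<open>The second difference is symmetric in \<open>w\<close> and \<open>z\<close>, and divided
  by \<open>t^2\<close> it approximates both values of \<open>f''\<close>.\<close>

lemma second_derivative_symmetric:
  fixes f :: "'a::real_normed_vector \<Rightarrow> real" and D :: "'a \<Rightarrow> 'a \<Rightarrow>\<^sub>L real" and f'' :: "'a \<Rightarrow>\<^sub>L 'a \<Rightarrow>\<^sub>L real"
  assumes f: "\<forall>\<^sub>F x in nhds a. (f has_derivative D x) (at x)" and D: "(D has_derivative f'') (at a)"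
  shows "f'' w z = f'' z w"
proof -
  have "\<bar>f'' w z - f'' z w\<bar> \<le> 0 + \<epsilon>" if \<epsilon>: "\<epsilon> > 0" for \<epsilon>
  proof -
    have \<epsilon>2: "\<epsilon> / 2 > 0" using \<epsilon> by simp
    let ?\<Delta> = "\<lambda>t w z. f (a + t *\<^sub>R w + t *\<^sub>R z) - f (a + t *\<^sub>R w) - f (a + t *\<^sub>R z) + f a"
    obtain t1 where t1: "t1 > 0" "\<And>t. 0 < t \<and> t < t1 \<Longrightarrow> \<bar>?\<Delta> t w z - t\<^sup>2 * f'' w z\<bar> \<le> \<epsilon> / 2 * t\<^sup>2"
      using second_difference_approx[OF f D \<epsilon>2, of w z] by blast
    obtain t2 where t2: "t2 > 0" "\<And>t. 0 < t \<and> t < t2 \<Longrightarrow> \<bar>?\<Delta> t z w - t\<^sup>2 * f'' z w\<bar> \<le> \<epsilon> / 2 * t\<^sup>2"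
      using second_difference_approx[OF f D \<epsilon>2, of z w] by blast
    define t where "t = min t1 t2 / 2"
    have t: "0 < t" "t < t1" "t < t2" using t1(1) t2(1) by (auto simp: t_def)
    define X where "X = ?\<Delta> t w z"
    have X: "?\<Delta> t z w = X" by (simp add: X_def add_ac)
    have "\<bar>X - t\<^sup>2 * f'' w z\<bar> \<le> \<epsilon> / 2 * t\<^sup>2" unfolding X_def using t1(2)[of t] t by blast
    moreover have "\<bar>X - t\<^sup>2 * f'' z w\<bar> \<le> \<epsilon> / 2 * t\<^sup>2" unfolding X[symmetric] using t2(2)[of t] t by blast
    moreover have "\<epsilon> / 2 * t\<^sup>2 + \<epsilon> / 2 * t\<^sup>2 = t\<^sup>2 * \<epsilon>" by simp
    ultimately have "\<bar>t\<^sup>2 * f'' w z - t\<^sup>2 * f'' z w\<bar> \<le> t\<^sup>2 * \<epsilon>" by linarith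
    then have "t\<^sup>2 * \<bar>f'' w z - f'' z w\<bar> \<le> t\<^sup>2 * \<epsilon>"
      by (simp add: right_diff_distrib[symmetric] abs_mult)
    then show ?thesis using t by simp
  qed
  then have "\<bar>f'' w z - f'' z w\<bar> \<le> 0" by (rule field_le_epsilon)
  then show ?thesis by simp
qed

text \<open>The mean value theorem gives a point \<open>a + \<xi> w\<close> where the slope along
  \<open>w\<close> is nonnegative. As \<open>D a = 0\<close>, this slope is
  \<open>\<xi> f'' w w\<close> up to an error below \<open>\<xi> \<epsilon>\<close>.\<close>

lemma second_derivative_nonneg_at_min:
  fixes f :: "'a::real_normed_vector \<Rightarrow> real" and D :: "'a \<Rightarrow> 'a \<Rightarrow>\<^sub>L real" and f'' :: "'a \<Rightarrow>\<^sub>L 'a \<Rightarrow>\<^sub>L real"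
  assumes f: "\<forall>\<^sub>F x in nhds a. (f has_derivative D x) (at x)" and D: "(D has_derivative f'') (at a)"
    and min: "\<And>x. f a \<le> f x"
  shows "D a = 0" and "0 \<le> f'' w w"
proof -
  have "(f has_derivative D a) (at a)" using f by (rule eventually_nhds_x_imp_x)
  then have "blinfun_apply (D a) = (\<lambda>h. 0)"
    using min by (intro has_derivative_local_min) auto
  then show Da: "D a = 0" by (intro blinfun_eqI) simp
  obtain d1 where d1: "d1 > 0" "\<And>x. dist x a < d1 \<Longrightarrow> (f has_derivative D x) (at x)"
    using f unfolding eventually_nhds_metric by blast
  have "0 \<le> f'' w w + \<epsilon>" if \<epsilon>: "\<epsilon> > 0" for \<epsilon>
  proof -
    define K where "K = (norm w)\<^sup>2 + 1"
    have K: "K > 0" by (simp add: K_def add_nonneg_pos)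
    obtain d2 where d2: "d2 > 0"
      "\<And>y. norm (y - a) < d2 \<Longrightarrow> norm (D y - D a - f'' (y - a)) \<le> \<epsilon> / K * norm (y - a)"
      using D \<epsilon> K unfolding has_derivative_at_alt by (meson zero_less_divide_iff)
    define t where "t = min d1 d2 / (norm w + 1)"
    have n1: "0 < norm w + 1" by (simp add: add_nonneg_pos)
    have t: "t > 0" using d1 d2 n1 by (simp add: t_def)
    have near: "norm (s *\<^sub>R w) < min d1 d2" if "0 \<le> s" "s \<le> t" for s
    proof -
      have "norm (s *\<^sub>R w) \<le> t * norm w" using that by (simp add: mult_right_mono)
      also have "\<dots> < t * (norm w + 1)" using t by simp
      also have "\<dots> = min d1 d2" using n1 by (simp add: t_def)
      finally show ?thesis .
    qed
    have "\<exists>\<xi>>0. \<xi> < t \<and> f (a + t *\<^sub>R w) - f (a + 0 *\<^sub>R w) = (t - 0) * D (a + \<xi> *\<^sub>R w) w"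
    proof (rule MVT2[OF t])
      fix s assume "0 \<le> s" "s \<le> t"
      then show "((\<lambda>s. f (a + s *\<^sub>R w)) has_real_derivative D (a + s *\<^sub>R w) w) (at s)"
        using near[of s] by (intro DERIV_along_line d1(2)) (simp add: dist_norm)
    qed
    then obtain \<xi> where \<xi>: "0 < \<xi>" "\<xi> < t" "f (a + t *\<^sub>R w) - f a = t * D (a + \<xi> *\<^sub>R w) w" by auto
    have "0 \<le> t * D (a + \<xi> *\<^sub>R w) w" using \<xi>(3) min[of "a + t *\<^sub>R w"] by linarith
    then have D0: "0 \<le> D (a + \<xi> *\<^sub>R w) w" using t by (simp add: zero_le_mult_iff)
    define E where "E = D (a + \<xi> *\<^sub>R w) - D a - f'' (\<xi> *\<^sub>R w)"
    have "norm E \<le> \<epsilon> / K * (\<xi> * norm w)"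
      using d2(2)[of "a + \<xi> *\<^sub>R w"] near[of \<xi>] \<xi> by (simp add: E_def)
    then have "norm E * norm w \<le> \<epsilon> / K * (\<xi> * norm w) * norm w" by (rule mult_right_mono) simp
    moreover have "E w \<le> norm E * norm w" using norm_blinfun[of E w] by simp
    moreover have "D (a + \<xi> *\<^sub>R w) w = \<xi> * f'' w w + E w"
      by (simp add: E_def Da blinfun.diff_left blinfun.scaleR_right blinfun.scaleR_left)
    moreover have "\<epsilon> / K * (\<xi> * norm w) * norm w = \<xi> * (\<epsilon> * ((K - 1) / K))"
    proof -
      have "K - 1 = norm w * norm w" by (simp add: K_def power2_eq_square)
      then show ?thesis by simp
    qed
    moreover have "\<epsilon> * ((K - 1) / K) \<le> \<epsilon>" by (rule mult_left_le) (use \<epsilon> K in simp_all)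
    then have "\<xi> * (\<epsilon> * ((K - 1) / K)) \<le> \<xi> * \<epsilon>" using \<xi> by (intro mult_left_mono) auto
    ultimately have "0 \<le> \<xi> * f'' w w + \<xi> * \<epsilon>" using D0 by linarith
    then have "0 \<le> \<xi> * (f'' w w + \<epsilon>)" by (simp add: distrib_left)
    then show ?thesis using \<xi> by (simp add: zero_le_mult_iff)
  qed
  then show "0 \<le> f'' w w" by (rule field_le_epsilon)
qed

section \<open>Cameron-Martin coordinates of the MAP functional\<close>

lemma sqrt_op_coordinates:
  assumes C: "positive_operator C" and inj: "inj (blinfun_apply C)"
  shows "inj (blinfun_apply (sqrt_op C))" and "cm_coord C (sqrt_op C x) = x"
    and "w \<in> cm_space C \<Longrightarrow> sqrt_op C (cm_coord C w) = w"
    and "cov_norm_sq C (sqrt_op C x) = ereal ((norm x)\<^sup>2)"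
proof -
  show i: "inj (blinfun_apply (sqrt_op C))"
  proof (rule injI)
    fix x y assume "sqrt_op C x = sqrt_op C y"
    then have "C x = C y" using sqrt_op_works(2)[OF C] by (metis blinfun_apply_blinfun_compose)
    then show "x = y" using inj by (meson injD)
  qed
  show co: "cm_coord C (sqrt_op C x) = x" using i by (simp add: cm_coord_def inv_f_f)
  show "w \<in> cm_space C \<Longrightarrow> sqrt_op C (cm_coord C w) = w"
    by (simp add: cm_coord_def cm_space_def f_inv_into_f)
  show "cov_norm_sq C (sqrt_op C x) = ereal ((norm x)\<^sup>2)"
    using co by (simp add: cov_norm_sq_def cm_space_def)
qed

text \<open>The function \<open>\<Phi> (L x) + \<parallel>x\<parallel>\<^sup>2 / 2\<close> is the MAP functional in the coordinates \<open>u = L x\<close>.\<close>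

lemma derivatives_in_coordinates:
  fixes L :: "'a::real_inner \<Rightarrow>\<^sub>L 'a" and D :: "'a \<Rightarrow> 'a \<Rightarrow>\<^sub>L real" and f'' :: "'a \<Rightarrow>\<^sub>L 'a \<Rightarrow>\<^sub>L real"
  assumes \<Phi>: "twice_differentiable_at \<Phi> \<Phi>' \<Phi>'' (L a)"
    and f: "\<forall>\<^sub>F x in nhds a. ((\<lambda>x. \<Phi> (L x) + 1/2 * (norm x)\<^sup>2) has_derivative D x) (at x)"
    and D: "(D has_derivative f'') (at a)"
  shows "D a z = \<Phi>' (L z) + a \<bullet> z" and "f'' w z = \<Phi>'' (L w) (L z) + w \<bullet> z"
proof -
  obtain E where E: "\<forall>\<^sub>F u in nhds (L a). (\<Phi> has_derivative blinfun_apply (E u)) (at u)" "E (L a) = \<Phi>'"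
    "(E has_derivative blinfun_apply \<Phi>'') (at (L a))"
    using \<Phi> unfolding twice_differentiable_at_def by blast
  have "filterlim L (nhds (L a)) (nhds a)"
    by (intro blinfun.tendsto tendsto_const tendsto_ident_at filterlim_ident)
  then have E': "\<forall>\<^sub>F x in nhds a. (\<Phi> has_derivative blinfun_apply (E (L x))) (at (L x))"
    using E(1) by (rule eventually_compose_filterlim[rotated])
  have Ld: "(L has_derivative L) (at x)" for x
    by (rule bounded_linear_imp_has_derivative[OF blinfun.bounded_linear_right])
  \<comment> \<open>Uniqueness of derivatives identifies \<open>D\<close> near \<open>a\<close>. The
    identity must hold on a neighborhood because it is differentiated once more.\<close>
  have ev: "\<forall>\<^sub>F x in nhds a. \<forall>z. D x z = E (L x) (L z) + x \<bullet> z"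
    using f E'
  proof eventually_elim
    case (elim x)
    have 1: "((\<lambda>x. \<Phi> (L x)) has_derivative (\<lambda>z. E (L x) (L z))) (at x)"
      by (rule has_derivative_compose[OF Ld elim(2)])
    have "((\<lambda>x. 1/2 * (x \<bullet> x)) has_derivative (\<lambda>z. 1/2 * (x \<bullet> z + z \<bullet> x))) (at x)"
      by (intro has_derivative_mult_right has_derivative_inner has_derivative_ident)
    then have 2: "((\<lambda>x. 1/2 * (norm x)\<^sup>2) has_derivative (\<lambda>z. x \<bullet> z)) (at x)"
      by (simp add: power2_norm_eq_inner inner_commute)
    show ?case
      using has_derivative_unique[OF elim(1) has_derivative_add[OF 1 2]] by (simp add: fun_eq_iff)
  qed
  then have ev_a: "\<forall>z. D a z = E (L a) (L z) + a \<bullet> z" by (rule eventually_nhds_x_imp_x)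
  then show "D a z = \<Phi>' (L z) + a \<bullet> z" by (simp add: E(2))
  have "((\<lambda>x. E (L x)) has_derivative (\<lambda>w. \<Phi>'' (L w))) (at a)"
    by (rule has_derivative_compose[OF Ld E(3)])
  \<comment> \<open>Evaluating at a fixed \<open>z\<close> replaces operator-valued maps by scalar
    ones.\<close>
  from bounded_linear.has_derivative[OF bounded_linear_apply_blinfun this, of "L z"]
  have "((\<lambda>x. E (L x) (L z) + x \<bullet> z) has_derivative (\<lambda>w. \<Phi>'' (L w) (L z) + w \<bullet> z)) (at a)"
    by (intro has_derivative_add bounded_linear.has_derivative[OF bounded_linear_inner_left] has_derivative_ident) simp
  then have "((\<lambda>x. D x z) has_derivative (\<lambda>w. \<Phi>'' (L w) (L z) + w \<bullet> z)) (at a)"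
  proof (rule has_derivative_transform_eventually)
    show "\<forall>\<^sub>F x in at a. E (L x) (L z) + x \<bullet> z = D x z"
      using ev unfolding eventually_at_filter by eventually_elim simp
  qed (use ev_a in auto)
  moreover have "((\<lambda>x. D x z) has_derivative (\<lambda>w. f'' w z)) (at a)"
    by (rule bounded_linear.has_derivative[OF bounded_linear_apply_blinfun D])
  ultimately have "(\<lambda>w. \<Phi>'' (L w) (L z) + w \<bullet> z) = (\<lambda>w. f'' w z)" by (rule has_derivative_unique)
  then show "f'' w z = \<Phi>'' (L w) (L z) + w \<bullet> z" by metis
qed

section \<open>The Laplace approximation as a Gibbs measure\<close>

theorem proposition1:
  fixes G :: "'x::{real_inner, complete_space} \<Rightarrow> 'y::{real_inner, complete_space}"
    and P :: "'w measure" and \<eta> :: "'w \<Rightarrow> 'y" and \<Gamma> :: "'y \<Rightarrow>\<^sub>L 'y" and y :: 'y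
    and C\<^sub>0 C :: "'x \<Rightarrow>\<^sub>L 'x" and \<mu>\<^sub>0 \<mu> :: "'x measure"
    and \<Phi> :: "'x \<Rightarrow> real" and D\<Phi> :: "'x \<Rightarrow>\<^sub>L real" and H\<Phi> :: "'x \<Rightarrow>\<^sub>L 'x \<Rightarrow>\<^sub>L real"
    and I :: "'x \<Rightarrow> ereal" and HI :: "'x \<Rightarrow> 'x \<Rightarrow> real" and u_MAP :: 'x
  assumes noise: "prob_space P" "\<eta> \<in> borel_measurable P" "is_gaussian (distr P borel \<eta>) 0 \<Gamma>"
      "inj (blinfun_apply \<Gamma>)"
    and prior: "is_gaussian \<mu>\<^sub>0 0 C\<^sub>0" "inj (blinfun_apply C\<^sub>0)"
    and misfit: "\<forall>u. ereal (\<Phi> u) = data_misfit \<Gamma> G y u"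
    and posterior: "has_gibbs_density \<mu>\<^sub>0 \<Phi> \<mu>"
    and I: "I = map_functional \<Phi> C\<^sub>0"
    and u_MAP: "is_arg_min I (\<lambda>_. True) u_MAP"
    and I_C2: "cm_C2_near C\<^sub>0 I HI u_MAP"
    and \<Phi>_derivatives: "twice_differentiable_at \<Phi> D\<Phi> H\<Phi> u_MAP"
    and C: "inverse_of_form (cm_space C\<^sub>0) HI C"
  shows "(\<exists>!\<nu>. is_gaussian \<nu> u_MAP C) \<and>
    (\<forall>\<nu>. is_gaussian \<nu> u_MAP C \<longleftrightarrow> has_gibbs_density \<mu>\<^sub>0 (taylor2 \<Phi> D\<Phi> H\<Phi> u_MAP) \<nu>)"
proof -
  define L where "L = sqrt_op C\<^sub>0"
  have C0: "covariance_operator C\<^sub>0" "positive_operator C\<^sub>0" by (rule is_gaussianD[OF prior(1)])+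
  have L: "positive_operator L" "L o\<^sub>L L = C\<^sub>0" unfolding L_def by (rule sqrt_op_works[OF C0(2)])+
  note coords = sqrt_op_coordinates[OF C0(2) prior(2), folded L_def]
  interpret covariance_root L
    by unfold_locales (use L C0 positive_operator_sym in auto)
  obtain e :: "nat \<Rightarrow> 'x" where e: "basis_seq e" by (rule ex_basis_seq[OF C0(1) prior(2)])
  define a where "a = cm_coord C\<^sub>0 u_MAP"
  have u_cm: "u_MAP \<in> cm_space C\<^sub>0" using I_C2 by (simp add: cm_C2_near_def)
  have La: "L a = u_MAP" unfolding a_def by (rule coords(3)[OF u_cm])
  \<comment> \<open>On the range of \<open>L\<close> the functional \<open>I\<close> is finite, so
    the extended-real minimum becomes an ordinary minimum of \<open>f\<close>.\<close>
  define f where "f x = \<Phi> (L x) + 1/2 * (norm x)\<^sup>2" for x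
  have IL: "I (L x) = ereal (f x)" for x by (simp add: I map_functional_def coords(4) f_def)
  have f_min: "f a \<le> f x" for x
    using u_MAP IL[of x] IL[of a] unfolding is_arg_min_def La by (metis ereal_less(1) less_ereal.simps(1) not_le)
  obtain f'' where f'': "C2_near f f'' a"
    and HI: "\<And>w z. w \<in> cm_space C\<^sub>0 \<Longrightarrow> z \<in> cm_space C\<^sub>0 \<Longrightarrow> HI w z = f'' (cm_coord C\<^sub>0 w) (cm_coord C\<^sub>0 z)"
    using I_C2 unfolding cm_C2_near_def L_def[symmetric] IL a_def[symmetric] by auto
  obtain D where D: "\<forall>\<^sub>F x in nhds a. (f has_derivative blinfun_apply (D x)) (at x)"
    "(D has_derivative blinfun_apply f'') (at a)"
    using f'' unfolding C2_near_def eventually_nhds by blast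
  note min = second_derivative_nonneg_at_min[OF D f_min]
  have f''_sym: "f'' w z = f'' z w" for w z by (rule second_derivative_symmetric[OF D])
  note deriv = derivatives_in_coordinates[OF \<Phi>_derivatives[folded La] D(1)[unfolded f_def[abs_def]] D(2)]
  have first_order: "D\<Phi> (L z) = - (a \<bullet> z)" for z using deriv(1)[of z] min(1) by simp

  \<comment> \<open>The Taylor polynomial sees only the diagonal of the Hessian; its symmetric part
    has the same diagonal and yields a self-adjoint \<open>A\<close>.\<close>
  define Hs where "Hs v w = 1/2 * (H\<Phi> v w + H\<Phi> w v)" for v w
  have Hs: "bounded_bilinear Hs"
  proof
    show "\<exists>K. \<forall>v w. norm (Hs v w) \<le> norm v * norm w * K"
    proof (intro exI allI)
      fix v w
      have b: "norm (H\<Phi> v w) \<le> norm H\<Phi> * norm v * norm w" for v w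
        by (meson norm_blinfun mult_right_mono norm_ge_zero order_trans)
      show "norm (Hs v w) \<le> norm v * norm w * norm H\<Phi>"
        using b[of v w] b[of w v] by (simp add: Hs_def mult_ac)
    qed
  qed (simp_all add: Hs_def blinfun.add_left blinfun.add_right blinfun.scaleR_left blinfun.scaleR_right algebra_simps)
  obtain A :: "'x \<Rightarrow>\<^sub>L 'x" where A: "\<And>v w. Hs v w = A v \<bullet> w" by (rule operator_of_bounded_form[OF Hs]) blast
  have A_sym: "A x \<bullet> y = x \<bullet> A y" for x y
    using A[of x y] A[of y x] by (simp add: Hs_def inner_commute)
  have H_diag: "H\<Phi> v v = A v \<bullet> v" for v using A[of v v] by (simp add: Hs_def)
  \<comment> \<open>Symmetry of \<open>f''\<close> allows averaging \<open>deriv(2)\<close> over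
    both orders of the arguments, which produces \<open>Hs\<close>.\<close>
  have f''_eq: "f'' x z = x \<bullet> z + A (L x) \<bullet> L z" for x z
    using deriv(2)[of x z] deriv(2)[of z x] f''_sym[of x z] A[of "L x" "L z"]
    by (simp add: Hs_def inner_commute)
  have inv_C: "inverts C (\<lambda>x z. x \<bullet> z + A (L x) \<bullet> L z)"
    unfolding inverts_def f''_eq[symmetric]
  proof
    fix h
    have Ch: "C h \<in> cm_space C\<^sub>0" and K: "\<And>z. z \<in> cm_space C\<^sub>0 \<Longrightarrow> HI (C h) z = h \<bullet> z"
      using C by (auto simp: inverse_of_form_def)
    have "f'' (cm_coord C\<^sub>0 (C h)) z = h \<bullet> L z" for z
    proof -
      have "L z \<in> cm_space C\<^sub>0" by (simp add: cm_space_def L_def)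
      then show ?thesis using K[of "L z"] HI[OF Ch, of "L z"] by (simp add: coords(2))
    qed
    then show "\<exists>b. C h = L b \<and> (\<forall>z. f'' b z = h \<bullet> L z)" using coords(3)[OF Ch] by metis
  qed
  have nonneg: "0 \<le> x \<bullet> x + A (L x) \<bullet> L x" for x using min(2)[of x] by (simp add: f''_eq)
  have \<mu>\<^sub>0: "is_gaussian \<mu>\<^sub>0 0 (L o\<^sub>L L)" using prior(1) by (simp add: L(2))
  interpret \<mu>\<^sub>0: prob_space \<mu>\<^sub>0 by (rule is_gaussianD(1)[OF prior(1)])
  note [measurable_cong] = is_gaussianD(2)[OF prior(1)]
  note quad = gibbs_quadratic_gaussian[OF \<mu>\<^sub>0 coords(1) e A_sym nonneg inv_C]

  obtain g where g: "\<And>v. D\<Phi> v = g \<bullet> v" by (rule riesz_representation) blast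
  \<comment> \<open>Minus the linear coefficient after the Taylor polynomial is expanded around 0.
    By the first-order condition \<open>k . L z = f'' a z\<close>, so in coordinates
    \<open>C k\<close> is \<open>a\<close>.\<close>
  define k where "k = A u_MAP - g"
  have "C k = u_MAP"
  proof -
    obtain d where d: "0 < d" "\<And>x. d * (norm x)\<^sup>2 \<le> x \<bullet> x + A (L x) \<bullet> L x"
      using form_coercive[OF e coords(1) A_sym nonneg inv_C] by blast
    obtain b where b: "C k = L b" "\<And>z. f'' b z = k \<bullet> L z"
      using inv_C unfolding inverts_def f''_eq by blast
    have "k \<bullet> L z = f'' a z" for z
      using first_order[of z] by (simp add: k_def inner_diff_left f''_eq La g)
    then have "f'' (b - a) (b - a) = 0"
      using b(2) by (simp add: blinfun.diff_left blinfun.diff_right[of f''])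
    then have "d * (norm (b - a))\<^sup>2 \<le> 0" using d(2)[of "b - a"] by (simp add: f''_eq)
    then have "b = a" using d(1) by (simp add: mult_le_0_iff)
    then show ?thesis using b(1) La by simp
  qed
  define F where "F u = 1/2 * (A u \<bullet> u)" for u
  \<comment> \<open>A pure linear tilt, written as the instance \<open>a = 0\<close>,
    \<open>b = 1\<close> of \<open>gaussian_exp_quadratic\<close>; the covariance is
    unchanged.\<close>
  define T where "T u = 0 / 2 * (u \<bullet> k)\<^sup>2 - 1 * (u \<bullet> k)" for u
  have F: "integrable \<mu>\<^sub>0 (\<lambda>u. exp (- F u))" "is_gaussian (gibbs \<mu>\<^sub>0 F) 0 C"
    using quad unfolding F_def[abs_def] by blast+
  have "0 < 1 + 0 * (C k \<bullet> k)" by simp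
  note tilt = gaussian_exp_quadratic[OF F(2) this, of 1]
  have "rank_one_update C 0 k = C" by (rule blinfun_eqI) (simp add: rank_one_update_apply)
  then have tilt3: "is_gaussian (gibbs (gibbs \<mu>\<^sub>0 F) T) u_MAP C"
    using tilt(3) \<open>C k = u_MAP\<close> unfolding T_def[abs_def] by simp
  have tilt1: "integrable (gibbs \<mu>\<^sub>0 F) (\<lambda>u. exp (- T u))" using tilt(1) unfolding T_def .
  have Tm: "T \<in> borel_measurable \<mu>\<^sub>0" unfolding T_def by measurable
  note FT = gibbs_gibbs[OF \<mu>\<^sub>0.prob_space_axioms F(1) tilt1 Tm]
  define c where "c = \<Phi> u_MAP - g \<bullet> u_MAP + 1/2 * (A u_MAP \<bullet> u_MAP)"
  note FTc = gibbs_add_const[OF \<mu>\<^sub>0.prob_space_axioms FT(1), of c]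
  have taylor: "taylor2 \<Phi> D\<Phi> H\<Phi> u_MAP = (\<lambda>u. F u + T u + c)"
  proof
    fix v
    have "A (v - u_MAP) \<bullet> (v - u_MAP) = A v \<bullet> v - 2 * (A u_MAP \<bullet> v) + A u_MAP \<bullet> u_MAP"
      using A_sym[of v u_MAP]
      by (simp add: blinfun.diff_right inner_diff_left inner_diff_right inner_commute)
    then show "taylor2 \<Phi> D\<Phi> H\<Phi> u_MAP v = F v + T v + c"
      by (simp add: taylor2_def H_diag g F_def T_def c_def k_def inner_diff_right inner_diff_left inner_commute field_simps)
  qed
  let ?\<nu> = "gibbs \<mu>\<^sub>0 (taylor2 \<Phi> D\<Phi> H\<Phi> u_MAP)"
  have G: "is_gaussian ?\<nu> u_MAP C" using tilt3 unfolding taylor FTc(2) FT(2) .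
  have int: "integrable \<mu>\<^sub>0 (\<lambda>u. exp (- taylor2 \<Phi> D\<Phi> H\<Phi> u_MAP u))" unfolding taylor by (rule FTc(1))
  \<comment> \<open>Since Gaussian measures are unique, both sides of the equivalence say that the
    measure equals \<open>?\<nu>\<close>.\<close>
  have "is_gaussian \<nu> u_MAP C \<longleftrightarrow> \<nu> = ?\<nu>" for \<nu>
    using G gaussian_unique[OF e] by blast
  then show ?thesis using int by (auto simp: has_gibbs_density_iff)
qed

end
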